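(* Consider the dual risk model with causal dependence and proportional gains described in the context, with ruin probability $R(x)$ and $\rho(s)=\int_0^\infty e^{-sx}R(x)\,dx$, $\mathrm{Re}(s)>0$. For $i=0,1$ let $a_i(s)=\frac{s}{1+a_i}$, and for $l,m\ge 0$ let $a_{l,m}(s)=\frac{s}{(1+a_0)^l(1+a_1)^m}$. Let $\chi_0(s)=E(e^{-sB}1(T\ge B))$, $\chi_1(s)=E(e^{-sB}1(T<B))$, $\widehat\chi_i(s)=\frac{\chi_i(s)}{1+a_i}$, and $$L_{1,0}(s)=\widehat\chi_0(s)\sum_{i=1}^{K}q_i\frac{\mu_i}{\mu_i-a_0(s)},\qquad L_{0,1}(s)=\widehat\chi_1(s)\sum_{i=1}^{L}h_i\frac{\nu_i}{\nu_i-a_1(s)},$$ $$K(s)=\frac{1-\phi(s)}{s}-\widehat\chi_0(s)\sum_{i=1}^{K}q_i\frac{\mu_i}{\mu_i-a_0(s)}\rho(\mu_i)-\widehat\chi_1(s)\sum_{i=1}^{L}h_i\frac{\nu_i}{\nu_i-a_1(s)}\rho(\nu_i).$$ Define $L_{l,m}(s)$, $l,m\ge 0$, recursively by $L_{0,0}(s)=1$ and, for $l+m\ge 1$, $$L_{l,m}(s)=L_{l-1,m}(s)L_{1,0}(a_{l-1,m}(s))+L_{l,m-1}(s)L_{0,1}(a_{l,m-1}(s)),$$ where terms with a negative index are $0$. Then, for every $s$ with $\mathrm{Re}(s)>0$ outside the set $\{\mu_i(1+a_0)^{l+1}(1+a_1)^m,\ \nu_i(1+a_0)^{l}(1+a_1)^{m+1}: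 l,m\ge 0\}$ (all $i$), $$\rho(s)=\lim_{n\to\infty}\sum_{l=0}^{n}L_{l,n-l}(s)+\sum_{j=0}^{\infty}\sum_{l=0}^{j}L_{l,j-l}(s)K(a_{l,j-l}(s)).$$ The constants $\rho(\mu_i)$, $i=1,\dots,K$, and $\rho(\nu_i)$, $i=1,\dots,L$, are obtained from the set of linear equations derived by setting $s=\mu_i$, $i=1,\dots,K$, and $s=\nu_i$, $i=1,\dots,L$, in this identity (values at removable singularities being understood as limits).
   Context: Model. The surplus $U(t)$ starts at $U(0)=x>0$ and decreases at unit rate between gains. Gain interarrival times $B_i>0$ are i.i.d. (generic $B$) with c.d.f. $B(\cdot)$, density, Laplace–Stieltjes transform $\phi(s)=E(e^{-sB})$ and finite mean; thresholds $T_i$ are i.i.d. (generic $T$), independent of the $B_i$, with c.d.f. $T(\cdot)$. If the surplus just before the $i$-th gain is $u>0$, then it jumps to $(1+a_0)u+C_i^{(0)}$ when $T_i\ge B_i$, and to $(1+a_1)u+C_i^{(1)}$ when $T_i<B_i$. Here $a_0,a_1>0$ are constants, and the $C_i^{(0)}$ (resp. $C_i^{(1)}$) are i.i.d., independent of everything else, hyperexponential with c.d.f. $\sum_{i=1}^{K}q_i(1-e^{-\mu_i x})$ (resp. $\sum_{i=1}^{L}h_i(1-e^{-\nu_i x})$), with $q_i,h_i\geq 0$, $\sum_i q_i=\sum_i h_i=1$, $\mu_i,\nu_i>0$. Ruin occurs when the surplus hits $0$ and $R(x)$ is the probability that ruin ever occurs starting from $x$. *)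

theory Defs
  imports "HOL-Probability.Probability"
begin

section \<open>The surplus process\<close>

text \<open>
  All sequences are indexed from 0, so \<open>B n\<close>, \<open>T n\<close>, \<open>C0 n\<close>, \<open>C1 n\<close> belong to the
  \<open>(n + 1)\<close>-st gain. The index type below only serves to express joint independence of the
  four sequences.
\<close>

datatype source = Interarrival nat | Threshold nat | Gain0 nat | Gain1 nat

primrec source_var ::
  "(nat \<Rightarrow> 'a \<Rightarrow> real) \<Rightarrow> (nat \<Rightarrow> 'a \<Rightarrow> real) \<Rightarrow> (nat \<Rightarrow> 'a \<Rightarrow> real) \<Rightarrow> (nat \<Rightarrow> 'a \<Rightarrow> real)
    \<Rightarrow> source \<Rightarrow> 'a \<Rightarrow> real" where
  "source_var B T C0 C1 (Interarrival n) = B n"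
| "source_var B T C0 C1 (Threshold n) = T n"
| "source_var B T C0 C1 (Gain0 n) = C0 n"
| "source_var B T C0 C1 (Gain1 n) = C1 n"

definition gain_time :: "(nat \<Rightarrow> 'a \<Rightarrow> real) \<Rightarrow> nat \<Rightarrow> 'a \<Rightarrow> real" where
  "gain_time B n \<omega> = (\<Sum>i<n. B i \<omega>)"

text \<open>
  Surplus right after the \<open>n\<close>-th gain. The model specifies a gain only when the surplus \<open>u\<close>
  just before it is positive; otherwise ruin has already occurred. The value 0 makes
  \<open>u = 0\<close> count as a hit of 0; later values are irrelevant for the ruin event.
\<close>

primrec post_gain ::
  "real \<Rightarrow> real \<Rightarrow> (nat \<Rightarrow> 'a \<Rightarrow> real) \<Rightarrow> (nat \<Rightarrow> 'a \<Rightarrow> real) \<Rightarrow> (nat \<Rightarrow> 'a \<Rightarrow> real) \<Rightarrow>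
    (nat \<Rightarrow> 'a \<Rightarrow> real) \<Rightarrow> real \<Rightarrow> nat \<Rightarrow> 'a \<Rightarrow> real" where
  "post_gain a0 a1 B T C0 C1 x 0 \<omega> = x"
| "post_gain a0 a1 B T C0 C1 x (Suc n) \<omega> =
    (let u = post_gain a0 a1 B T C0 C1 x n \<omega> - B n \<omega> in
      if u \<le> 0 then 0
      else if T n \<omega> \<ge> B n \<omega> then (1 + a0) * u + C0 n \<omega>
      else (1 + a1) * u + C1 n \<omega>)"

definition surplus ::
  "real \<Rightarrow> real \<Rightarrow> (nat \<Rightarrow> 'a \<Rightarrow> real) \<Rightarrow> (nat \<Rightarrow> 'a \<Rightarrow> real) \<Rightarrow> (nat \<Rightarrow> 'a \<Rightarrow> real) \<Rightarrow>
    (nat \<Rightarrow> 'a \<Rightarrow> real) \<Rightarrow> real \<Rightarrow> real \<Rightarrow> 'a \<Rightarrow> real" where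
  "surplus a0 a1 B T C0 C1 x t \<omega> =
    (let n = (LEAST n. t < gain_time B (Suc n) \<omega>) in
      post_gain a0 a1 B T C0 C1 x n \<omega> - (t - gain_time B n \<omega>))"

text \<open>
  The path is determined at time \<open>t\<close> only if some gain time exceeds \<open>t\<close>. Almost surely this is
  the case for all \<open>t\<close>.
\<close>

definition ruined ::
  "real \<Rightarrow> real \<Rightarrow> (nat \<Rightarrow> 'a \<Rightarrow> real) \<Rightarrow> (nat \<Rightarrow> 'a \<Rightarrow> real) \<Rightarrow> (nat \<Rightarrow> 'a \<Rightarrow> real) \<Rightarrow>
    (nat \<Rightarrow> 'a \<Rightarrow> real) \<Rightarrow> real \<Rightarrow> 'a \<Rightarrow> bool" where
  "ruined a0 a1 B T C0 C1 x \<omega> \<longleftrightarrow>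
    (\<exists>t\<ge>0. (\<exists>n. t < gain_time B n \<omega>) \<and> surplus a0 a1 B T C0 C1 x t \<omega> = 0)"

definition ruin_prob ::
  "'a measure \<Rightarrow> real \<Rightarrow> real \<Rightarrow> (nat \<Rightarrow> 'a \<Rightarrow> real) \<Rightarrow> (nat \<Rightarrow> 'a \<Rightarrow> real) \<Rightarrow>
    (nat \<Rightarrow> 'a \<Rightarrow> real) \<Rightarrow> (nat \<Rightarrow> 'a \<Rightarrow> real) \<Rightarrow> real \<Rightarrow> real" where
  "ruin_prob M a0 a1 B T C0 C1 x =
    Sigma_Algebra.measure M {\<omega> \<in> space M. ruined a0 a1 B T C0 C1 x \<omega>}"

definition rho ::
  "'a measure \<Rightarrow> real \<Rightarrow> real \<Rightarrow> (nat \<Rightarrow> 'a \<Rightarrow> real) \<Rightarrow> (nat \<Rightarrow> 'a \<Rightarrow> real) \<Rightarrow>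
    (nat \<Rightarrow> 'a \<Rightarrow> real) \<Rightarrow> (nat \<Rightarrow> 'a \<Rightarrow> real) \<Rightarrow> complex \<Rightarrow> complex" where
  "rho M a0 a1 B T C0 C1 s =
    (LINT x:{0<..}|lborel.
      exp (- s * complex_of_real x) * complex_of_real (ruin_prob M a0 a1 B T C0 C1 x))"

section \<open>Transforms of the generic interarrival time and threshold\<close>

definition phi :: "'a measure \<Rightarrow> ('a \<Rightarrow> real) \<Rightarrow> complex \<Rightarrow> complex" where
  "phi M B s = (LINT \<omega>|M. exp (- s * complex_of_real (B \<omega>)))"

definition chi0 :: "'a measure \<Rightarrow> ('a \<Rightarrow> real) \<Rightarrow> ('a \<Rightarrow> real) \<Rightarrow> complex \<Rightarrow> complex" where
  "chi0 M B T s = (LINT \<omega>|M. exp (- s * complex_of_real (B \<omega>)) * of_bool (T \<omega> \<ge> B \<omega>))"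

definition chi1 :: "'a measure \<Rightarrow> ('a \<Rightarrow> real) \<Rightarrow> ('a \<Rightarrow> real) \<Rightarrow> complex \<Rightarrow> complex" where
  "chi1 M B T s = (LINT \<omega>|M. exp (- s * complex_of_real (B \<omega>)) * of_bool (T \<omega> < B \<omega>))"

section \<open>The coefficients\<close>

definition a_scaled :: "real \<Rightarrow> real \<Rightarrow> nat \<Rightarrow> nat \<Rightarrow> complex \<Rightarrow> complex" where
  "a_scaled a0 a1 l m s = s / complex_of_real ((1 + a0) ^ l * (1 + a1) ^ m)"

definition chi_hat :: "real \<Rightarrow> (complex \<Rightarrow> complex) \<Rightarrow> complex \<Rightarrow> complex" where
  "chi_hat a chi s = chi s / complex_of_real (1 + a)"

text \<open>
  With \<open>w = (\<lambda>_. 1)\<close> this is \<open>L\<^sub>1\<^sub>,\<^sub>0\<close> or \<open>L\<^sub>0\<^sub>,\<^sub>1\<close>; with \<open>w i\<close> in the role of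
  the constants \<open>\<rho>(\<mu>\<^sub>i)\<close> or \<open>\<rho>(\<nu>\<^sub>i)\<close> it is the corresponding term of \<open>K\<close>.
\<close>

definition gain_term ::
  "real \<Rightarrow> (complex \<Rightarrow> complex) \<Rightarrow> nat \<Rightarrow> (nat \<Rightarrow> real) \<Rightarrow> (nat \<Rightarrow> real) \<Rightarrow> (nat \<Rightarrow> complex) \<Rightarrow>
    complex \<Rightarrow> complex" where
  "gain_term a chi N p r w s =
    chi_hat a chi s *
    (\<Sum>i=1..N. complex_of_real (p i) *
      (complex_of_real (r i) / (complex_of_real (r i) - s / complex_of_real (1 + a))) * w i)"

definition K_fun ::
  "real \<Rightarrow> real \<Rightarrow> (complex \<Rightarrow> complex) \<Rightarrow> (complex \<Rightarrow> complex) \<Rightarrow> (complex \<Rightarrow> complex) \<Rightarrow>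
    nat \<Rightarrow> (nat \<Rightarrow> real) \<Rightarrow> (nat \<Rightarrow> real) \<Rightarrow> nat \<Rightarrow> (nat \<Rightarrow> real) \<Rightarrow> (nat \<Rightarrow> real) \<Rightarrow>
    (nat \<Rightarrow> complex) \<Rightarrow> (nat \<Rightarrow> complex) \<Rightarrow> complex \<Rightarrow> complex" where
  "K_fun a0 a1 ph x0 x1 K q \<mu> L h \<nu> y z s =
    (1 - ph s) / s - gain_term a0 x0 K q \<mu> y s - gain_term a1 x1 L h \<nu> z s"

fun L_coeff ::
  "real \<Rightarrow> real \<Rightarrow> (complex \<Rightarrow> complex) \<Rightarrow> (complex \<Rightarrow> complex) \<Rightarrow> nat \<Rightarrow> nat \<Rightarrow> complex \<Rightarrow> complex"
  where
  "L_coeff a0 a1 L10 L01 0 0 s = 1"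
| "L_coeff a0 a1 L10 L01 (Suc l) 0 s =
    L_coeff a0 a1 L10 L01 l 0 s * L10 (a_scaled a0 a1 l 0 s)"
| "L_coeff a0 a1 L10 L01 0 (Suc m) s =
    L_coeff a0 a1 L10 L01 0 m s * L01 (a_scaled a0 a1 0 m s)"
| "L_coeff a0 a1 L10 L01 (Suc l) (Suc m) s =
    L_coeff a0 a1 L10 L01 l (Suc m) s * L10 (a_scaled a0 a1 l (Suc m) s)
    + L_coeff a0 a1 L10 L01 (Suc l) m s * L01 (a_scaled a0 a1 (Suc l) m s)"

definition L_diag ::
  "real \<Rightarrow> real \<Rightarrow> (complex \<Rightarrow> complex) \<Rightarrow> (complex \<Rightarrow> complex) \<Rightarrow> complex \<Rightarrow> nat \<Rightarrow> complex" where
  "L_diag a0 a1 L10 L01 s n = (\<Sum>l=0..n. L_coeff a0 a1 L10 L01 l (n - l) s)"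

definition LK_diag ::
  "real \<Rightarrow> real \<Rightarrow> (complex \<Rightarrow> complex) \<Rightarrow> (complex \<Rightarrow> complex) \<Rightarrow> (complex \<Rightarrow> complex) \<Rightarrow>
    complex \<Rightarrow> nat \<Rightarrow> complex" where
  "LK_diag a0 a1 L10 L01 Kf s j =
    (\<Sum>l=0..j. L_coeff a0 a1 L10 L01 l (j - l) s * Kf (a_scaled a0 a1 l (j - l) s))"

definition series_rhs ::
  "real \<Rightarrow> real \<Rightarrow> (complex \<Rightarrow> complex) \<Rightarrow> (complex \<Rightarrow> complex) \<Rightarrow> (complex \<Rightarrow> complex) \<Rightarrow>
    complex \<Rightarrow> complex" where
  "series_rhs a0 a1 L10 L01 Kf s =
    lim (L_diag a0 a1 L10 L01 s) + (\<Sum>j. LK_diag a0 a1 L10 L01 Kf s j)"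

definition singular_points ::
  "real \<Rightarrow> real \<Rightarrow> nat \<Rightarrow> (nat \<Rightarrow> real) \<Rightarrow> nat \<Rightarrow> (nat \<Rightarrow> real) \<Rightarrow> complex set" where
  "singular_points a0 a1 K \<mu> L \<nu> =
    {complex_of_real (\<mu> i * (1 + a0) ^ (l + 1) * (1 + a1) ^ m) | i l m. i \<in> {1..K}} \<union>
    {complex_of_real (\<nu> i * (1 + a0) ^ l * (1 + a1) ^ (m + 1)) | i l m. i \<in> {1..L}}"

text \<open>
  \<open>F\<close> takes the value \<open>v\<close> at \<open>s\<close>, where on the set \<open>S\<close> of possible singularities the
  value is a limit. There the formula for \<open>F\<close> divides by 0, so \<open>F s\<close> itself is meaningless.
\<close>

definition has_value :: "complex set \<Rightarrow> (complex \<Rightarrow> complex) \<Rightarrow> complex \<Rightarrow> complex \<Rightarrow> bool" where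
  "has_value S F s v \<longleftrightarrow> (if s \<in> S then (F \<longlongrightarrow> v) (at s) else F s = v)"

text \<open>
  The linear system in the unknowns \<open>y i\<close>, \<open>z i\<close> obtained from the identity
  \<open>\<rho>(s) = F y z s\<close> at \<open>s = \<mu>\<^sub>i\<close> and \<open>s = \<nu>\<^sub>i\<close>, where \<open>F y z\<close> is the right-hand side
  with \<open>\<rho>(\<mu>\<^sub>i)\<close>, \<open>\<rho>(\<nu>\<^sub>i)\<close> replaced by the unknowns.
\<close>

definition solves_system ::
  "complex set \<Rightarrow> ((nat \<Rightarrow> complex) \<Rightarrow> (nat \<Rightarrow> complex) \<Rightarrow> complex \<Rightarrow> complex) \<Rightarrow>
    nat \<Rightarrow> (nat \<Rightarrow> real) \<Rightarrow> nat \<Rightarrow> (nat \<Rightarrow> real) \<Rightarrow>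
    (nat \<Rightarrow> complex) \<Rightarrow> (nat \<Rightarrow> complex) \<Rightarrow> bool" where
  "solves_system S F K \<mu> L \<nu> y z \<longleftrightarrow>
    (\<forall>i\<in>{1..K}. has_value S (F y z) (complex_of_real (\<mu> i)) (y i)) \<and>
    (\<forall>i\<in>{1..L}. has_value S (F y z) (complex_of_real (\<nu> i)) (z i))"

end

theory Submission
  imports Defs "HOL-Complex_Analysis.Complex_Analysis" "HOL-Real_Asymp.Real_Asymp"
begin

text \<open>
  The surplus is multiplied by at least \<open>1 + min a\<^sub>0 a\<^sub>1\<close> at every gain, so ruin from \<open>x\<close> forces a
  geometrically discounted sum of the interarrival times to exceed \<open>x\<close>. By Markov's inequality
  \<open>R(x) = O(1/x)\<close>, hence \<open>\<rho>(s) = O(1/\<surd>(Re s))\<close>. Conditioning on the first gain gives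
  \<open>\<rho> = A \<rho> + K\<close> with \<open>(A g)(s) = L\<^sub>1\<^sub>,\<^sub>0(s) g(a\<^sub>0(s)) + L\<^sub>0\<^sub>,\<^sub>1(s) g(a\<^sub>1(s))\<close>, and the diagonal sums of
  the statement are the iterates \<open>A\<^sup>n 1\<close> and \<open>A\<^sup>n K\<close>. Near 0 the factors \<open>1/(1 + a\<^sub>i)\<close> make \<open>A\<close> a
  contraction on bounded functions and on functions of order \<open>1/\<surd>(Re s)\<close>. This yields the series,
  and the limit of the diagonal sums of the \<open>L\<^sub>l\<^sub>,\<^sub>m\<close> is in fact 0.

  For the linear system, let \<open>D\<close> be the difference of two right-hand sides. If both come from
  solutions, then all singularities of \<open>D\<close> are removable, \<open>D\<close> is holomorphic on the right
  half-plane, continuous up to the imaginary axis, and \<open>O(1/|s|)\<close>. By the Poisson formula the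
  difference quotient \<open>\<mu> (D(s) - D(\<mu>)) / (\<mu> - s)\<close> has at most the \<open>L\<^sup>2\<close> norm of \<open>D\<close> on the imaginary
  axis. The homogeneous equation expresses \<open>D\<close> as a subconvex combination of such quotients,
  rescaled, which gives \<open>\<parallel>D\<parallel>\<^sup>2 \<le> \<parallel>D\<parallel>\<^sup>2 / (1 + min a\<^sub>0 a\<^sub>1)\<close> and so \<open>D = 0\<close>.
\<close>

text \<open>The weight 1/sqrt(Re s) balances two effects. The bound R <= 1 alone gives |rho(s)| <=
  1/Re s, and passing from s to s/(1 + a) then costs a factor 1 + a, which eats the whole factor
  1/(1 + a) of the coefficients. With exponent 1/2 the cost is sqrt(1 + a) and a contraction
  remains; the decay of R is what permits this exponent.

  For uniqueness the poles of the coefficients are the obstacle. Once a pole is merged with its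
  unknown into a difference quotient, the sup norm controls this quotient only up to a factor 2, too
  much when 1 + a <= 2. The L2 norm on the axis does not grow, and the rescaling costs 1 + a in the
  squared norm against a squared coefficient 1/(1 + a)^2.

  The system prescribes values only at the rates, while \<open>singular_points\<close> contains all
  their multiples by admissible powers. This suffices because the homogeneous equation determines
  the values for |s| < c R from those for |s| < R, with \<open>c\<close> the smaller of 1 + a0 and 1
  + a1. Regularity therefore spreads outwards from a half disc around 0 that is free of singular
  points.\<close>

abbreviation (input) scaled :: "real \<Rightarrow> complex \<Rightarrow> complex" where
  "scaled a s \<equiv> s / complex_of_real (1 + a)"

abbreviation (input) lexp :: "complex \<Rightarrow> real \<Rightarrow> complex" where
  "lexp s x \<equiv> exp (- s * complex_of_real x)"

abbreviation (input) RHP :: "complex set" where "RHP \<equiv> {s. Re s > 0}"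
abbreviation (input) cRHP :: "complex set" where "cRHP \<equiv> {s. Re s \<ge> 0}"

section \<open>Diagonal sums as iterates of a weighted composition operator\<close>

definition gain_op ::
  "real \<Rightarrow> real \<Rightarrow> (complex \<Rightarrow> complex) \<Rightarrow> (complex \<Rightarrow> complex) \<Rightarrow> (complex \<Rightarrow> complex) \<Rightarrow> complex \<Rightarrow> complex"
  where
  "gain_op a0 a1 L10 L01 g s =
    L10 s * g (scaled a0 s) + L01 s * g (scaled a1 s)"

lemma L_coeff_rec:
  assumes "l \<noteq> 0 \<or> m \<noteq> 0"
  shows "L_coeff a0 a1 L10 L01 l m s =
    (if l = 0 then 0 else L_coeff a0 a1 L10 L01 (l - 1) m s * L10 (a_scaled a0 a1 (l - 1) m s)) +
    (if m = 0 then 0 else L_coeff a0 a1 L10 L01 l (m - 1) s * L01 (a_scaled a0 a1 l (m - 1) s))"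
  using assms by (cases l; cases m) auto

lemma a_scaled_Suc:
  "a_scaled a0 a1 (Suc l) m s = a_scaled a0 a1 l m s / of_real (1 + a0)"
  "a_scaled a0 a1 l (Suc m) s = a_scaled a0 a1 l m s / of_real (1 + a1)"
  unfolding a_scaled_def by (simp_all add: mult_ac)

text \<open>A lattice point on diagonal n feeds the points (l + 1, m) and (l, m + 1) of diagonal n +
  1. Regrouping diagonal n + 1 by its predecessors applies the operator to the innermost function,
  which is why an arbitrary \<open>g\<close> is carried along.\<close>

lemma diag_sum_Suc:
  "(\<Sum>l=0..Suc n. L_coeff a0 a1 L10 L01 l (Suc n - l) s * g (a_scaled a0 a1 l (Suc n - l) s)) =
   (\<Sum>l=0..n. L_coeff a0 a1 L10 L01 l (n - l) s * gain_op a0 a1 L10 L01 g (a_scaled a0 a1 l (n - l) s))"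
proof -
  let ?L = "\<lambda>l m. L_coeff a0 a1 L10 L01 l m s" and ?a = "\<lambda>l m. a_scaled a0 a1 l m s"
  define c where "c l m = ?L l m * L10 (?a l m) * g (?a (Suc l) m)" for l m
  define d where "d l m = ?L l m * L01 (?a l m) * g (?a l (Suc m))" for l m
  have eq: "?L l (Suc n - l) * g (?a l (Suc n - l)) =
      (if l = 0 then 0 else c (l - 1) (Suc n - l)) + (if l = Suc n then 0 else d l (n - l))"
    if "l \<in> {0..Suc n}" for l
  proof -
    have "l \<noteq> 0 \<or> Suc n - l \<noteq> 0" "Suc n - l - 1 = n - l"
      "l \<noteq> Suc n \<Longrightarrow> Suc n - l = Suc (n - l)" "(Suc n - l = 0) = (l = Suc n)"
      using that by auto
    then show ?thesis
      by (subst L_coeff_rec) (auto simp: c_def d_def algebra_simps)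
  qed
  have "(\<Sum>l=0..Suc n. ?L l (Suc n - l) * g (?a l (Suc n - l))) =
      (\<Sum>l=0..Suc n. if l = 0 then 0 else c (l - 1) (Suc n - l)) +
      (\<Sum>l=0..Suc n. if l = Suc n then 0 else d l (n - l))"
    by (simp only: eq sum.distrib cong: sum.cong)
  also have "(\<Sum>l=0..Suc n. if l = 0 then 0 else c (l - 1) (Suc n - l)) = (\<Sum>l=0..n. c l (n - l))"
    by (subst sum.atLeast0_atMost_Suc_shift) simp
  also have "(\<Sum>l=0..Suc n. if l = Suc n then 0 else d l (n - l)) = (\<Sum>l=0..n. d l (n - l))"
    by (subst sum.atLeast0_atMost_Suc) (auto intro!: sum.cong)
  finally show ?thesis
    by (simp add: c_def d_def gain_op_def a_scaled_Suc algebra_simps flip: sum.distrib)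
qed

lemma diag_sum_eq_funpow:
  "(\<Sum>l=0..n. L_coeff a0 a1 L10 L01 l (n - l) s * g (a_scaled a0 a1 l (n - l) s)) =
   (gain_op a0 a1 L10 L01 ^^ n) g s"
proof (induction n arbitrary: g)
  case 0
  show ?case by (simp add: a_scaled_def)
next
  case (Suc n)
  show ?case
    by (simp only: diag_sum_Suc Suc.IH funpow_Suc_right o_apply)
qed

lemma LK_diag_eq_funpow:
  "LK_diag a0 a1 L10 L01 g s n = (gain_op a0 a1 L10 L01 ^^ n) g s"
  unfolding LK_diag_def by (rule diag_sum_eq_funpow)

lemma L_diag_eq_funpow:
  "L_diag a0 a1 L10 L01 s n = (gain_op a0 a1 L10 L01 ^^ n) (\<lambda>_. 1) s"
  using diag_sum_eq_funpow[of a0 a1 L10 L01 n s "\<lambda>_. 1"] by (simp add: L_diag_def)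

text \<open>Peels off the outermost application, whereas \<open>diag_sum_Suc\<close> peels off the
  innermost one. In this form an estimate at \<open>s\<close> follows by induction from estimates at
  the two scaled points.\<close>

lemma funpow_Suc_gain_op:
  "(gain_op a0 a1 L10 L01 ^^ Suc n) g s =
    L10 s * (gain_op a0 a1 L10 L01 ^^ n) g (scaled a0 s) +
    L01 s * (gain_op a0 a1 L10 L01 ^^ n) g (scaled a1 s)"
  by (subst funpow.simps(2), subst o_apply, rule gain_op_def)

lemma funpow_gain_op_diff: "(gain_op a0 a1 L10 L01 ^^ n) (\<lambda>s. f s - g s) s =
    (gain_op a0 a1 L10 L01 ^^ n) f s - (gain_op a0 a1 L10 L01 ^^ n) g s"
proof (induction n arbitrary: s)
  case (Suc n)
  show ?case
    by (simp only: funpow_Suc_gain_op Suc.IH right_diff_distrib) simp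
qed simp

section \<open>Iterates of the gain operator\<close>

text \<open>The analytic content of the model without its probability space: \<open>x0\<close>,
  \<open>x1\<close> stand for chi_0, chi_1, and \<open>p0\<close>, \<open>p1\<close> for the
  probabilities of T >= B and T < B, which dominate them on the closed half-plane.\<close>

locale gain_system =
  fixes a0 a1 p0 p1 :: real and x0 x1 :: "complex \<Rightarrow> complex" and K L :: nat
    and q \<mu> h \<nu> :: "nat \<Rightarrow> real"
  assumes a_pos: "a0 > 0" "a1 > 0"
    and p_nonneg: "p0 \<ge> 0" "p1 \<ge> 0" and p_sum: "p0 + p1 = 1"
    and q: "\<And>i. i \<in> {1..K} \<Longrightarrow> q i \<ge> 0" "(\<Sum>i=1..K. q i) = 1"
    and h: "\<And>i. i \<in> {1..L} \<Longrightarrow> h i \<ge> 0" "(\<Sum>i=1..L. h i) = 1"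
    and \<mu>: "\<And>i. i \<in> {1..K} \<Longrightarrow> \<mu> i > 0"
    and \<nu>: "\<And>i. i \<in> {1..L} \<Longrightarrow> \<nu> i > 0"
    and x0_bound: "\<And>s. Re s \<ge> 0 \<Longrightarrow> cmod (x0 s) \<le> p0"
    and x1_bound: "\<And>s. Re s \<ge> 0 \<Longrightarrow> cmod (x1 s) \<le> p1"
    and x0_cont: "continuous_on cRHP x0"
    and x1_cont: "continuous_on cRHP x1"
    and x0_hol: "x0 holomorphic_on RHP"
    and x1_hol: "x1 holomorphic_on RHP"
begin

abbreviation "L10 \<equiv> gain_term a0 x0 K q \<mu> (\<lambda>_. 1)"
abbreviation "L01 \<equiv> gain_term a1 x1 L h \<nu> (\<lambda>_. 1)"
abbreviation "A \<equiv> gain_op a0 a1 L10 L01"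
abbreviation "S \<equiv> singular_points a0 a1 K \<mu> L \<nu>"

text \<open>The least scaling factor: each passage to a scaled point divides the modulus by at least
  \<open>c\<close>.\<close>

definition c where "c = 1 + min a0 a1"

lemma c_gt_1: "c > 1" and c_le: "c \<le> 1 + a0" "c \<le> 1 + a1"
  using a_pos by (auto simp: c_def)

lemma rate_lower:
  obtains m where "m > 0" "\<And>i. i \<in> {1..K} \<Longrightarrow> m \<le> \<mu> i" "\<And>i. i \<in> {1..L} \<Longrightarrow> m \<le> \<nu> i"
proof -
  define F where "F = insert 1 (\<mu> ` {1..K} \<union> \<nu> ` {1..L})"
  have "finite F" "F \<noteq> {}" by (auto simp: F_def)
  moreover have "\<forall>x\<in>F. x > 0" using \<mu> \<nu> by (auto simp: F_def)
  ultimately have "Min F > 0" by (subst Min_gr_iff) auto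
  moreover have "\<And>x. x \<in> F \<Longrightarrow> Min F \<le> x" using \<open>finite F\<close> by auto
  moreover have "\<mu> ` {1..K} \<subseteq> F" "\<nu> ` {1..L} \<subseteq> F" by (auto simp: F_def)
  ultimately show ?thesis
    by (intro that[of "Min F"]) blast+
qed

end

text \<open>The phases are averaged with weights of sum 1, and r/(r - d) decreases in r, so the
  smallest rate gives the worst case m/(m - d). The factor 1/(1 + a) comes from
  \<open>chi_hat\<close>.\<close>

lemma gain_term_bound_near_0:
  fixes a m d :: real
  assumes a: "a > 0" and p: "\<And>i. i \<in> {1..N} \<Longrightarrow> p i \<ge> 0" "(\<Sum>i=1..N. p i) = 1"
    and r: "\<And>i. i \<in> {1..N} \<Longrightarrow> m \<le> r i" and m: "m > 0"
    and d: "d < m" and s: "cmod s \<le> d" and x: "cmod (x s) \<le> P"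
  shows "cmod (gain_term a x N p r (\<lambda>_. 1) s) \<le> P / (1 + a) * (m / (m - d))"
proof -
  have *: "cmod (of_real (r i) / (of_real (r i) - scaled a s)) \<le> m / (m - d)"
    if "i \<in> {1..N}" for i
  proof -
    have ri: "r i \<ge> m" using r that by blast
    have sa: "cmod (scaled a s) \<le> d"
    proof -
      have "cmod (scaled a s) = cmod s / (1 + a)"
        using a by (simp only: norm_divide norm_of_real)
      also have "\<dots> \<le> cmod s" using a by (simp add: divide_le_eq algebra_simps)
      finally show ?thesis using s by simp
    qed
    have "r i - d \<le> cmod (of_real (r i) - scaled a s)"
      using norm_triangle_ineq2[of "of_real (r i)" "scaled a s"] sa ri m
      by simp
    then have "cmod (of_real (r i) / (of_real (r i) - scaled a s)) \<le> r i / (r i - d)"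
      using ri m d by (simp only: norm_divide) (intro divide_mono, auto)
    also have "\<dots> \<le> m / (m - d)"
    proof -
      have "d \<ge> 0" using s norm_ge_zero order_trans by blast
      then have "m * d \<le> r i * d" using ri by (simp add: mult_right_mono)
      then show ?thesis using ri m d by (simp add: field_simps)
    qed
    finally show ?thesis .
  qed
  have "cmod (\<Sum>i=1..N. of_real (p i) *
      (of_real (r i) / (of_real (r i) - scaled a s)) * 1) \<le>
      (\<Sum>i=1..N. p i * (m / (m - d)))"
  proof (rule sum_norm_le)
    fix i assume i: "i \<in> {1..N}"
    show "cmod (of_real (p i) *
      (of_real (r i) / (of_real (r i) - scaled a s)) * 1) \<le> p i * (m / (m - d))"
      unfolding norm_mult[of "of_real (p i)"] mult_1_right
      using p(1)[OF i] *[OF i] by (simp only: norm_of_real abs_of_nonneg mult_left_mono)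
  qed
  also have "\<dots> = m / (m - d)" by (simp only: sum_distrib_right[symmetric] p(2) mult_1_left)
  finally have 1: "cmod (\<Sum>i=1..N. of_real (p i) *
      (of_real (r i) / (of_real (r i) - scaled a s)) * 1) \<le> m / (m - d)" .
  have "cmod (chi_hat a x s) \<le> P / (1 + a)"
    unfolding chi_hat_def norm_divide norm_of_real using a x by (simp add: divide_right_mono)
  then show ?thesis
    unfolding gain_term_def norm_mult[of "chi_hat a x s"]
    using 1 x a by (intro mult_mono) (auto intro: order_trans[OF norm_ge_zero])
qed

context gain_system
begin

text \<open>Near 0 the coefficients have modulus at most about p0/(1 + a0) and p1/(1 + a1). Even
  after weighting by sqrt(1 + a) their sum is close to at most 1/sqrt c < 1, which leaves room for a
  contraction on a small half disc.\<close>

lemma contraction_radius: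
  obtains d r where "d > 0" "0 < r" "r < 1"
    "\<And>i. i \<in> {1..K} \<Longrightarrow> d < \<mu> i" "\<And>i. i \<in> {1..L} \<Longrightarrow> d < \<nu> i"
    "\<And>s. Re s \<ge> 0 \<Longrightarrow> cmod s \<le> d \<Longrightarrow> sqrt (1 + a0) * cmod (L10 s) + sqrt (1 + a1) * cmod (L01 s) \<le> r"
    "\<And>s. Re s \<ge> 0 \<Longrightarrow> cmod s \<le> d \<Longrightarrow> cmod (L10 s) + cmod (L01 s) \<le> r"
proof -
  obtain m where m: "m > 0" "\<And>i. i \<in> {1..K} \<Longrightarrow> m \<le> \<mu> i" "\<And>i. i \<in> {1..L} \<Longrightarrow> m \<le> \<nu> i"
    using rate_lower by blast
  define t where "t = sqrt c"
  have t: "t > 1" using c_gt_1 by (simp add: t_def)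
  define u where "u = (t + 1) / 2"
  have u: "1 < u" "u < t" using t by (auto simp: u_def)
  \<comment> \<open>Solves m/(m - d) = u. As u lies strictly below t = sqrt c, the loss u from the
    poles is outweighed and the ratio is u/t < 1.\<close>
  define d where "d = m * (1 - 1 / u)"
  have d: "0 < d" "d < m" "m / (m - d) = u"
    using u m by (auto simp: d_def field_simps)
  define r where "r = u / t"
  have r: "0 < r" "r < 1" using u t by (auto simp: r_def)
  have main: "sqrt (1 + a0) * cmod (L10 s) + sqrt (1 + a1) * cmod (L01 s) \<le> r"
    if s: "Re s \<ge> 0" "cmod s \<le> d" for s
  proof -
    have 0: "cmod (L10 s) \<le> p0 / (1 + a0) * u"
      using gain_term_bound_near_0[where x = x0, OF a_pos(1) q m(2,1) d(2) s(2) x0_bound[OF s(1)]] d(3) by simp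
    have 1: "cmod (L01 s) \<le> p1 / (1 + a1) * u"
      using gain_term_bound_near_0[where x = x1, OF a_pos(2) h m(3,1) d(2) s(2) x1_bound[OF s(1)]] d(3) by simp
    have aux: "sqrt (1 + a) * (p / (1 + a) * u) \<le> p * r" if "c \<le> 1 + a" "p \<ge> 0" for a p
    proof -
      have "t \<le> sqrt (1 + a)" using that by (simp add: t_def)
      have pos: "1 + a > 0" using that c_gt_1 by simp
      have "sqrt (1 + a) * (p / (1 + a) * u) = p * (u / sqrt (1 + a))"
        using pos real_sqrt_mult_self[of "1 + a"] by (simp add: field_simps)
      also have "\<dots> \<le> p * (u / t)"
        using that t u \<open>t \<le> sqrt (1 + a)\<close> pos by (intro mult_left_mono divide_left_mono) auto
      finally show ?thesis by (simp add: r_def)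
    qed
    have "sqrt (1 + a0) * cmod (L10 s) + sqrt (1 + a1) * cmod (L01 s) \<le> p0 * r + p1 * r"
      using aux[OF c_le(1) p_nonneg(1)] aux[OF c_le(2) p_nonneg(2)] 0 1 a_pos
        mult_left_mono[OF 0, of "sqrt (1 + a0)"] mult_left_mono[OF 1, of "sqrt (1 + a1)"] by simp
    also have "\<dots> = r" using p_sum by (simp flip: distrib_right)
    finally show ?thesis .
  qed
  show ?thesis
  proof (rule that[OF d(1) r _ _ main])
    fix s assume s: "Re s \<ge> 0" "cmod s \<le> d"
    have "cmod (L10 s) \<le> sqrt (1 + a0) * cmod (L10 s)" "cmod (L01 s) \<le> sqrt (1 + a1) * cmod (L01 s)"
      using a_pos by (auto intro!: mult_right_le_one_le mult_le_cancel_right1[THEN iffD2])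
    then show "cmod (L10 s) + cmod (L01 s) \<le> r" using main[OF s] by simp
  qed (use m d in force)+
qed

lemma scaled_region:
  assumes "Re s \<ge> 0" "a > 0"
  shows "Re (scaled a s) \<ge> 0" "Re (scaled a s) = Re s / (1 + a)"
    "cmod (scaled a s) = cmod s / (1 + a)" "cmod s / (1 + a) \<le> cmod s"
proof -
  show *: "Re (scaled a s) = Re s / (1 + a)" by (rule Re_divide_of_real)
  show "Re (scaled a s) \<ge> 0" unfolding * using assms by simp
  show "cmod (scaled a s) = cmod s / (1 + a)"
    using assms by (simp only: norm_divide norm_of_real)
  show "cmod s / (1 + a) \<le> cmod s"
    using assms by (simp add: divide_le_eq algebra_simps)
qed

lemma funpow_bounded:
  assumes d: "\<And>s. Re s \<ge> 0 \<Longrightarrow> cmod s \<le> d \<Longrightarrow> cmod (L10 s) + cmod (L01 s) \<le> r"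
    and r: "r > 0"
    and g: "\<And>s. Re s \<ge> 0 \<Longrightarrow> cmod s \<le> d \<Longrightarrow> cmod (g s) \<le> C"
    and s: "Re s \<ge> 0" "cmod s \<le> d"
  shows "cmod ((A ^^ n) g s) \<le> C * r ^ n"
  using s
proof (induction n arbitrary: s)
  case (Suc n)
  have C: "C * r ^ n \<ge> 0" using order_trans[OF norm_ge_zero g[OF Suc.prems]] r by simp
  note reg = scaled_region[OF Suc.prems(1) a_pos(1)] scaled_region[OF Suc.prems(1) a_pos(2)]
  have IH: "cmod ((A ^^ n) g (scaled a0 s)) \<le> C * r ^ n"
    "cmod ((A ^^ n) g (scaled a1 s)) \<le> C * r ^ n"
    using reg Suc.prems by (auto intro!: Suc.IH simp del: of_real_add)
  have "cmod ((A ^^ Suc n) g s) \<le> cmod (L10 s) * (C * r ^ n) + cmod (L01 s) * (C * r ^ n)"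
    using IH unfolding funpow_Suc_gain_op
    by (intro order_trans[OF norm_triangle_ineq] add_mono; simp only: norm_mult; intro mult_left_mono; simp only: norm_ge_zero)
  also have "\<dots> = (cmod (L10 s) + cmod (L01 s)) * (C * r ^ n)" by (simp add: algebra_simps)
  also have "\<dots> \<le> r * (C * r ^ n)" using d[OF Suc.prems] C by (rule mult_right_mono)
  finally show ?case by (simp add: algebra_simps)
qed (use g in simp)

text \<open>Replacing s by s/(1 + a) multiplies 1/sqrt(Re s) by sqrt(1 + a); these are exactly the
  weights in the first assumption.\<close>

lemma funpow_sqrt_bounded:
  assumes d: "\<And>s. Re s \<ge> 0 \<Longrightarrow> cmod s \<le> d \<Longrightarrow> sqrt (1 + a0) * cmod (L10 s) + sqrt (1 + a1) * cmod (L01 s) \<le> r"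
    and r: "r > 0"
    and g: "\<And>s. Re s > 0 \<Longrightarrow> cmod (g s) \<le> C / sqrt (Re s)" and C: "C \<ge> 0"
    and s: "Re s > 0" "cmod s \<le> d"
  shows "cmod ((A ^^ n) g s) \<le> C * r ^ n / sqrt (Re s)"
  using s
proof (induction n arbitrary: s)
  case (Suc n)
  let ?C = "C * r ^ n / sqrt (Re s)"
  have nn: "Re s \<ge> 0" using Suc.prems by simp
  note reg = scaled_region[OF nn a_pos(1)] scaled_region[OF nn a_pos(2)]
  have pos: "Re (scaled a0 s) > 0" "Re (scaled a1 s) > 0"
    using reg(2,6) Suc.prems a_pos by (auto simp del: of_real_add)
  have IH: "cmod ((A ^^ n) g (scaled a0 s)) \<le> sqrt (1 + a0) * ?C"
    "cmod ((A ^^ n) g (scaled a1 s)) \<le> sqrt (1 + a1) * ?C"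
    using Suc.IH[OF pos(1)] Suc.IH[OF pos(2)] reg Suc.prems
    by (auto simp: real_sqrt_divide field_simps simp del: of_real_add)
  have "cmod ((A ^^ Suc n) g s) \<le> cmod (L10 s) * (sqrt (1 + a0) * ?C) + cmod (L01 s) * (sqrt (1 + a1) * ?C)"
    using IH unfolding funpow_Suc_gain_op
    by (intro order_trans[OF norm_triangle_ineq] add_mono; simp only: norm_mult; intro mult_left_mono; simp only: norm_ge_zero)
  also have "\<dots> = (sqrt (1 + a0) * cmod (L10 s) + sqrt (1 + a1) * cmod (L01 s)) * ?C" by (simp add: algebra_simps)
  also have "\<dots> \<le> r * ?C" using d[OF nn Suc.prems(2)] C r nn by (intro mult_right_mono) auto
  finally show ?case by (simp add: algebra_simps)
qed (use g in simp)

text \<open>Repeated division by 1 + a0 or 1 + a1, in any order, brings each point into the disc of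
  radius \<open>d\<close>. The proof is an induction on n over the half discs of radius d *
  c^n.\<close>

lemma scaling_induct [consumes 2, case_names small step]:
  assumes s: "Re s \<ge> 0" and d: "d > 0"
    and base: "\<And>s. Re s \<ge> 0 \<Longrightarrow> cmod s \<le> d \<Longrightarrow> P s"
    and step: "\<And>s. Re s \<ge> 0 \<Longrightarrow> P (scaled a0 s) \<Longrightarrow> P (scaled a1 s) \<Longrightarrow> P s"
  shows "P s"
proof -
  have *: "\<forall>s. Re s \<ge> 0 \<longrightarrow> cmod s \<le> d * c ^ n \<longrightarrow> P s" for n
  proof (induction n)
    case (Suc n)
    show ?case
    proof (intro allI impI)
      fix s assume s: "Re s \<ge> 0" "cmod s \<le> d * c ^ Suc n"
      have "cmod s / (1 + a) \<le> d * c ^ n" if "c \<le> 1 + a" for a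
      proof -
        have "cmod s / (1 + a) \<le> cmod s / c"
          using that c_gt_1 by (intro divide_left_mono) auto
        also have "\<dots> \<le> d * c ^ n" using s c_gt_1 by (simp add: field_simps)
        finally show ?thesis .
      qed
      then show "P s"
        using Suc s scaled_region[OF s(1) a_pos(1)] scaled_region[OF s(1) a_pos(2)] c_le
        by (rule_tac step) (auto simp del: of_real_add)
    qed
  qed (use base in auto)
  obtain n where "cmod s / d < c ^ n" using real_arch_pow[OF c_gt_1] by blast
  then have "cmod s \<le> d * c ^ n" using d by (simp add: field_simps)
  with * s show ?thesis by blast
qed

text \<open>Valid at every \<open>s\<close>, also on the singular set: where a denominator vanishes,
  the coefficient takes the value that x / 0 = 0 gives it, and the recursion holds as an identity of
  total functions.\<close>

lemma summable_funpow_step: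
  assumes "summable (\<lambda>n. (A ^^ n) g (scaled a0 s))"
    "summable (\<lambda>n. (A ^^ n) g (scaled a1 s))"
  shows "summable (\<lambda>n. (A ^^ n) g s)"
proof -
  have "summable (\<lambda>n. (A ^^ Suc n) g s)"
    unfolding funpow_Suc_gain_op by (intro summable_add summable_mult assms)
  then show ?thesis by (subst (asm) summable_Suc_iff)
qed

lemma summable_funpow:
  assumes e: "e > 0" and g: "\<And>s. Re s \<ge> 0 \<Longrightarrow> cmod s \<le> e \<Longrightarrow> cmod (g s) \<le> C" and s: "Re s \<ge> 0"
  shows "summable (\<lambda>n. (A ^^ n) g s)"
proof -
  obtain d r where d: "d > 0" "0 < r" "r < 1"
    "\<And>s. Re s \<ge> 0 \<Longrightarrow> cmod s \<le> d \<Longrightarrow> cmod (L10 s) + cmod (L01 s) \<le> r"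
    using contraction_radius by metis
  have "min d e > 0" using d e by simp
  with s show ?thesis
  proof (induction rule: scaling_induct)
    case (small s)
    have "cmod ((A ^^ n) g s) \<le> C * r ^ n" for n
      using small d g by (intro funpow_bounded[where d = "min d e"]) auto
    moreover have "summable (\<lambda>n. C * r ^ n)" using d by (intro summable_mult summable_geometric) auto
    ultimately show ?case by (rule summable_comparison_test'[where N = 0, rotated])
  qed (rule summable_funpow_step)
qed

lemma funpow_sqrt_tendsto_0:
  assumes g: "\<And>s. Re s > 0 \<Longrightarrow> cmod (g s) \<le> C / sqrt (Re s)" and C: "C \<ge> 0" and s: "Re s > 0"
  shows "(\<lambda>n. (A ^^ n) g s) \<longlonglongrightarrow> 0"
proof -
  obtain d r where d: "d > 0" "0 < r" "r < 1"
    "\<And>s. Re s \<ge> 0 \<Longrightarrow> cmod s \<le> d \<Longrightarrow> sqrt (1 + a0) * cmod (L10 s) + sqrt (1 + a1) * cmod (L01 s) \<le> r"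
    using contraction_radius by metis
  have "Re s \<ge> 0" using s by simp
  \<comment> \<open>Summability is stronger than needed but passes from the scaled points to s by
    \<open>summable_funpow_step\<close>. Strict positivity of the real part is part of the claim
    because the induction ranges over the closed half-plane.\<close>
  then have "Re s > 0 \<longrightarrow> summable (\<lambda>n. (A ^^ n) g s)"
    using d(1)
  proof (induction rule: scaling_induct)
    case (small s)
    show ?case
    proof
      assume s: "Re s > 0"
      have "cmod ((A ^^ n) g s) \<le> C * r ^ n / sqrt (Re s)" for n
        using small d g C s by (intro funpow_sqrt_bounded[where d = d]) auto
      moreover have "summable (\<lambda>n. C * r ^ n / sqrt (Re s))"
        using d by (intro summable_divide summable_mult summable_geometric) auto
      ultimately show "summable (\<lambda>n. (A ^^ n) g s)"
        by (rule summable_comparison_test'[where N = 0, rotated])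
    qed
  next
    case (step s)
    have "Re (scaled a s) > 0" if "Re s > 0" "a > 0" for a
      using that by (simp only: Re_divide_of_real) simp
    with a_pos have "Re s > 0 \<Longrightarrow> Re (scaled a0 s) > 0"
      "Re s > 0 \<Longrightarrow> Re (scaled a1 s) > 0"
      by blast+
    then show ?case
      using step(2,3) by (iprover intro: summable_funpow_step[of g s])
  qed
  then show ?thesis using s by (auto intro: summable_LIMSEQ_zero)
qed

text \<open>The singular set is closed under multiplication by 1 + a0 and 1 + a1, so its complement
  is closed under the scalings. The poles of the coefficients themselves are the members with the
  lowest exponents.\<close>

lemma S_scaled:
  assumes "s \<notin> S"
  shows "scaled a0 s \<notin> S" "scaled a1 s \<notin> S"
    "i \<in> {1..K} \<Longrightarrow> scaled a0 s \<noteq> of_real (\<mu> i)"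
    "i \<in> {1..L} \<Longrightarrow> scaled a1 s \<noteq> of_real (\<nu> i)"
proof -
  have *: "s = of_real (x * (1 + a))" if "scaled a s = of_real x" "a > 0" for x a
  proof -
    have "of_real (1 + a) \<noteq> 0" using that(2) by (simp only: of_real_eq_0_iff)
    then have "s = of_real x * of_real (1 + a)" using that(1) by (metis nonzero_divide_eq_eq)
    then show ?thesis by (simp only: of_real_mult)
  qed
  have mem: "z \<in> S \<longleftrightarrow> (\<exists>l m. (\<exists>i\<in>{1..K}. z = of_real (\<mu> i * (1 + a0) ^ (l + 1) * (1 + a1) ^ m)) \<or>
      (\<exists>i\<in>{1..L}. z = of_real (\<nu> i * (1 + a0) ^ l * (1 + a1) ^ (m + 1))))" for z
    unfolding singular_points_def by blast
  have up0: "x * (1 + a0) ^ l * (1 + a1) ^ m * (1 + a0) = x * (1 + a0) ^ Suc l * (1 + a1) ^ m"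
    and up1: "x * (1 + a0) ^ l * (1 + a1) ^ m * (1 + a1) = x * (1 + a0) ^ l * (1 + a1) ^ Suc m" for x l m
    by simp_all
  show "scaled a0 s \<notin> S"
    using assms *[OF _ a_pos(1)] unfolding mem by (metis up0 add_Suc)
  show "scaled a1 s \<notin> S"
    using assms *[OF _ a_pos(2)] unfolding mem by (metis up1 add_Suc)
  show "scaled a0 s \<noteq> of_real (\<mu> i)" if "i \<in> {1..K}"
  proof
    assume "scaled a0 s = of_real (\<mu> i)"
    then have "s = of_real (\<mu> i * (1 + a0) ^ (0 + 1) * (1 + a1) ^ 0)"
      using *[of a0] a_pos by simp
    then show False using assms that unfolding singular_points_def by blast
  qed
  show "scaled a1 s \<noteq> of_real (\<nu> i)" if "i \<in> {1..L}"
  proof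
    assume "scaled a1 s = of_real (\<nu> i)"
    then have "s = of_real (\<nu> i * (1 + a0) ^ 0 * (1 + a1) ^ (0 + 1))"
      using *[of a1] a_pos by simp
    then show False using assms that unfolding singular_points_def by blast
  qed
qed

lemma lim_L_diag:
  assumes "Re s \<ge> 0"
  shows "L_diag a0 a1 L10 L01 s \<longlonglongrightarrow> 0"
proof -
  have "summable (\<lambda>n. (A ^^ n) (\<lambda>_. 1) s)"
    by (rule summable_funpow[of 1 _ 1]) (use assms in simp_all)
  then show ?thesis
    by (simp only: L_diag_eq_funpow[symmetric] summable_LIMSEQ_zero)
qed

text \<open>Iterating the equation n times leaves the remainder (A^n F)(s), which vanishes in the
  limit by the growth bound on \<open>F\<close>. The equation is invoked at scaled points only,
  which stay outside the singular set.\<close>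

theorem series_representation:
  assumes F: "\<And>s. Re s > 0 \<Longrightarrow> s \<notin> S \<Longrightarrow> F s = A F s + G s"
    and F_bound: "\<And>s. Re s > 0 \<Longrightarrow> cmod (F s) \<le> C / sqrt (Re s)" "C \<ge> 0"
    and s: "Re s > 0" "s \<notin> S"
  shows "LK_diag a0 a1 L10 L01 G s sums F s"
proof -
  have "F s = (A ^^ n) F s + (\<Sum>j<n. (A ^^ j) G s)" for n
    using s
  proof (induction n arbitrary: s)
    case (Suc n)
    have pos: "Re (scaled a0 s) > 0" "Re (scaled a1 s) > 0"
      using scaled_region[of s a0] scaled_region[of s a1] Suc.prems a_pos by (auto simp del: of_real_add)
    let ?u = "scaled a0 s" and ?v = "scaled a1 s"
    have u: "F ?u = (A ^^ n) F ?u + (\<Sum>j<n. (A ^^ j) G ?u)"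
      by (rule Suc.IH[OF pos(1) S_scaled(1)[OF Suc.prems(2)]])
    have v: "F ?v = (A ^^ n) F ?v + (\<Sum>j<n. (A ^^ j) G ?v)"
      by (rule Suc.IH[OF pos(2) S_scaled(2)[OF Suc.prems(2)]])
    have "A F s = L10 s * F ?u + L01 s * F ?v"
      by (rule gain_op_def)
    also have "L10 s * F ?u = L10 s * (A ^^ n) F ?u + (\<Sum>j<n. L10 s * (A ^^ j) G ?u)"
      by (subst u) (simp only: distrib_left sum_distrib_left)
    also have "L01 s * F ?v = L01 s * (A ^^ n) F ?v + (\<Sum>j<n. L01 s * (A ^^ j) G ?v)"
      by (subst v) (simp only: distrib_left sum_distrib_left)
    finally have "A F s = (A ^^ Suc n) F s + (\<Sum>j<n. (A ^^ Suc j) G s)"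
      by (simp only: funpow_Suc_gain_op sum.distrib add_ac)
    moreover have "F s = A F s + G s" using F Suc.prems by blast
    moreover have "(\<Sum>j<Suc n. (A ^^ j) G s) = G s + (\<Sum>j<n. (A ^^ Suc j) G s)"
      by (subst sum.lessThan_Suc_shift) (simp only: funpow_0)
    ultimately show ?case
      by (simp only: add_ac)
  qed simp
  then have "(\<Sum>j<n. (A ^^ j) G s) = F s - (A ^^ n) F s" for n by (metis add_diff_cancel_left')
  moreover have "(\<lambda>n. F s - (A ^^ n) F s) \<longlonglongrightarrow> F s - 0"
    by (intro tendsto_intros funpow_sqrt_tendsto_0[OF F_bound s(1)])
  ultimately show ?thesis
    by (simp only: sums_def LK_diag_eq_funpow diff_zero)
qed

end

section \<open>Bounded analytic functions on the right half-plane\<close>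

lemma
  fixes m :: real
  assumes m: "m > 0"
  shows integrable_inverse_square_plus: "integrable lborel (\<lambda>x. 1 / (m\<^sup>2 + x\<^sup>2))"
    and integral_inverse_square_plus: "(\<integral>x. 1 / (m\<^sup>2 + x\<^sup>2) \<partial>lborel) = pi / m"
proof -
  have 1: "integrable lborel (\<lambda>x::real. inverse (1 + x\<^sup>2))"
    using integrable_inverse_1_plus_square by (simp add: set_integrable_def)
  have 2: "(\<integral>x. inverse (1 + x\<^sup>2) \<partial>lborel) = pi"
    using LBINT_inverse_1_plus_square
    by (simp add: interval_lebesgue_integral_def set_lebesgue_integral_def)
  have eq: "1 / (m\<^sup>2 + (0 + m * x)\<^sup>2) = inverse (m\<^sup>2) * inverse (1 + x\<^sup>2)" for x
    by (simp add: power_mult_distrib field_simps)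
  show "integrable lborel (\<lambda>x. 1 / (m\<^sup>2 + x\<^sup>2))"
  proof (subst lborel_integrable_real_affine_iff[where c = m and t = 0, symmetric])
    show "integrable lborel (\<lambda>x. 1 / (m\<^sup>2 + (0 + m * x)\<^sup>2))"
      unfolding eq using 1 by (intro integrable_mult_right)
  qed (use m in simp)
  show "(\<integral>x. 1 / (m\<^sup>2 + x\<^sup>2) \<partial>lborel) = pi / m"
  proof -
    have "(\<integral>x. 1 / (m\<^sup>2 + x\<^sup>2) \<partial>lborel) = \<bar>m\<bar> *\<^sub>R (\<integral>x. 1 / (m\<^sup>2 + (0 + m * x)\<^sup>2) \<partial>lborel)"
      using m by (intro lborel_integral_real_affine) simp
    also have "\<dots> = \<bar>m\<bar> *\<^sub>R (inverse (m\<^sup>2) * pi)"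
      by (simp only: eq integral_mult_right_zero 2)
    also have "\<dots> = pi / m" using m by (simp add: field_simps power2_eq_square)
    finally show ?thesis .
  qed
qed

text \<open>\<open>X\<close> may contain boundary points where \<open>f\<close> is merely
  continuous. Holomorphy matters only at \<open>r\<close>, where the singularity is
  removable.\<close>

lemma continuous_on_difference_quotient:
  assumes cont: "continuous_on X f" and hol: "f holomorphic_on U" "open U" "r \<in> U"
  shows "continuous_on X (\<lambda>z. if z = r then deriv f r else (f z - f r) / (z - r))" (is "continuous_on X ?q")
  unfolding continuous_on_eq_continuous_within
proof
  fix z assume z: "z \<in> X"
  show "continuous (at z within X) ?q"
  proof (cases "z = r")
    case True
    have "?q holomorphic_on U" using hol by (intro pole_lemma) (auto simp: interior_open)
    then have "isCont ?q r"
      using hol holomorphic_on_imp_continuous_on continuous_on_eq_continuous_at by blast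
    then show ?thesis unfolding True by (rule continuous_at_imp_continuous_at_within)
  next
    case False
    have "continuous (at z within X) (\<lambda>z. (f z - f r) / (z - r))"
      using cont z False by (intro continuous_intros) (auto simp: continuous_on_eq_continuous_within)
    then show ?thesis
      by (rule continuous_transform_within[where \<delta> = "dist z r"]) (use z False in \<open>auto simp: dist_commute\<close>)
  qed
qed

text \<open>Cauchy's theorem on the closed upper half disc, in the version that asks only for
  continuity up to the boundary: the integral over the diameter cancels the one over the arc, which
  has length R * pi.\<close>

lemma half_disc_integral:
  fixes F :: "complex \<Rightarrow> complex" and R :: real
  assumes R: "R > 0" and cont: "continuous_on (cball 0 R \<inter> {z. Im z \<ge> 0}) F"
    and fin: "finite X" and hol: "\<And>z. z \<in> ball 0 R \<inter> {z. Im z > 0} - X \<Longrightarrow> F field_differentiable at z"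
    and bound: "\<And>z. cmod z = R \<Longrightarrow> Im z \<ge> 0 \<Longrightarrow> cmod (F z) \<le> C" and C: "C \<ge> 0"
  shows "cmod (integral {-R..R} (\<lambda>x. F (of_real x))) \<le> C * R * pi"
proof -
  let ?S = "cball 0 R \<inter> {z. Im z \<ge> 0}"
  let ?l = "linepath (of_real (-R)) (of_real R)" and ?c = "part_circlepath 0 R 0 pi"
  have conv: "convex ?S" by (intro convex_Int convex_cball convex_halfspace_Im_ge)
  have int: "interior ?S \<subseteq> ball 0 R \<inter> {z. Im z > 0}"
  proof -
    have "interior ?S = ball 0 R \<inter> interior {z. Im z \<ge> 0}" by (simp add: interior_Int)
    also have "{z. Im z \<ge> 0} = {z. inner \<i> z \<ge> 0}" by (auto simp: inner_complex_def)
    also have "interior {z. inner \<i> z \<ge> 0} = {z. inner \<i> z > 0}"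
      by (rule interior_halfspace_ge) auto
    finally show ?thesis by (auto simp: inner_complex_def)
  qed
  have l_img: "path_image ?l \<subseteq> ?S"
    using R by (simp only: path_image_linepath, intro closed_segment_subset conv) auto
  have c_img: "path_image ?c \<subseteq> ?S"
    using R by (auto simp: path_image_part_circlepath' norm_mult sin_ge_zero Im_exp cis.ctr closed_segment_eq_real_ivl)
  have c_norm: "cmod z = R" if "z \<in> path_image ?c" for z
    using in_path_image_part_circlepath[OF that] R by simp
  have ends: "pathstart ?c = of_real R" "pathfinish ?c = of_real (-R)"
    by (simp_all add: exp_pi_i)
  have "(F has_contour_integral 0) (?l +++ ?c)"
  proof (rule Cauchy_theorem_convex[OF cont conv fin])
    show "F field_differentiable at x" if "x \<in> interior ?S - X" for x
      using that int hol by blast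
    show "valid_path (?l +++ ?c)" using ends by (intro valid_path_join) auto
    show "path_image (?l +++ ?c) \<subseteq> ?S" using ends l_img c_img by (subst path_image_join) auto
  qed (use ends in simp)
  moreover have Fl: "F contour_integrable_on ?l"
    using cont l_img
    by (intro contour_integrable_continuous_linepath continuous_on_subset[OF cont]) simp
  moreover have Fc: "F contour_integrable_on ?c"
    using cont c_img by (intro contour_integrable_continuous_part_circlepath continuous_on_subset[OF cont]) simp
  ultimately have "contour_integral ?l F + contour_integral ?c F = 0"
    using contour_integral_join[OF Fl Fc] contour_integral_unique ends
    by (metis contour_integral_unique valid_path_linepath valid_path_part_circlepath)
  then have "cmod (contour_integral ?l F) = cmod (contour_integral ?c F)"
    by (metis add_eq_0_iff norm_minus_cancel)
  also have "\<dots> \<le> C * R * \<bar>pi - 0\<bar>"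
  proof (rule contour_integral_bound_part_circlepath)
    show "cmod (F x) \<le> C" if "x \<in> path_image ?c" for x
      using bound[OF c_norm[OF that]] that c_img by auto
  qed (use Fc R C in auto)
  finally show ?thesis
    using R by (subst (asm) contour_integral_linepath_Reals_eq) auto
qed

lemma poisson_half_plane:
  fixes f :: "complex \<Rightarrow> complex" and m :: real
  assumes cont: "continuous_on cRHP f" and hol: "f holomorphic_on RHP"
    and bound: "\<And>s. Re s \<ge> 0 \<Longrightarrow> cmod (f s) \<le> C" and m: "m > 0"
  shows "integrable lborel (\<lambda>y. f (- \<i> * of_real y) / of_real (m\<^sup>2 + y\<^sup>2))"
    and "(\<integral>y. f (- \<i> * of_real y) / of_real (m\<^sup>2 + y\<^sup>2) \<partial>lborel) =
      of_real (pi / m) * f (of_real m)"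
proof -
  define g where "g z = f (- \<i> * z)" for z
  define z0 where "z0 = \<i> * of_real m"
  have z0: "Im z0 > 0" "g z0 = f (of_real m)" using m by (auto simp: z0_def g_def mult.assoc[symmetric])
  define F where "F z = (if z = z0 then deriv g z0 else (g z - g z0) / (z - z0)) / (z + z0)" for z
  have C: "C \<ge> 0" using order_trans[OF norm_ge_zero bound[of 0]] by simp
  have g_cont: "continuous_on {z. Im z \<ge> 0} g"
    unfolding g_def by (rule continuous_on_compose2[OF cont]) (auto intro!: continuous_intros)
  have g_hol: "g holomorphic_on {z. Im z > 0}"
    unfolding g_def
    by (rule holomorphic_on_compose_gen[OF _ hol, unfolded o_def]) (auto intro!: holomorphic_intros)
  have g_bound: "cmod (g z) \<le> C" if "Im z \<ge> 0" for z
    unfolding g_def using that by (intro bound) simp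
  have op: "open {z. Im z > 0}" by (simp add: open_halfspace_Im_gt)
  have nz: "z + z0 \<noteq> 0" if "Im z \<ge> 0" for z
  proof
    assume "z + z0 = 0"
    then have "Im z + Im z0 = 0" by (metis plus_complex.sel(2) zero_complex.sel(2))
    then show False using that z0 by simp
  qed
  have F_cont: "continuous_on {z. Im z \<ge> 0} F"
  proof -
    have "continuous_on {z. Im z \<ge> 0} (\<lambda>z. if z = z0 then deriv g z0 else (g z - g z0) / (z - z0))"
      using z0 by (intro continuous_on_difference_quotient[OF g_cont g_hol op]) simp
    then show ?thesis
      unfolding F_def using nz by (intro continuous_on_divide continuous_intros) auto
  qed
  have F_diff: "F field_differentiable at z" if "z \<in> {z. Im z > 0} - {z0}" for z
  proof -
    have o: "open ({z. Im z > 0} - {z0})" using op by (simp add: open_delete)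
    have "(\<lambda>z. (g z - g z0) / (z - z0) / (z + z0)) holomorphic_on {z. Im z > 0} - {z0}"
      using nz by (intro holomorphic_intros holomorphic_on_subset[OF g_hol]) auto
    then have "F holomorphic_on {z. Im z > 0} - {z0}"
      by (rule holomorphic_transform) (auto simp: F_def)
    then show ?thesis using o that holomorphic_on_imp_differentiable_at by blast
  qed
  have fac: "(z - z0) * (z + z0) = z\<^sup>2 + of_real (m\<^sup>2)" for z
    by (simp add: z0_def algebra_simps power2_eq_square)
  have F_eq: "F z = (g z - g z0) / (z\<^sup>2 + of_real (m\<^sup>2))" if "z \<noteq> z0" for z
    unfolding F_def fac[symmetric] using that by simp
  have F_arc: "cmod (integral {-R..R} (\<lambda>x. F (of_real x))) \<le> 2 * C / (R\<^sup>2 - m\<^sup>2) * R * pi"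
    if R: "R > m" for R
  proof (rule half_disc_integral[where X = "{z0}"])
    have R2: "R\<^sup>2 > m\<^sup>2" using R m by (simp add: power_strict_mono)
    show "cmod (F z) \<le> 2 * C / (R\<^sup>2 - m\<^sup>2)" if z: "cmod z = R" "Im z \<ge> 0" for z
    proof -
      have "z \<noteq> z0" using z R m by (auto simp: z0_def norm_mult)
      then have "cmod (F z) = cmod (g z - g z0) / cmod (z\<^sup>2 + of_real (m\<^sup>2))"
        by (simp add: F_eq norm_divide)
      also have "\<dots> \<le> 2 * C / (R\<^sup>2 - m\<^sup>2)"
      proof (rule frac_le)
        show "cmod (g z - g z0) \<le> 2 * C"
          using norm_triangle_ineq4[of "g z" "g z0"] g_bound[OF z(2)] g_bound[of z0] z0 by simp
        show "R\<^sup>2 - m\<^sup>2 \<le> cmod (z\<^sup>2 + of_real (m\<^sup>2))"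
          using norm_diff_ineq[of "z\<^sup>2" "of_real (m\<^sup>2)"] z by (simp add: norm_power)
      qed (use R2 C in auto)
      finally show ?thesis .
    qed
    show "2 * C / (R\<^sup>2 - m\<^sup>2) \<ge> 0" using R2 C by simp
    show "continuous_on (cball 0 R \<inter> {z. 0 \<le> Im z}) F" by (rule continuous_on_subset[OF F_cont]) auto
  qed (use R m F_diff in auto)
  let ?F = "\<lambda>x. F (of_real x)" and ?f = "\<lambda>x. f (- \<i> * of_real x) / of_real (m\<^sup>2 + x\<^sup>2)"
  have F_real: "?F x = ?f x - f (of_real m) * of_real (1 / (m\<^sup>2 + x\<^sup>2))" for x
  proof -
    have "of_real x \<noteq> z0" using z0 by (metis Im_complex_of_real less_irrefl)
    then show ?thesis
      by (simp add: F_eq z0) (simp add: g_def diff_divide_distrib add.commute)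
  qed
  have f_cont: "continuous_on UNIV (\<lambda>x::real. f (- \<i> * of_real x))"
    by (rule continuous_on_compose2[OF cont]) (auto intro!: continuous_intros)
  have pos: "m\<^sup>2 + x\<^sup>2 > 0" for x using m by (simp add: add_pos_nonneg)
  have "integrable lborel (\<lambda>x. C * (1 / (m\<^sup>2 + x\<^sup>2)))"
    using integrable_inverse_square_plus[OF m] by (rule integrable_mult_right)
  then show int_f: "integrable lborel ?f"
  proof (rule Bochner_Integration.integrable_bound)
    show "?f \<in> borel_measurable lborel"
      using borel_measurable_continuous_onI[OF f_cont] by (auto intro!: borel_measurable_divide)
    show "AE x in lborel. norm (?f x) \<le> norm (C * (1 / (m\<^sup>2 + x\<^sup>2)))"
    proof (rule AE_I2)
      fix x
      have "cmod (?f x) = cmod (f (- \<i> * of_real x)) / (m\<^sup>2 + x\<^sup>2)"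
        using pos[of x] by (simp only: norm_divide norm_of_real abs_of_pos)
      also have "\<dots> \<le> C / (m\<^sup>2 + x\<^sup>2)"
        using pos[of x] by (intro divide_right_mono bound) auto
      finally show "norm (?f x) \<le> norm (C * (1 / (m\<^sup>2 + x\<^sup>2)))"
        using pos[of x] C by simp
    qed
  qed
  have int_c: "integrable lborel (\<lambda>x. complex_of_real (1 / (m\<^sup>2 + x\<^sup>2)))"
    using integrable_inverse_square_plus[OF m] by (rule integrable_of_real)
  have int_F: "integrable lborel ?F"
    unfolding F_real using int_f int_c by (intro Bochner_Integration.integrable_diff integrable_mult_right)
  have lim1: "(\<lambda>n. \<integral>x\<in>{- real n..real n}. ?F x \<partial>lborel) \<longlonglongrightarrow> (\<integral>x. ?F x \<partial>lborel)"
    unfolding set_lebesgue_integral_def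
  proof (rule integral_dominated_convergence[where w = "\<lambda>x. norm (?F x)"])
    show "AE x in lborel. (\<lambda>n. indicat_real {- real n..real n} x *\<^sub>R ?F x) \<longlonglongrightarrow> ?F x"
    proof (rule AE_I2)
      fix x :: real
      obtain N :: nat where "\<bar>x\<bar> \<le> N" using real_arch_simple by blast
      then have "\<forall>\<^sub>F n in sequentially. indicat_real {- real n..real n} x *\<^sub>R ?F x = ?F x"
        by (intro eventually_sequentiallyI[of N]) (auto simp: indicator_def)
      then show "(\<lambda>n. indicat_real {- real n..real n} x *\<^sub>R ?F x) \<longlonglongrightarrow> ?F x"
        by (rule tendsto_eventually)
    qed
    show "integrable lborel (\<lambda>x. norm (?F x))" using int_F by simp
    show "?F \<in> borel_measurable lborel" using int_F by simp
  qed (use int_F in \<open>auto simp: indicator_def\<close>)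
  have set_int: "(\<integral>x\<in>{- R..R}. ?F x \<partial>lborel) = integral {-R..R} ?F" for R
    by (rule set_borel_integral_eq_integral(2))
      (use int_F in \<open>auto simp: set_integrable_def intro!: integrable_mult_indicator\<close>)
  have lim2: "(\<lambda>n. \<integral>x\<in>{- real n..real n}. ?F x \<partial>lborel) \<longlonglongrightarrow> 0"
  proof (rule Lim_null_comparison)
    have "(\<lambda>n. 2 * C / ((real n)\<^sup>2 - m\<^sup>2) * real n * pi) \<longlonglongrightarrow> 0" by real_asymp
    then show "(\<lambda>n. 2 * C / ((real n)\<^sup>2 - m\<^sup>2) * real n * pi) \<longlonglongrightarrow> 0" .
    obtain N :: nat where N: "m < N" using reals_Archimedean2 by blast
    show "\<forall>\<^sub>F n in sequentially. norm (\<integral>x\<in>{- real n..real n}. ?F x \<partial>lborel)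
        \<le> 2 * C / ((real n)\<^sup>2 - m\<^sup>2) * real n * pi"
    proof (rule eventually_sequentiallyI[of N])
      fix n assume "n \<ge> N"
      then have "real n > m" using N by simp
      then show "norm (\<integral>x\<in>{- real n..real n}. ?F x \<partial>lborel)
        \<le> 2 * C / ((real n)\<^sup>2 - m\<^sup>2) * real n * pi"
        unfolding set_int by (rule F_arc)
    qed
  qed
  have "(\<integral>x. ?F x \<partial>lborel) = 0" using LIMSEQ_unique[OF lim1 lim2] .
  moreover have "(\<integral>x. ?F x \<partial>lborel) = (\<integral>x. ?f x \<partial>lborel) - f (of_real m) * of_real (pi / m)"
    unfolding F_real using int_f int_c
    by (simp only: Bochner_Integration.integral_diff integrable_mult_right integral_mult_right_zero
        integral_complex_of_real integral_inverse_square_plus[OF m])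
  ultimately show "(\<integral>x. ?f x \<partial>lborel) = of_real (pi / m) * f (of_real m)"
    by (simp add: mult.commute)
qed

text \<open>On the axis the denominator has squared modulus m^2 + y^2, the denominator of the
  Poisson kernel. Expanding |f(-iy) - f(m)|^2 gives a weighted square of \<open>f\<close> with
  weight at most 1, a cross term evaluated by the Poisson formula, and a constant times the
  kernel.\<close>

lemma difference_quotient_contraction:
  fixes f :: "complex \<Rightarrow> complex" and m :: real
  assumes cont: "continuous_on cRHP f" and hol: "f holomorphic_on RHP"
    and bound: "\<And>s. Re s \<ge> 0 \<Longrightarrow> cmod (f s) \<le> C"
    and sq_int: "integrable lborel (\<lambda>y. (cmod (f (- \<i> * of_real y)))\<^sup>2)"
    and m: "m > 0"
  defines "N \<equiv> \<lambda>y. (cmod (of_real m * (f (- \<i> * of_real y) - f (of_real m)) /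
      (of_real m + \<i> * of_real y)))\<^sup>2"
  shows "integrable lborel N"
    and "(\<integral>y. N y \<partial>lborel) \<le> (\<integral>y. (cmod (f (- \<i> * of_real y)))\<^sup>2 \<partial>lborel)"
proof -
  let ?d = "\<lambda>y. f (- \<i> * of_real y)" and ?v = "f (of_real m)"
  let ?P = "\<lambda>y. ?d y / of_real (m\<^sup>2 + y\<^sup>2)"
  define W where "W y = m\<^sup>2 * (1 / (m\<^sup>2 + y\<^sup>2)) * (cmod (?d y))\<^sup>2" for y :: real
  note P = poisson_half_plane[OF cont hol bound m]
  have pos: "m\<^sup>2 + x\<^sup>2 > 0" for x using m by (simp add: add_pos_nonneg)
  have N_eq: "N y = W y - 2 * m\<^sup>2 * Re (cnj ?v * ?P y) + m\<^sup>2 * (cmod ?v)\<^sup>2 * (1 / (m\<^sup>2 + y\<^sup>2))" for y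
  proof -
    have split: "m\<^sup>2 * (A - 2 * t + B) / D = m\<^sup>2 * (1 / D) * A - 2 * m\<^sup>2 * (t / D) + m\<^sup>2 * B * (1 / D)"
      for A t B D :: real
      by (simp add: add_divide_distrib diff_divide_distrib algebra_simps)
    have 1: "(cmod (of_real m + \<i> * of_real y))\<^sup>2 = m\<^sup>2 + y\<^sup>2"
      by (simp add: cmod_power2)
    have 2: "(cmod (?d y - ?v))\<^sup>2 = (cmod (?d y))\<^sup>2 - 2 * Re (cnj ?v * ?d y) + (cmod ?v)\<^sup>2"
      unfolding cmod_power2 by (simp add: power2_eq_square algebra_simps)
    have 3: "Re (cnj ?v * ?P y) = Re (cnj ?v * ?d y) / (m\<^sup>2 + y\<^sup>2)"
      by (simp only: times_divide_eq_right Re_divide_of_real)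
    have "N y = m\<^sup>2 * (cmod (?d y - ?v))\<^sup>2 / (m\<^sup>2 + y\<^sup>2)"
      unfolding N_def norm_divide norm_mult power_divide power_mult_distrib 1 by simp
    also have "\<dots> = W y - 2 * m\<^sup>2 * Re (cnj ?v * ?P y) + m\<^sup>2 * (cmod ?v)\<^sup>2 * (1 / (m\<^sup>2 + y\<^sup>2))"
      unfolding 2 3 W_def by (rule split)
    finally show ?thesis .
  qed
  have W_le: "W y \<le> (cmod (?d y))\<^sup>2" for y
    unfolding W_def using pos[of y] by (simp add: divide_le_eq mult_left_mono algebra_simps)
  have W_nn: "W y \<ge> 0" for y unfolding W_def using pos[of y] by simp
  have int_W: "integrable lborel W"
    using sq_int
  proof (rule Bochner_Integration.integrable_bound)
    show "W \<in> borel_measurable lborel"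
      unfolding W_def using borel_measurable_integrable[OF sq_int] by measurable
    show "AE x in lborel. norm (W x) \<le> norm ((cmod (?d x))\<^sup>2)"
      using W_le W_nn by (intro AE_I2) simp
  qed
  have int_P: "integrable lborel (\<lambda>y. Re (cnj ?v * ?P y))"
    using P(1) by (intro integrable_Re integrable_mult_right)
  have int_c: "integrable lborel (\<lambda>y. m\<^sup>2 * (cmod ?v)\<^sup>2 * (1 / (m\<^sup>2 + y\<^sup>2)))"
    by (intro integrable_mult_right integrable_inverse_square_plus m)
  note ints = int_W integrable_mult_right[OF int_P, of "2 * m\<^sup>2"] int_c
  show "integrable lborel N"
    unfolding N_eq[abs_def] using ints by (intro Bochner_Integration.integrable_add Bochner_Integration.integrable_diff)
  have "(\<integral>y. Re (cnj ?v * ?P y) \<partial>lborel) = Re (cnj ?v * (of_real (pi / m) * ?v))"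
    using P by (subst integral_Re) (simp_all only: integrable_mult_right integral_mult_right_zero)
  also have "\<dots> = pi / m * (cmod ?v)\<^sup>2"
    unfolding cmod_power2 by (simp add: power2_eq_square algebra_simps add_divide_distrib)
  finally have Re_int: "(\<integral>y. Re (cnj ?v * ?P y) \<partial>lborel) = pi / m * (cmod ?v)\<^sup>2" .
  have "(\<integral>y. N y \<partial>lborel) = (\<integral>y. W y \<partial>lborel) - 2 * m\<^sup>2 * (pi / m * (cmod ?v)\<^sup>2) + m\<^sup>2 * (cmod ?v)\<^sup>2 * (pi / m)"
    unfolding N_eq[abs_def] using ints
    by (simp only: Bochner_Integration.integral_add Bochner_Integration.integral_diff
        Bochner_Integration.integrable_diff integral_mult_right_zero Re_int integral_inverse_square_plus[OF m])
  \<comment> \<open>The cross term contributes -2 pi m |f(m)|^2 and the constant term only + pi m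
    |f(m)|^2, so the correction is nonpositive.\<close>
  also have "\<dots> \<le> (\<integral>y. W y \<partial>lborel)"
    using m by (simp add: field_simps power2_eq_square)
  also have "\<dots> \<le> (\<integral>y. (cmod (?d y))\<^sup>2 \<partial>lborel)"
    using int_W sq_int W_le by (intro integral_mono) auto
  finally show "(\<integral>y. N y \<partial>lborel) \<le> (\<integral>y. (cmod (?d y))\<^sup>2 \<partial>lborel)" .
qed

lemma square_convex_sum:
  fixes p :: "'i \<Rightarrow> real"
  assumes "\<And>i. i \<in> I \<Longrightarrow> p i \<ge> 0" "sum p I = 1"
  shows "(cmod (\<Sum>i\<in>I. of_real (p i) * z i))\<^sup>2 \<le> (\<Sum>i\<in>I. p i * (cmod (z i))\<^sup>2)"
proof -
  have "cmod (\<Sum>i\<in>I. of_real (p i) * z i) \<le> (\<Sum>i\<in>I. sqrt (p i) * (sqrt (p i) * cmod (z i)))"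
    using assms(1) by (intro sum_norm_le) (simp add: norm_mult mult.assoc[symmetric])
  then have "(cmod (\<Sum>i\<in>I. of_real (p i) * z i))\<^sup>2 \<le> (\<Sum>i\<in>I. sqrt (p i) * (sqrt (p i) * cmod (z i)))\<^sup>2"
    by (intro power_mono) auto
  also have "\<dots> \<le> (\<Sum>i\<in>I. (sqrt (p i))\<^sup>2) * (\<Sum>i\<in>I. (sqrt (p i) * cmod (z i))\<^sup>2)"
    by (rule Cauchy_Schwarz_ineq_sum)
  also have "(\<Sum>i\<in>I. (sqrt (p i))\<^sup>2) = 1"
    using assms by (simp cong: sum.cong)
  also have "(\<Sum>i\<in>I. (sqrt (p i) * cmod (z i))\<^sup>2) = (\<Sum>i\<in>I. p i * (cmod (z i))\<^sup>2)"
    using assms(1) by (intro sum.cong) (auto simp: power_mult_distrib)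
  finally show ?thesis by simp
qed

lemma square_convex_two:
  fixes p0 p1 u v :: real
  assumes "p0 \<ge> 0" "p1 \<ge> 0" "p0 + p1 = 1"
  shows "(p0 * u + p1 * v)\<^sup>2 \<le> p0 * u\<^sup>2 + p1 * v\<^sup>2"
proof -
  have p1: "p1 = 1 - p0" using assms by simp
  have "p0 * u\<^sup>2 + p1 * v\<^sup>2 - (p0 * u + p1 * v)\<^sup>2 = p0 * p1 * (u - v)\<^sup>2"
    unfolding p1 by (simp add: power2_eq_square algebra_simps)
  moreover have "p0 * p1 * (u - v)\<^sup>2 \<ge> 0" using assms by simp
  ultimately show ?thesis by linarith
qed

lemma integrable_scaled:
  fixes g :: "real \<Rightarrow> real"
  assumes "b > 0" "integrable lborel g"
  shows "integrable lborel (\<lambda>x. g (x / b))" "(\<integral>x. g (x / b) \<partial>lborel) = b * (\<integral>x. g x \<partial>lborel)"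
proof -
  have "integrable lborel (\<lambda>x. g (0 + (1 / b) * x))"
    using assms by (subst lborel_integrable_real_affine_iff) auto
  then show "integrable lborel (\<lambda>x. g (x / b))" by simp
  have "(\<integral>x. g x \<partial>lborel) = \<bar>1 / b\<bar> *\<^sub>R (\<integral>x. g (0 + (1 / b) * x) \<partial>lborel)"
    using assms by (intro lborel_integral_real_affine) simp
  then show "(\<integral>x. g (x / b) \<partial>lborel) = b * (\<integral>x. g x \<partial>lborel)"
    using assms by (simp add: field_simps)
qed

context gain_system
begin

text \<open>The decay of \<open>E\<close> makes it square integrable on the axis. Convexity of the
  square, used once over the phases and once over \<open>p0\<close>, \<open>p1\<close>, reduces the
  equation to the individual quotients, each a contraction in L2.\<close>

lemma homogeneous_solution_zero:
  fixes E :: "complex \<Rightarrow> complex"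
  assumes cont: "continuous_on cRHP E" and hol: "E holomorphic_on RHP"
    and bound: "\<And>s. Re s \<ge> 0 \<Longrightarrow> cmod (E s) \<le> C / (1 + cmod s)"
    and eq: "\<And>s. Re s = 0 \<Longrightarrow> E s =
      x0 s / of_real (1 + a0) * (\<Sum>i=1..K. of_real (q i) * (of_real (\<mu> i) *
        (E (scaled a0 s) - E (of_real (\<mu> i))) / (of_real (\<mu> i) - scaled a0 s))) +
      x1 s / of_real (1 + a1) * (\<Sum>i=1..L. of_real (h i) * (of_real (\<nu> i) *
        (E (scaled a1 s) - E (of_real (\<nu> i))) / (of_real (\<nu> i) - scaled a1 s)))"
    and m: "m > 0"
  shows "E (of_real m) = 0"
proof -
  let ?d = "\<lambda>y. E (- \<i> * of_real y)"
  have C: "C \<ge> 0" using order_trans[OF norm_ge_zero bound[of 0]] by simp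
  have bound': "cmod (E s) \<le> C" if "Re s \<ge> 0" for s
  proof -
    have "C / (1 + cmod s) \<le> C / 1"
      using C by (intro divide_left_mono) (auto intro: add_pos_nonneg)
    then show ?thesis using bound[OF that] by simp
  qed
  have d_cont: "continuous_on UNIV ?d"
    by (rule continuous_on_compose2[OF cont]) (auto intro!: continuous_intros)
  have sq_int: "integrable lborel (\<lambda>y. (cmod (?d y))\<^sup>2)"
  proof (rule Bochner_Integration.integrable_bound)
    show "integrable lborel (\<lambda>y::real. C\<^sup>2 * (1 / (1\<^sup>2 + y\<^sup>2)))"
      by (intro integrable_mult_right integrable_inverse_square_plus) simp
    show "(\<lambda>y. (cmod (?d y))\<^sup>2) \<in> borel_measurable lborel"
      using borel_measurable_continuous_onI[OF d_cont] by measurable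
    show "AE y in lborel. norm ((cmod (?d y))\<^sup>2) \<le> norm (C\<^sup>2 * (1 / (1\<^sup>2 + y\<^sup>2)))"
    proof (rule AE_I2)
      fix y :: real
      have "(cmod (?d y))\<^sup>2 \<le> (C / (1 + \<bar>y\<bar>))\<^sup>2"
        using bound[of "- \<i> * of_real y"] by (intro power_mono) (auto simp: norm_mult)
      also have "\<dots> = C\<^sup>2 / (1 + \<bar>y\<bar>)\<^sup>2" by (simp add: power_divide)
      also have "\<dots> \<le> C\<^sup>2 / (1\<^sup>2 + y\<^sup>2)"
      proof (intro divide_left_mono mult_pos_pos)
        show "1\<^sup>2 + y\<^sup>2 \<le> (1 + \<bar>y\<bar>)\<^sup>2" by (simp add: power2_sum)
      qed (auto intro: add_pos_nonneg)
      finally show "norm ((cmod (?d y))\<^sup>2) \<le> norm (C\<^sup>2 * (1 / (1\<^sup>2 + y\<^sup>2)))" by simp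
    qed
  qed
  define J where "J = (\<integral>y. (cmod (?d y))\<^sup>2 \<partial>lborel)"
  define n where "n r y = of_real r * (?d y - E (of_real r)) / (of_real r + \<i> * of_real y)" for r y
  have n: "integrable lborel (\<lambda>y. (cmod (n r y))\<^sup>2)" "(\<integral>y. (cmod (n r y))\<^sup>2 \<partial>lborel) \<le> J" if "r > 0" for r
    using difference_quotient_contraction[OF cont hol bound' sq_int that] by (simp_all add: n_def J_def)
  define N where "N k p r y = (\<Sum>i=1..k. p i * (cmod (n (r i) y))\<^sup>2)" for k :: nat and p r y
  have N: "integrable lborel (N k p r)" "(\<integral>y. N k p r y \<partial>lborel) \<le> J"
    if "\<And>i. i \<in> {1..k} \<Longrightarrow> p i \<ge> 0" "sum p {1..k} = 1" "\<And>i. i \<in> {1..k} \<Longrightarrow> r i > 0" for k and p r :: "nat \<Rightarrow> real"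
  proof -
    show "integrable lborel (N k p r)"
      unfolding N_def[abs_def] using n(1) that(3)
      by (intro Bochner_Integration.integrable_sum integrable_mult_right) auto
    have "(\<integral>y. N k p r y \<partial>lborel) = (\<Sum>i=1..k. p i * (\<integral>y. (cmod (n (r i) y))\<^sup>2 \<partial>lborel))"
      unfolding N_def using n(1) that(3)
      by (subst Bochner_Integration.integral_sum) auto
    also have "\<dots> \<le> (\<Sum>i=1..k. p i * J)"
      using n(2) that by (intro sum_mono mult_left_mono) auto
    also have "\<dots> = J" using that(2) by (simp flip: sum_distrib_right)
    finally show "(\<integral>y. N k p r y \<partial>lborel) \<le> J" .
  qed
  have term_bound: "cmod (x s / of_real (1 + a) * (\<Sum>i=1..k. of_real (p i) * (of_real (r i) *
        (E (scaled a s) - E (of_real (r i))) / (of_real (r i) - scaled a s))))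
      \<le> P * sqrt (N k p r (y / (1 + a)) / (1 + a)\<^sup>2)"
    if "\<And>i. i \<in> {1..k} \<Longrightarrow> p i \<ge> 0" "sum p {1..k} = 1" "cmod (x s) \<le> P" "a > 0" "s = - \<i> * of_real y"
    for k x P a s y and p r :: "nat \<Rightarrow> real"
  proof -
    have s: "scaled a s = - \<i> * of_real (y / (1 + a))"
      using that(5) by simp
    have "(\<Sum>i=1..k. of_real (p i) * (of_real (r i) *
        (E (scaled a s) - E (of_real (r i))) / (of_real (r i) - scaled a s)))
        = (\<Sum>i=1..k. of_real (p i) * n (r i) (y / (1 + a)))" (is "?X = ?Y")
      unfolding s n_def by simp
    moreover have "cmod ?Y \<le> sqrt (N k p r (y / (1 + a)))"
      using square_convex_sum[OF that(1,2)] unfolding N_def by (intro real_le_rsqrt) auto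
    moreover have "cmod (x s) / \<bar>1 + a\<bar> \<le> P / (1 + a)" using that(3,4) by (simp add: divide_right_mono)
    ultimately have "cmod (x s / of_real (1 + a) * ?X) \<le> P / (1 + a) * sqrt (N k p r (y / (1 + a)))"
      unfolding norm_mult norm_divide norm_of_real using that(3,4) order_trans[OF norm_ge_zero that(3)]
      by (intro mult_mono) auto
    also have "\<dots> = P * sqrt (N k p r (y / (1 + a)) / (1 + a)\<^sup>2)"
      using that(4) by (simp add: real_sqrt_divide)
    finally show ?thesis .
  qed
  have N_nn: "N k p r y \<ge> 0" if "\<And>i. i \<in> {1..k} \<Longrightarrow> p i \<ge> 0" for k and p r :: "nat \<Rightarrow> real" and y
    unfolding N_def using that by (intro sum_nonneg) auto
  let ?N0 = "\<lambda>y. N K q \<mu> (y / (1 + a0))" and ?N1 = "\<lambda>y. N L h \<nu> (y / (1 + a1))"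
  have pointwise: "(cmod (?d y))\<^sup>2 \<le> p0 / (1 + a0)\<^sup>2 * ?N0 y + p1 / (1 + a1)\<^sup>2 * ?N1 y" for y
  proof -
    let ?s = "- \<i> * of_real y"
    have Re: "Re ?s = 0" by simp
    have "cmod (?d y) \<le> p0 * sqrt (?N0 y / (1 + a0)\<^sup>2) + p1 * sqrt (?N1 y / (1 + a1)\<^sup>2)"
      unfolding eq[OF Re]
      by (intro order_trans[OF norm_triangle_ineq] add_mono term_bound q h a_pos x0_bound x1_bound refl) auto
    then have "(cmod (?d y))\<^sup>2 \<le> (p0 * sqrt (?N0 y / (1 + a0)\<^sup>2) + p1 * sqrt (?N1 y / (1 + a1)\<^sup>2))\<^sup>2"
      by (intro power_mono) auto
    also have "\<dots> \<le> p0 * (sqrt (?N0 y / (1 + a0)\<^sup>2))\<^sup>2 + p1 * (sqrt (?N1 y / (1 + a1)\<^sup>2))\<^sup>2"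
      by (rule square_convex_two[OF p_nonneg p_sum])
    also have "\<dots> = p0 / (1 + a0)\<^sup>2 * ?N0 y + p1 / (1 + a1)\<^sup>2 * ?N1 y"
      using N_nn[of K q] N_nn[of L h] q h by simp
    finally show ?thesis .
  qed
  have apos: "1 + a0 > 0" "1 + a1 > 0" using a_pos by auto
  note I0 = integrable_scaled[OF apos(1) N(1)[OF q \<mu>]] and I1 = integrable_scaled[OF apos(2) N(1)[OF h \<nu>]]
  have J_nn: "J \<ge> 0" unfolding J_def by simp
  have "J \<le> (\<integral>y. p0 / (1 + a0)\<^sup>2 * ?N0 y + p1 / (1 + a1)\<^sup>2 * ?N1 y \<partial>lborel)"
    unfolding J_def using I0(1) I1(1) sq_int pointwise by (intro integral_mono) auto
  \<comment> \<open>The change of variable y/(1 + a) contributes 1 + a, against the squared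
    coefficient 1/(1 + a)^2; the net factor 1/(1 + a) is at most 1/c.\<close>
  also have "\<dots> = p0 / (1 + a0)\<^sup>2 * ((1 + a0) * (\<integral>y. N K q \<mu> y \<partial>lborel)) + p1 / (1 + a1)\<^sup>2 * ((1 + a1) * (\<integral>y. N L h \<nu> y \<partial>lborel))"
    using I0 I1 by simp
  also have "\<dots> \<le> p0 / (1 + a0)\<^sup>2 * ((1 + a0) * J) + p1 / (1 + a1)\<^sup>2 * ((1 + a1) * J)"
    using N(2)[OF q \<mu>] N(2)[OF h \<nu>] apos p_nonneg by (intro add_mono mult_left_mono) auto
  also have "\<dots> = p0 * (J / (1 + a0)) + p1 * (J / (1 + a1))"
    using apos by (simp add: power2_eq_square)
  also have "\<dots> \<le> p0 * (J / c) + p1 * (J / c)"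
    using p_nonneg c_le c_gt_1 J_nn by (intro add_mono mult_left_mono divide_left_mono) auto
  also have "\<dots> = J / c" by (simp only: distrib_right[symmetric] p_sum mult_1_left)
  finally have "J \<le> J / c" .
  then have "J * (c - 1) \<le> 0" using c_gt_1 by (simp add: field_simps)
  then have "J = 0" using J_nn c_gt_1 by (simp add: mult_le_0_iff)
  then have "AE y in lborel. (cmod (?d y))\<^sup>2 = 0"
    unfolding J_def using sq_int by (subst (asm) integral_nonneg_eq_0_iff_AE) auto
  \<comment> \<open>\<open>E\<close> vanishes almost everywhere on the axis, and the Poisson formula
    carries this to the point m.\<close>
  then have "AE y in lborel. ?d y / of_real (m\<^sup>2 + y\<^sup>2) = 0" by auto
  then have "(\<integral>y. ?d y / of_real (m\<^sup>2 + y\<^sup>2) \<partial>lborel) = 0" by (rule integral_eq_zero_AE)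
  then show ?thesis
    using poisson_half_plane(2)[OF cont hol bound' m] m by simp
qed

end

section \<open>Uniqueness for the linear system\<close>

lemma gain_term_continuous_on:
  assumes "continuous_on cRHP x" "X \<subseteq> cRHP" "a > 0"
    "\<And>s i. s \<in> X \<Longrightarrow> i \<in> {1..N} \<Longrightarrow> scaled a s \<noteq> of_real (r i)"
  shows "continuous_on X (gain_term a x N p r w)"
proof -
  have "of_real (1 + a) \<noteq> 0" using assms(3) by (simp only: of_real_eq_0_iff)
  then show ?thesis
    unfolding gain_term_def[abs_def] chi_hat_def
    by (intro continuous_intros continuous_on_subset[OF assms(1,2)]) (auto dest: assms(4))
qed

lemma gain_term_holomorphic_on:
  assumes "x holomorphic_on RHP" "X \<subseteq> RHP" "a > 0"
    "\<And>s i. s \<in> X \<Longrightarrow> i \<in> {1..N} \<Longrightarrow> scaled a s \<noteq> of_real (r i)"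
  shows "gain_term a x N p r w holomorphic_on X"
proof -
  have "of_real (1 + a) \<noteq> 0" using assms(3) by (simp only: of_real_eq_0_iff)
  then show ?thesis
    unfolding gain_term_def[abs_def] chi_hat_def
    by (intro holomorphic_intros holomorphic_on_subset[OF assms(1,2)]) (auto dest: assms(4))
qed

section \<open>Neumann series and local finiteness of the singular set\<close>

context gain_system
begin

text \<open>The Neumann series of (I - A)^(-1). It converges at each point of the closed half-plane
  when \<open>g\<close> is bounded near 0; on the singular set its value comes from divisions by 0
  and carries no meaning.\<close>

definition resolvent :: "(complex \<Rightarrow> complex) \<Rightarrow> complex \<Rightarrow> complex" where
  "resolvent g s = (\<Sum>n. (A ^^ n) g s)"

text \<open>The part of \<open>K_fun\<close> that is linear in the unknowns, with the opposite
  sign.\<close>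

definition G :: "(nat \<Rightarrow> complex) \<Rightarrow> (nat \<Rightarrow> complex) \<Rightarrow> complex \<Rightarrow> complex" where
  "G v w s = gain_term a0 x0 K q \<mu> v s + gain_term a1 x1 L h \<nu> w s"

lemma scaled_ne_rate:
  assumes "Re s \<ge> 0" "cmod s \<le> d" "a > 0" "d < x"
  shows "scaled a s \<noteq> of_real x"
proof
  assume eq: "scaled a s = of_real x"
  have "cmod (scaled a s) \<le> d"
    using scaled_region(3,4)[of s a] assms by (auto simp del: of_real_add)
  then show False unfolding eq using assms by simp
qed

lemma gain_terms_continuous_near_0:
  assumes "\<And>i. i \<in> {1..K} \<Longrightarrow> d < \<mu> i" "\<And>i. i \<in> {1..L} \<Longrightarrow> d < \<nu> i"
  shows "continuous_on (cRHP \<inter> cball 0 d) (gain_term a0 x0 K q \<mu> y)"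
    "continuous_on (cRHP \<inter> cball 0 d) (gain_term a1 x1 L h \<nu> y)"
  using assms a_pos by (intro gain_term_continuous_on x0_cont x1_cont scaled_ne_rate; auto)+

lemma G_bounded_near_0:
  assumes "\<And>i. i \<in> {1..K} \<Longrightarrow> d < \<mu> i" "\<And>i. i \<in> {1..L} \<Longrightarrow> d < \<nu> i"
  obtains C where "\<And>s. Re s \<ge> 0 \<Longrightarrow> cmod s \<le> d \<Longrightarrow> cmod (G v w s) \<le> C"
proof -
  let ?Z = "cRHP \<inter> cball 0 d"
  have "continuous_on ?Z (G v w)"
    unfolding G_def[abs_def] by (intro continuous_intros gain_terms_continuous_near_0 assms)
  moreover have "compact ?Z"
    by (intro closed_Int_compact closed_halfspace_Re_ge compact_cball)
  ultimately have "bounded (G v w ` ?Z)" using compact_continuous_image compact_imp_bounded by blast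
  then obtain C where "\<forall>y\<in>G v w ` ?Z. cmod y \<le> C" unfolding bounded_iff by blast
  then show ?thesis by (intro that[of C]) auto
qed

lemma resolvent_eq:
  assumes g: "e > 0" "\<And>s. Re s \<ge> 0 \<Longrightarrow> cmod s \<le> e \<Longrightarrow> cmod (g s) \<le> C" and s: "Re s \<ge> 0"
  shows "resolvent g s = g s + L10 s * resolvent g (scaled a0 s) +
    L01 s * resolvent g (scaled a1 s)"
proof -
  let ?u = "scaled a0 s" and ?v = "scaled a1 s"
  note sm = summable_funpow[of e g C, OF g]
  have u: "summable (\<lambda>n. (A ^^ n) g ?u)" and v: "summable (\<lambda>n. (A ^^ n) g ?v)"
    using scaled_region(1)[OF s a_pos(1)] scaled_region(1)[OF s a_pos(2)] by (auto intro: sm)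
  have "(\<lambda>n. (A ^^ Suc n) g s) sums (L10 s * resolvent g ?u + L01 s * resolvent g ?v)"
    unfolding funpow_Suc_gain_op resolvent_def
    by (intro sums_add sums_mult summable_sums u v)
  then have "(\<lambda>n. (A ^^ n) g s) sums (L10 s * resolvent g ?u + L01 s * resolvent g ?v + (A ^^ 0) g s)"
    by (rule sums_Suc)
  then show ?thesis
    unfolding resolvent_def[of g s] by (simp only: sums_unique[symmetric] funpow_0 add_ac)
qed

text \<open>Singular points are rates multiplied by factors at least 1. The last clause therefore
  lets a strict lower bound for all rates pass to the whole singular set, which keeps small discs
  around 0 free of it.\<close>

lemma S_pos:
  assumes "s \<in> S"
  obtains x where "s = of_real x" "x > 0"
    "\<And>m. (\<And>i. i \<in> {1..K} \<Longrightarrow> m < \<mu> i) \<Longrightarrow> (\<And>i. i \<in> {1..L} \<Longrightarrow> m < \<nu> i) \<Longrightarrow> m < x"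
proof -
  have *: "x \<le> x * (1 + a0) ^ l * (1 + a1) ^ m" if "x > 0" for x l m
  proof -
    have "1 * 1 \<le> (1 + a0) ^ l * (1 + a1) ^ m"
      using a_pos by (intro mult_mono one_le_power) auto
    then show ?thesis using that by (simp add: mult.assoc)
  qed
  from assms consider i l m where "i \<in> {1..K}" "s = of_real (\<mu> i * (1 + a0) ^ (l + 1) * (1 + a1) ^ m)"
    | i l m where "i \<in> {1..L}" "s = of_real (\<nu> i * (1 + a0) ^ l * (1 + a1) ^ (m + 1))"
    unfolding singular_points_def by blast
  then show ?thesis
  proof cases
    case 1
    note le = *[OF \<mu>[OF 1(1)], of "l + 1" m]
    show ?thesis
      by (rule that[OF 1(2)]) (use le \<mu>[OF 1(1)] 1(1) in \<open>blast intro: less_le_trans\<close>)+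
  next
    case 2
    note le = *[OF \<nu>[OF 2(1)], of l "m + 1"]
    show ?thesis
      by (rule that[OF 2(2)]) (use le \<nu>[OF 2(1)] 2(1) in \<open>blast intro: less_le_trans\<close>)+
  qed
qed

text \<open>The factors are at least c^k and c^l, so a bound on the modulus bounds both
  exponents.\<close>

lemma finite_scaled_powers:
  assumes x: "x > 0"
  shows "finite {z. cmod z \<le> R \<and> (\<exists>k l. z = of_real (x * (1 + a0) ^ k * (1 + a1) ^ l))}" (is "finite ?P")
proof -
  obtain n where n: "R / x < c ^ n" using real_arch_pow[OF c_gt_1] by blast
  have *: "k < n \<and> l < n" if le: "x * (1 + a0) ^ k * (1 + a1) ^ l \<le> R" for k l
  proof -
    have "c ^ k \<le> (1 + a0) ^ k" "c ^ l \<le> (1 + a1) ^ l"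
      using c_le c_gt_1 by (auto intro: power_mono)
    moreover have "1 \<le> (1 + a0) ^ k" "1 \<le> (1 + a1) ^ l" using a_pos by (auto intro: one_le_power)
    ultimately have "c ^ k * 1 \<le> (1 + a0) ^ k * (1 + a1) ^ l" "1 * c ^ l \<le> (1 + a0) ^ k * (1 + a1) ^ l"
      using c_gt_1 by (intro mult_mono; simp)+
    moreover have "(1 + a0) ^ k * (1 + a1) ^ l \<le> R / x" using le x by (simp add: pos_le_divide_eq mult_ac)
    ultimately have "c ^ k < c ^ n" "c ^ l < c ^ n" using n by auto
    then show ?thesis using c_gt_1 by (auto simp: power_strict_increasing_iff)
  qed
  have "?P \<subseteq> (\<lambda>(k, l). of_real (x * (1 + a0) ^ k * (1 + a1) ^ l)) ` ({..n} \<times> {..n})"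
  proof
    fix z assume "z \<in> ?P"
    then obtain k l where z: "z = of_real (x * (1 + a0) ^ k * (1 + a1) ^ l)" "cmod z \<le> R" by blast
    from z(2) have "x * (1 + a0) ^ k * (1 + a1) ^ l \<le> R" using abs_ge_self order_trans unfolding z(1) norm_of_real by blast
    from *[OF this] show "z \<in> (\<lambda>(k, l). of_real (x * (1 + a0) ^ k * (1 + a1) ^ l)) ` ({..n} \<times> {..n})"
      using z by (intro image_eqI[of _ _ "(k, l)"]) auto
  qed
  then show ?thesis by (rule finite_subset) auto
qed

lemma finite_S_cball: "finite (S \<inter> cball 0 R)"
proof (rule finite_subset)
  let ?P = "\<lambda>x. {z. cmod z \<le> R \<and> (\<exists>k l. z = of_real (x * (1 + a0) ^ k * (1 + a1) ^ l))}"
  show "S \<inter> cball 0 R \<subseteq> (\<Union>i\<in>{1..K}. ?P (\<mu> i)) \<union> (\<Union>i\<in>{1..L}. ?P (\<nu> i))"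
  proof
    fix s assume "s \<in> S \<inter> cball 0 R"
    then have "s \<in> S" "cmod s \<le> R" by auto
    then show "s \<in> (\<Union>i\<in>{1..K}. ?P (\<mu> i)) \<union> (\<Union>i\<in>{1..L}. ?P (\<nu> i))"
      unfolding singular_points_def by blast
  qed
  show "finite ((\<Union>i\<in>{1..K}. ?P (\<mu> i)) \<union> (\<Union>i\<in>{1..L}. ?P (\<nu> i)))"
    using finite_scaled_powers \<mu> \<nu> by (intro finite_UnI finite_UN_I) simp_all
qed

text \<open>Limits at a singular point may therefore be computed from identities that hold only off
  the singular set.\<close>

lemma eventually_notin_S: "\<forall>\<^sub>F z in at s. z \<notin> S"
proof -
  have "\<not> s islimpt (S \<inter> cball 0 (cmod s + 1))"
    by (rule islimpt_finite[OF finite_S_cball])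
  then have 1: "\<forall>\<^sub>F z in at s. z \<notin> S \<inter> cball 0 (cmod s + 1)"
    by (simp add: islimpt_iff_eventually)
  have 2: "\<forall>\<^sub>F z in at s. z \<in> ball 0 (cmod s + 1)"
    by (rule eventually_at_topological[THEN iffD2]) (auto intro!: exI[of _ "ball 0 (cmod s + 1)"])
  from 1 2 show ?thesis by eventually_elim auto
qed

end

text \<open>\<open>v\<close> and \<open>w\<close> play the role of the difference between a solution
  of the linear system and the true constants. The inhomogeneous term cancels, and the unknowns
  enter through \<open>- G\<close> because \<open>K_fun\<close> subtracts them. The aim is v = w =
  0.\<close>

locale homogeneous_system = gain_system +
  fixes v w :: "nat \<Rightarrow> complex"
  assumes value_\<mu>: "\<And>i. i \<in> {1..K} \<Longrightarrow>
      has_value (singular_points a0 a1 K \<mu> L \<nu>) (resolvent (\<lambda>s. - G v w s)) (of_real (\<mu> i)) (v i)"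
    and value_\<nu>: "\<And>i. i \<in> {1..L} \<Longrightarrow>
      has_value (singular_points a0 a1 K \<mu> L \<nu>) (resolvent (\<lambda>s. - G v w s)) (of_real (\<nu> i)) (w i)"
begin

abbreviation "D \<equiv> resolvent (\<lambda>s. - G v w s)"

text \<open>\<open>D\<close> with its singularities filled in. \<open>Lim\<close> is an unspecified
  value until \<open>region_step\<close> shows that the limit exists.\<close>

definition E where "E s = (if s \<in> S then Lim (at s) D else D s)"

text \<open>The only place where the equations of the linear system enter; the two readings of
  \<open>has_value\<close> merge into plain values of \<open>E\<close>.\<close>

lemma E_rates: "i \<in> {1..K} \<Longrightarrow> E (of_real (\<mu> i)) = v i" "i \<in> {1..L} \<Longrightarrow> E (of_real (\<nu> i)) = w i"
  using value_\<mu>[of i] value_\<nu>[of i] unfolding has_value_def E_def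
  by (auto intro: tendsto_Lim split: if_splits)

text \<open>On a half disc below all rates the terms are regular and bounded by C * r^n, so the
  Weierstrass test gives a uniform limit, continuous up to the axis and holomorphic inside. No
  singular point lies there, hence \<open>E\<close> agrees with \<open>D\<close>. The recursion for
  \<open>D\<close> on the whole half-plane uses the same bound near 0.\<close>

lemma E_near_0:
  obtains e where "e > 0"
    "continuous_on {s. Re s \<ge> 0 \<and> cmod s < e} E" "E holomorphic_on {s. Re s > 0 \<and> cmod s < e}"
    "\<And>s. Re s \<ge> 0 \<Longrightarrow> D s = - G v w s + L10 s * D (scaled a0 s) + L01 s * D (scaled a1 s)"
proof -
  obtain d r where d: "d > 0" "0 < r" "r < 1"
    "\<And>i. i \<in> {1..K} \<Longrightarrow> d < \<mu> i" "\<And>i. i \<in> {1..L} \<Longrightarrow> d < \<nu> i"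
    "\<And>s. Re s \<ge> 0 \<Longrightarrow> cmod s \<le> d \<Longrightarrow> cmod (L10 s) + cmod (L01 s) \<le> r"
    using contraction_radius by metis
  let ?Z = "cRHP \<inter> cball 0 d" and ?U = "RHP \<inter> ball 0 d"
  let ?g = "\<lambda>s. - G v w s"
  have ne: "scaled a s \<noteq> of_real x" if "s \<in> ?Z" "a > 0" "d < x" for s a x
    using that by (intro scaled_ne_rate) auto
  have UZ: "?U \<subseteq> ?Z" by auto
  note cont = gain_terms_continuous_near_0[OF d(4,5)]
  have hol: "gain_term a0 x0 K q \<mu> y holomorphic_on ?U" "gain_term a1 x1 L h \<nu> y holomorphic_on ?U" for y
    using d a_pos UZ by (intro gain_term_holomorphic_on x0_hol x1_hol ne; blast)+
  have scale_Z: "(\<lambda>s. scaled a s) ` ?Z \<subseteq> ?Z" if "a > 0" for a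
    using scaled_region[OF _ that] by (force simp del: of_real_add)
  have scale_U: "(\<lambda>s. scaled a s) ` ?U \<subseteq> ?U" if "a > 0" for a
  proof
    fix t assume "t \<in> (\<lambda>s. scaled a s) ` ?U"
    then obtain s where s: "t = scaled a s" "s \<in> ?U" by blast
    then have s': "Re s > 0" "cmod s < d" by auto
    have "Re t = Re s / (1 + a)" "cmod t \<le> cmod s"
      using scaled_region[of s a] that s' unfolding s(1) by auto
    then show "t \<in> ?U" using s' that by auto
  qed
  have g_cont: "continuous_on ?Z ?g" unfolding G_def[abs_def] by (intro continuous_intros cont)
  have g_hol: "?g holomorphic_on ?U" unfolding G_def[abs_def] by (intro holomorphic_intros hol)
  have nz: "of_real (1 + a) \<noteq> 0" if "a > 0" for a using that by (simp only: of_real_eq_0_iff)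
  have A_cont: "continuous_on ?Z ((A ^^ n) ?g)" for n
  proof (induction n)
    case (Suc n)
    have scaled: "continuous_on ?Z (\<lambda>s. (A ^^ n) ?g (scaled a s))" if "a > 0" for a
      by (rule continuous_on_compose2[OF Suc _ scale_Z[OF that]]) (intro continuous_intros ballI nz that)
    then show ?case
      unfolding funpow_Suc_gain_op[abs_def] by (intro continuous_on_add continuous_on_mult cont scaled a_pos)
  qed (use g_cont in simp)
  have A_hol: "(A ^^ n) ?g holomorphic_on ?U" for n
  proof (induction n)
    case (Suc n)
    have scaled: "(\<lambda>s. (A ^^ n) ?g (scaled a s)) holomorphic_on ?U" if "a > 0" for a
      by (rule holomorphic_on_compose_gen[OF _ Suc scale_U[OF that], unfolded o_def]) (intro holomorphic_intros nz that)
    then show ?case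
      unfolding funpow_Suc_gain_op[abs_def] by (intro holomorphic_on_add holomorphic_on_mult hol scaled a_pos)
  qed (use g_hol in simp)
  obtain C where "\<And>s. Re s \<ge> 0 \<Longrightarrow> cmod s \<le> d \<Longrightarrow> cmod (G v w s) \<le> C"
    using G_bounded_near_0[OF d(4,5)] by metis
  then have C': "\<And>s. Re s \<ge> 0 \<Longrightarrow> cmod s \<le> d \<Longrightarrow> cmod (?g s) \<le> C" by simp
  have bound: "cmod ((A ^^ n) ?g s) \<le> C * r ^ n" if "s \<in> ?Z" for n s
    by (rule funpow_bounded[where d = d]) (use d C' that in auto)
  have ul: "uniform_limit ?Z (\<lambda>n s. \<Sum>i<n. (A ^^ i) ?g s) D sequentially"
    unfolding resolvent_def[abs_def]
    by (rule Weierstrass_m_test[OF bound]) (use d in \<open>auto intro!: summable_mult summable_geometric\<close>)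
  have D_cont: "continuous_on ?Z D"
    by (rule uniform_limit_theorem[OF _ ul]) (auto intro!: always_eventually continuous_on_sum A_cont)
  have op: "open ?U" by (intro open_Int open_halfspace_Re_gt open_ball)
  have D_hol: "D holomorphic_on ?U"
  proof (rule holomorphic_uniform_sequence[OF op])
    show "(\<lambda>s. \<Sum>i<n. (A ^^ i) ?g s) holomorphic_on ?U" for n
      by (intro holomorphic_on_sum A_hol)
    fix x assume "x \<in> ?U"
    then obtain e where e: "e > 0" "cball x e \<subseteq> ?U" using op open_contains_cball by metis
    then have "uniform_limit (cball x e) (\<lambda>n s. \<Sum>i<n. (A ^^ i) ?g s) D sequentially"
      using UZ by (intro uniform_limit_on_subset[OF ul]) blast
    then show "\<exists>e>0. cball x e \<subseteq> ?U \<and> uniform_limit (cball x e) (\<lambda>n s. \<Sum>i<n. (A ^^ i) ?g s) D sequentially"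
      using e by blast
  qed
  have E_eq: "E s = D s" if "cmod s \<le> d" for s
  proof -
    have "s \<notin> S"
    proof
      assume "s \<in> S"
      then obtain x where "s = of_real x" "x > 0" "d < x" using d(4,5) S_pos by metis
      then show False using that by simp
    qed
    then show ?thesis by (simp add: E_def)
  qed
  show ?thesis
  proof (rule that[OF d(1)])
    show "continuous_on {s. Re s \<ge> 0 \<and> cmod s < d} E"
      by (rule continuous_on_eq[OF continuous_on_subset[OF D_cont]]) (use E_eq in auto)
    show "E holomorphic_on {s. Re s > 0 \<and> cmod s < d}"
      by (rule holomorphic_transform[OF holomorphic_on_subset[OF D_hol]]) (use E_eq in auto)
    show "D s = - G v w s + L10 s * D (scaled a0 s) + L01 s * D (scaled a1 s)"
      if "Re s \<ge> 0" for s
      by (rule resolvent_eq[OF d(1) C' that])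
  qed
qed

lemma D_rec:
  assumes "Re s \<ge> 0"
  shows "D s = - G v w s + L10 s * D (scaled a0 s) + L01 s * D (scaled a1 s)"
proof (rule E_near_0)
  assume "\<And>s. Re s \<ge> 0 \<Longrightarrow> D s = - G v w s + L10 s * D (scaled a0 s) + L01 s * D (scaled a1 s)"
  from this[OF assms] show ?thesis .
qed

text \<open>The sign matches the denominators r - z of the coefficients. The value at z = r is the
  right one only where \<open>E\<close> is known to be holomorphic at r.\<close>

definition quotient :: "real \<Rightarrow> complex \<Rightarrow> complex" where
  "quotient r z = - (if z = of_real r then deriv E (of_real r)
    else (E z - E (of_real r)) / (z - of_real r))"

text \<open>The homogeneous right-hand side with each pole merged with the value of \<open>E\<close>
  at the corresponding rate. In contrast to the recursion for \<open>D\<close>, this expression is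
  meaningful on the singular set as well.\<close>

definition T where
  "T s = x0 s / of_real (1 + a0) *
      (\<Sum>i=1..K. of_real (q i) * (of_real (\<mu> i) * quotient (\<mu> i) (scaled a0 s))) +
    x1 s / of_real (1 + a1) *
      (\<Sum>i=1..L. of_real (h i) * (of_real (\<nu> i) * quotient (\<nu> i) (scaled a1 s)))"

lemma quotient_regular:
  assumes "z \<noteq> of_real r"
  shows "quotient r z = (E z - E (of_real r)) / (of_real r - z)"
  using assms unfolding quotient_def by (simp add: minus_divide_right)

text \<open>The pole cancellation: both terms share the coefficient p r/(r - z), and since
  \<open>y i\<close> equals the value of \<open>E\<close> at the rate, their difference carries the
  factor E(z) - E(r), which vanishes at the pole.\<close>

lemma gain_term_difference:
  assumes "\<And>i. i \<in> {1..N} \<Longrightarrow> scaled a s \<noteq> of_real (r i)"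
    and "\<And>i. i \<in> {1..N} \<Longrightarrow> E (of_real (r i)) = y i"
  shows "gain_term a x N p r (\<lambda>_. 1) s * E (scaled a s) - gain_term a x N p r y s =
    x s / of_real (1 + a) *
      (\<Sum>i=1..N. of_real (p i) * (of_real (r i) * quotient (r i) (scaled a s)))"
proof -
  let ?z = "scaled a s"
  have alg: "P * (r / d) * 1 * e - P * (r / d) * y = P * (r * ((e - y) / d))" for P r d e y :: complex
    by (simp add: algebra_simps diff_divide_distrib)
  have "of_real (p i) * (of_real (r i) / (of_real (r i) - ?z)) * 1 * E ?z -
      of_real (p i) * (of_real (r i) / (of_real (r i) - ?z)) * y i =
      of_real (p i) * (of_real (r i) * quotient (r i) ?z)" if "i \<in> {1..N}" for i
    unfolding quotient_regular[OF assms(1)[OF that]] assms(2)[OF that]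
    by (rule alg)
  then show ?thesis
    unfolding gain_term_def chi_hat_def mult.assoc[of "x s / of_real (1 + a)"] right_diff_distrib[symmetric]
    by (simp only: sum_distrib_right sum_subtractf[symmetric] cong: sum.cong)
qed

lemma D_eq_T:
  assumes s: "Re s \<ge> 0" "s \<notin> S"
  shows "D s = T s"
proof -
  have D_E: "D t = E t" if "t \<notin> S" for t using that by (simp add: E_def)
  have "D s = (L10 s * E (scaled a0 s) - gain_term a0 x0 K q \<mu> v s) +
      (L01 s * E (scaled a1 s) - gain_term a1 x1 L h \<nu> w s)"
    unfolding D_rec[OF s(1)] G_def[of v w s] D_E[OF S_scaled(1)[OF s(2)]] D_E[OF S_scaled(2)[OF s(2)]] by simp
  also have "\<dots> = T s"
    unfolding T_def
    by (subst (1 2) gain_term_difference)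
      (use S_scaled[OF s(2)] E_rates in \<open>auto simp del: of_real_add\<close>)
  finally show ?thesis .
qed

text \<open>For |s| < c R both scaled points have modulus below R, so \<open>T\<close> on the larger
  region needs only what is known on the smaller one; regularity of \<open>T\<close> then passes to
  \<open>E\<close>.\<close>

lemma region_step:
  assumes R: "R > 0" and cont: "continuous_on {s. Re s \<ge> 0 \<and> cmod s < R} E"
    and hol: "E holomorphic_on {s. Re s > 0 \<and> cmod s < R}"
  shows "continuous_on {s. Re s \<ge> 0 \<and> cmod s < c * R} E"
    "E holomorphic_on {s. Re s > 0 \<and> cmod s < c * R}"
    "\<And>s. Re s \<ge> 0 \<Longrightarrow> cmod s < c * R \<Longrightarrow> E s = T s"
proof -
  let ?W = "{s. Re s \<ge> 0 \<and> cmod s < R}" and ?U = "{s. Re s > 0 \<and> cmod s < R}"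
  let ?W' = "{s. Re s \<ge> 0 \<and> cmod s < c * R}" and ?U' = "{s. Re s > 0 \<and> cmod s < c * R}"
  have op: "open {s. Re s > 0 \<and> cmod s < R}" for R
  proof -
    have "{s. Re s > 0 \<and> cmod s < R} = RHP \<inter> ball 0 R" by auto
    then show ?thesis by (simp add: open_Int open_halfspace_Re_gt)
  qed
  have quot: "continuous_on ?W (quotient r)" "quotient r holomorphic_on ?U" if "r > 0" for r
  proof -
    let ?q = "\<lambda>z. if z = of_real r then deriv E (of_real r)
      else (E z - E (of_real r)) / (z - of_real r)"
    have "continuous_on ?W ?q \<and> ?q holomorphic_on ?U"
    \<comment> \<open>A rate inside the known region gives a removable singularity. For a rate
      outside, the denominator has no zero in the region and the branch with \<open>deriv\<close> is
      never reached.\<close>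
    proof (cases "r < R")
      case True
      then have r: "of_real r \<in> ?U" using that by simp
      have "?q holomorphic_on ?U"
        by (rule pole_lemma[OF hol], unfold interior_open[OF op], rule r)
      then show ?thesis
        using continuous_on_difference_quotient[OF cont hol op r] by blast
    next
      case False
      then have ne: "z \<noteq> of_real r" if "cmod z < R" for z using that by auto
      have "continuous_on ?W (\<lambda>z. (E z - E (of_real r)) / (z - of_real r))"
        using ne by (intro continuous_intros cont) auto
      moreover have "(\<lambda>z. (E z - E (of_real r)) / (z - of_real r)) holomorphic_on ?U"
        using ne by (intro holomorphic_intros hol) auto
      ultimately show ?thesis
        using ne by (auto intro: continuous_on_eq holomorphic_transform)
    qed
    then show "continuous_on ?W (quotient r)" "quotient r holomorphic_on ?U"
      unfolding quotient_def[abs_def] by (auto intro: continuous_on_minus holomorphic_on_minus)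
  qed
  have nz: "of_real (1 + a) \<noteq> 0" if "a > 0" for a using that by (simp only: of_real_eq_0_iff)
  have less: "cmod s / (1 + a) < R" if "cmod s < c * R" "c \<le> 1 + a" for s a
  proof -
    have "c * R \<le> (1 + a) * R" using that R by (intro mult_right_mono) auto
    then have "cmod s < (1 + a) * R" using that by simp
    then show ?thesis using that c_gt_1 by (simp add: divide_less_eq mult.commute)
  qed
  have scale_W: "(\<lambda>s. scaled a s) ` ?W' \<subseteq> ?W" if "a > 0" "c \<le> 1 + a" for a
  proof
    fix t assume "t \<in> (\<lambda>s. scaled a s) ` ?W'"
    then obtain s where s: "t = scaled a s" "Re s \<ge> 0" "cmod s < c * R" by blast
    then show "t \<in> ?W" using scaled_region[OF s(2) that(1)] less[OF s(3) that(2)] by simp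
  qed
  have scale_U: "(\<lambda>s. scaled a s) ` ?U' \<subseteq> ?U" if "a > 0" "c \<le> 1 + a" for a
  proof
    fix t assume "t \<in> (\<lambda>s. scaled a s) ` ?U'"
    then obtain s where s: "t = scaled a s" "Re s > 0" "cmod s < c * R" by blast
    then have "Re t > 0" using scaled_region(2)[of s a] that by simp
    moreover have "cmod t < R" using scaled_region(3)[of s a] less[OF s(3) that(2)] s that by simp
    ultimately show "t \<in> ?U" by simp
  qed
  have q_cont: "continuous_on ?W' (\<lambda>s. quotient r (scaled a s))" if "r > 0" "a > 0" "c \<le> 1 + a" for r a
    by (rule continuous_on_compose2[OF quot(1)[OF that(1)] _ scale_W[OF that(2,3)]]) (intro continuous_intros ballI nz that)
  have q_hol: "(\<lambda>s. quotient r (scaled a s)) holomorphic_on ?U'" if "r > 0" "a > 0" "c \<le> 1 + a" for r a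
    by (rule holomorphic_on_compose_gen[OF _ quot(2)[OF that(1)] scale_U[OF that(2,3)], unfolded o_def]) (intro holomorphic_intros nz that)
  have T_cont: "continuous_on ?W' T"
    unfolding T_def[abs_def]
    by (intro continuous_intros ballI nz a_pos q_cont c_le \<mu> \<nu> continuous_on_subset[OF x0_cont] continuous_on_subset[OF x1_cont]) auto
  have T_hol: "T holomorphic_on ?U'"
    unfolding T_def[abs_def]
    by (intro holomorphic_intros ballI nz a_pos q_hol c_le \<mu> \<nu> holomorphic_on_subset[OF x0_hol] holomorphic_on_subset[OF x1_hol]) auto
  show E_T: "E s = T s" if s: "Re s \<ge> 0" "cmod s < c * R" for s
  proof (cases "s \<in> S")
    case True
    then have "Re s > 0" by (metis S_pos Re_complex_of_real)
    then have U': "s \<in> ?U'" using s by simp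
    \<comment> \<open>Off the singular set and near s, \<open>D\<close> coincides with the
      continuous function \<open>T\<close>. Hence the limit in the definition of \<open>E\<close>
      exists and equals T s.\<close>
    have "T \<midarrow>s\<rightarrow> T s"
      using T_hol U' op holomorphic_on_imp_continuous_on continuous_on_eq_continuous_at isCont_def by blast
    moreover have "\<forall>\<^sub>F z in at s. z \<in> ?U'"
      using U' op eventually_at_topological by blast
    then have "\<forall>\<^sub>F z in at s. T z = D z"
      using eventually_notin_S[of s] by eventually_elim (auto simp: D_eq_T)
    ultimately have "D \<midarrow>s\<rightarrow> T s" by (rule Lim_transform_eventually)
    then have "Lim (at s) D = T s" by (intro tendsto_Lim) auto
    then show ?thesis using True by (simp add: E_def)
  qed (use s in \<open>simp add: E_def D_eq_T\<close>)
  show "continuous_on ?W' E" by (rule continuous_on_eq[OF T_cont]) (use E_T in auto)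
  show "E holomorphic_on ?U'" by (rule holomorphic_transform[OF T_hol]) (use E_T in auto)
qed

text \<open>The radii e * c^n exhaust the half-plane. Continuity and differentiability are local, so
  they follow from any sufficiently large half disc.\<close>

lemma E_regular:
  shows "continuous_on cRHP E" "E holomorphic_on RHP" "\<And>s. Re s \<ge> 0 \<Longrightarrow> E s = T s"
proof -
  obtain e where e: "e > 0"
    "continuous_on {s. Re s \<ge> 0 \<and> cmod s < e} E" "E holomorphic_on {s. Re s > 0 \<and> cmod s < e}"
    by (rule E_near_0)
  have c: "c ^ n > 0" for n using c_gt_1 by simp
  have reg: "continuous_on {s. Re s \<ge> 0 \<and> cmod s < c ^ n * e} E \<and>
    E holomorphic_on {s. Re s > 0 \<and> cmod s < c ^ n * e}" for n
  proof (induction n)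
    case (Suc n)
    have "c ^ n * e > 0" using c e by simp
    from region_step(1,2)[OF this] Suc show ?case by (simp add: mult.assoc)
  qed (use e in simp)
  have ex: "\<exists>n. cmod s < c ^ n * e" for s
  proof -
    obtain n where "cmod s / e < c ^ n" using real_arch_pow[OF c_gt_1] by blast
    then show ?thesis using e(1) by (auto simp: divide_less_eq)
  qed
  show "E s = T s" if "Re s \<ge> 0" for s
  proof -
    obtain n where n: "cmod s < c ^ n * e" using ex by blast
    moreover have "c ^ n * e \<le> c * (c ^ n * e)" using c_gt_1 c[of n] e(1) by simp
    ultimately have "cmod s < c * (c ^ n * e)" by simp
    then show ?thesis using reg[of n] c[of n] e(1) that by (intro region_step(3)[of "c ^ n * e"]) auto
  qed
  show "continuous_on cRHP E"
    unfolding continuous_on_eq_continuous_within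
  proof
    fix s :: complex assume s: "s \<in> cRHP"
    obtain n where n: "cmod s < c ^ n * e" using ex by blast
    have "at s within cRHP = at s within {s. Re s \<ge> 0 \<and> cmod s < c ^ n * e}"
      by (rule at_within_nhd[of s "ball 0 (c ^ n * e)"]) (use n in auto)
    moreover have "continuous (at s within {s. Re s \<ge> 0 \<and> cmod s < c ^ n * e}) E"
      using reg[of n] s n by (auto simp: continuous_on_eq_continuous_within)
    ultimately show "continuous (at s within cRHP) E" by simp
  qed
  have "E field_differentiable at s" if "Re s > 0" for s
  proof -
    obtain n where n: "cmod s < c ^ n * e" using ex by blast
    have "{s. Re s > 0 \<and> cmod s < c ^ n * e} = RHP \<inter> ball 0 (c ^ n * e)" by auto
    then have "open {s. Re s > 0 \<and> cmod s < c ^ n * e}" by (simp add: open_Int open_halfspace_Re_gt)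
    then show ?thesis using reg[of n] n that holomorphic_on_imp_differentiable_at by blast
  qed
  then show "E holomorphic_on RHP"
    by (simp add: holomorphic_on_def field_differentiable_at_within)
qed

text \<open>Far out, |r - z| >= |z|/2 turns the equation into |E(s)| <= 2 m (X + Y)/|s|, where X
  bounds \<open>E\<close> at the scaled points and Y at the rates. Used along
  \<open>scaling_induct\<close> this gives boundedness; used once more with the global bound it
  gives the decay 1/|s|.\<close>

lemma E_bound: obtains C where "\<And>s. Re s \<ge> 0 \<Longrightarrow> cmod (E s) \<le> C / (1 + cmod s)"
proof -
  define F where "F = insert 1 (\<mu> ` {1..K} \<union> \<nu> ` {1..L})"
  define H where "H = insert 0 ((\<lambda>i. cmod (v i)) ` {1..K} \<union> (\<lambda>i. cmod (w i)) ` {1..L})"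
  have fin: "finite F" "finite H" by (auto simp: F_def H_def)
  define m where "m = Max F"
  define Y where "Y = Max H"
  have m: "m \<ge> 1" "\<And>i. i \<in> {1..K} \<Longrightarrow> \<mu> i \<le> m" "\<And>i. i \<in> {1..L} \<Longrightarrow> \<nu> i \<le> m"
    unfolding m_def by (rule Max_ge[OF fin(1)]; unfold F_def; blast)+
  have Y: "Y \<ge> 0" "\<And>i. i \<in> {1..K} \<Longrightarrow> cmod (v i) \<le> Y" "\<And>i. i \<in> {1..L} \<Longrightarrow> cmod (w i) \<le> Y"
    unfolding Y_def by (rule Max_ge[OF fin(2)]; unfold H_def; blast)+
  \<comment> \<open>For |s| >= R both scaled points have modulus at least 2 m, twice any rate, and
    the factor 2 m/|s| is at most 1/2.\<close>
  define R where "R = 2 * m * (2 + a0 + a1)"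
  have R: "R \<ge> 4 * m" "R \<ge> 2 * m * (1 + a0)" "R \<ge> 2 * m * (1 + a1)" "R \<ge> 1"
    using m(1) a_pos unfolding R_def by (auto simp: algebra_simps add_increasing2)
  have term_bound: "cmod (x s / of_real (1 + a) *
      (\<Sum>i=1..k. of_real (p i) * (of_real (r i) * quotient (r i) (scaled a s))))
      \<le> P * (2 * m * (X + Y) / cmod s)"
    if a: "a > 0" and p: "\<And>i. i \<in> {1..k} \<Longrightarrow> p i \<ge> 0" "sum p {1..k} = 1"
      and r: "\<And>i. i \<in> {1..k} \<Longrightarrow> 0 < r i" "\<And>i. i \<in> {1..k} \<Longrightarrow> r i \<le> m"
      and E: "\<And>i. i \<in> {1..k} \<Longrightarrow> cmod (E (of_real (r i))) \<le> Y"
      and x: "cmod (x s) \<le> P" and s: "cmod s \<ge> 2 * m * (1 + a)"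
      and X: "cmod (E (scaled a s)) \<le> X"
    for x k a P X s and p r :: "nat \<Rightarrow> real"
  proof -
    let ?z = "scaled a s"
    let ?Q = "\<Sum>i=1..k. of_real (p i) * (of_real (r i) * quotient (r i) ?z)"
    have z: "cmod ?z = cmod s / (1 + a)" using a by (simp only: norm_divide norm_of_real)
    then have z_ge: "cmod ?z \<ge> 2 * m" using s a by (simp add: pos_le_divide_eq)
    have P: "P \<ge> 0" using x norm_ge_zero order_trans by blast
    have X0: "X \<ge> 0" using X norm_ge_zero order_trans by blast
    have 1: "cmod (of_real (r i) * quotient (r i) ?z) \<le> m * ((X + Y) / (cmod ?z / 2))" if i: "i \<in> {1..k}" for i
    proof -
      have ne: "?z \<noteq> of_real (r i)"
      proof
        assume "?z = of_real (r i)"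
        then have "cmod ?z = r i" using r(1)[OF i] by simp
        then show False using z_ge r(2)[OF i] m(1) by simp
      qed
      have low: "cmod ?z / 2 \<le> cmod (of_real (r i) - ?z)"
        using norm_triangle_ineq2[of ?z "of_real (r i)"] z_ge r(1,2)[OF i]
        by (simp add: norm_minus_commute del: of_real_add)
      have "cmod (quotient (r i) ?z) \<le> (X + Y) / (cmod ?z / 2)"
        unfolding quotient_regular[OF ne] norm_divide
      proof (rule frac_le[OF _ _ _ low[unfolded norm_divide]])
        show "cmod (E ?z - E (of_real (r i))) \<le> X + Y"
          using norm_triangle_ineq4[of "E ?z" "E (of_real (r i))"] X E[OF i] by simp
        show "0 < cmod s / cmod (of_real (1 + a)) / 2"
          using z_ge m(1) by (simp only: norm_divide) simp
      qed (use X0 Y in auto)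
      then show ?thesis
        using r[OF i] m(1) unfolding norm_mult by (intro mult_mono) auto
    qed
    have "cmod ?Q
        \<le> (\<Sum>i=1..k. p i * (m * ((X + Y) / (cmod ?z / 2))))"
    proof (rule sum_norm_le)
      fix i assume i: "i \<in> {1..k}"
      show "cmod (of_real (p i) * (of_real (r i) * quotient (r i) ?z)) \<le> p i * (m * ((X + Y) / (cmod ?z / 2)))"
        unfolding norm_mult[of "of_real (p i)"] norm_of_real abs_of_nonneg[OF p(1)[OF i]]
        by (rule mult_left_mono[OF 1[OF i] p(1)[OF i]])
    qed
    also have "\<dots> = m * ((X + Y) / (cmod ?z / 2))"
      by (simp only: sum_distrib_right[symmetric] p(2) mult_1_left)
    finally have 2: "cmod ?Q
      \<le> m * ((X + Y) / (cmod ?z / 2))" .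
    have "cmod (x s / of_real (1 + a)) \<le> P / (1 + a)"
      using x a by (simp only: norm_divide norm_of_real) (simp add: divide_right_mono)
    then have "cmod (x s / of_real (1 + a) *
      ?Q)
      \<le> P / (1 + a) * (m * ((X + Y) / (cmod ?z / 2)))"
      unfolding norm_mult[of "x s / of_real (1 + a)"] using 2 P a by (intro mult_mono) auto
    also have "\<dots> = P * (2 * m * (X + Y) / cmod s)"
    proof -
      have "P / b * (m * (Y / (t / b / 2))) = P * (2 * m * Y / t)" if "b \<noteq> 0" for b Y t
        using that by (simp add: mult_ac)
      from this[of "1 + a" "X + Y" "cmod s"] show ?thesis unfolding z using a by linarith
    qed
    finally show ?thesis .
  qed
  have far: "cmod (E s) \<le> 2 * m * (X + Y) / cmod s"
    if s: "Re s \<ge> 0" "cmod s \<ge> R" and X: "cmod (E (scaled a0 s)) \<le> X" "cmod (E (scaled a1 s)) \<le> X" for s X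
  proof -
    have "cmod (E s) \<le> p0 * (2 * m * (X + Y) / cmod s) + p1 * (2 * m * (X + Y) / cmod s)"
      unfolding E_regular(3)[OF s(1)] T_def
      by (intro order_trans[OF norm_triangle_ineq] add_mono term_bound)
        (use a_pos q h \<mu> \<nu> m Y E_rates x0_bound x1_bound s R X in \<open>auto simp del: of_real_add\<close>)
    also have "\<dots> = 2 * m * (X + Y) / cmod s"
      by (simp only: distrib_right[symmetric] p_sum mult_1_left)
    finally show ?thesis .
  qed
  have "compact (cRHP \<inter> cball 0 R)"
    by (intro closed_Int_compact closed_halfspace_Re_ge compact_cball)
  moreover have "continuous_on (cRHP \<inter> cball 0 R) E"
    by (rule continuous_on_subset[OF E_regular(1)]) auto
  ultimately have "bounded (E ` (cRHP \<inter> cball 0 R))"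
    using compact_continuous_image compact_imp_bounded by blast
  then obtain B0 where "\<forall>y\<in>E ` (cRHP \<inter> cball 0 R). cmod y \<le> B0" unfolding bounded_iff by blast
  then have B0: "\<And>s. Re s \<ge> 0 \<Longrightarrow> cmod s \<le> R \<Longrightarrow> cmod (E s) \<le> B0" by auto
  define B where "B = max B0 Y"
  have B: "B \<ge> B0" "B \<ge> Y" "B \<ge> 0" using Y(1) by (auto simp: B_def)
  \<comment> \<open>Since B >= Y, the induction step returns (B + Y)/2 <= B, so the bound from the
    compact half disc propagates without growing.\<close>
  have bdd: "cmod (E s) \<le> B" if "Re s \<ge> 0" for s
  proof -
    have "R > 0" using R(4) by simp
    with that show ?thesis
    proof (induction rule: scaling_induct)
      case (small s)
      then show ?case using B0[of s] B by simp
    next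
      case (step s)
      show ?case
      proof (cases "cmod s \<le> R")
        case False
        then have "cmod (E s) \<le> 2 * m * (B + Y) / cmod s" using far[of s B] step by simp
        also have "\<dots> \<le> 2 * m * (B + Y) / (4 * m)"
          using False R m(1) B Y(1) by (intro divide_left_mono mult_nonneg_nonneg mult_pos_pos) auto
        also have "\<dots> = (B + Y) / 2" using m(1) by simp
        also have "\<dots> \<le> B" using B by simp
        finally show ?thesis .
      qed (use B0[of s] B step in simp)
    qed
  qed
  show ?thesis
  proof (rule that)
    fix s assume s: "Re s \<ge> 0"
    \<comment> \<open>The first summand serves |s| <= R. Beyond that, |E(s)| |s| <= 4 m B and 1 +
      |s| <= 2 |s|.\<close>
    define C where "C = B * (1 + R) + 8 * m * B"
    have C1: "B * (1 + R) \<le> C" "8 * m * B \<le> C" using B R m by (auto simp: C_def)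
    have "cmod (E s) * (1 + cmod s) \<le> C"
    proof (cases "cmod s \<le> R")
      case True
      have "cmod (E s) * (1 + cmod s) \<le> B * (1 + R)"
        using bdd[OF s] True B R by (intro mult_mono) auto
      then show ?thesis using C1 by simp
    next
      case False
      then have s1: "cmod s \<ge> 1" using R by simp
      have "cmod (E s) \<le> 2 * m * (B + Y) / cmod s"
        using far[of s B] False s bdd scaled_region(1)[OF s a_pos(1)] scaled_region(1)[OF s a_pos(2)]
        by (simp del: of_real_add)
      also have "\<dots> \<le> 2 * m * (2 * B) / cmod s"
        using B m(1) by (intro divide_right_mono mult_left_mono) auto
      finally have "cmod (E s) \<le> 2 * m * (2 * B) / cmod s" .
      moreover have "cmod s > 0" using s1 by linarith
      ultimately have "cmod (E s) * cmod s \<le> 2 * m * (2 * B)" by (simp only: pos_le_divide_eq)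
      then have "cmod (E s) * cmod s \<le> 4 * m * B" by simp
      moreover have "cmod (E s) * (1 + cmod s) \<le> cmod (E s) * (2 * cmod s)"
        using s1 by (intro mult_left_mono) auto
      ultimately show ?thesis using C1(2) by simp
    qed
    then show "cmod (E s) \<le> (B * (1 + R) + 8 * m * B) / (1 + cmod s)"
      unfolding C_def by (simp add: pos_le_divide_eq add_pos_nonneg)
  qed
qed

theorem homogeneous_trivial:
  shows "\<And>i. i \<in> {1..K} \<Longrightarrow> v i = 0" "\<And>i. i \<in> {1..L} \<Longrightarrow> w i = 0"
proof -
  obtain C where C: "\<And>s. Re s \<ge> 0 \<Longrightarrow> cmod (E s) \<le> C / (1 + cmod s)" using E_bound by blast
  have "E (of_real m) = 0" if "m > 0" for m
  proof (rule homogeneous_solution_zero[OF E_regular(1,2) C _ that])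
    fix s :: complex assume s: "Re s = 0"
    have q: "of_real r * quotient r (scaled a s) =
        of_real r * (E (scaled a s) - E (of_real r)) / (of_real r - scaled a s)"
      if "r > 0" for r a
    proof -
      \<comment> \<open>On the imaginary axis a scaled point never meets a positive rate, so
        \<open>quotient\<close> is the literal ratio there.\<close>
      have "Re (scaled a s) = 0" unfolding Re_divide_of_real s by simp
      then have "scaled a s \<noteq> of_real r" using that by (metis Re_complex_of_real less_irrefl)
      from quotient_regular[OF this] show ?thesis by (simp only: times_divide_eq_right)
    qed
    show "E s =
      x0 s / of_real (1 + a0) * (\<Sum>i=1..K. of_real (q i) * (of_real (\<mu> i) *
        (E (scaled a0 s) - E (of_real (\<mu> i))) / (of_real (\<mu> i) - scaled a0 s))) +
      x1 s / of_real (1 + a1) * (\<Sum>i=1..L. of_real (h i) * (of_real (\<nu> i) *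
        (E (scaled a1 s) - E (of_real (\<nu> i))) / (of_real (\<nu> i) - scaled a1 s)))"
      using E_regular(3)[of s] s unfolding T_def
      by (simp only: q \<mu> \<nu> order_refl cong: sum.cong)
  qed
  then show "i \<in> {1..K} \<Longrightarrow> v i = 0" "i \<in> {1..L} \<Longrightarrow> w i = 0" for i
    using E_rates \<mu> \<nu> by metis+
qed

end

section \<open>The series identity and the characterization of the constants\<close>

lemma gain_term_cong:
  "(\<And>i. i \<in> {1..N} \<Longrightarrow> w i = w' i) \<Longrightarrow> gain_term a x N p r w s = gain_term a x N p r w' s"
  unfolding gain_term_def
  by (intro arg_cong[where f = "times (chi_hat a x s)"] sum.cong) simp_all

lemma gain_term_diff:
  "gain_term a x N p r (\<lambda>i. w i - w' i) s = gain_term a x N p r w s - gain_term a x N p r w' s"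
  unfolding gain_term_def by (simp only: right_diff_distrib sum_subtractf)

context gain_system
begin

text \<open>\<open>F\<close> solves the system because it is continuous at the rates and equals the
  series off the singular set, which has no limit points. Conversely, any solution differs from
  \<open>F\<close> by data of \<open>homogeneous_system\<close>.\<close>

theorem system_characterizes:
  fixes ph F :: "complex \<Rightarrow> complex" and b C :: real
  assumes ph: "\<And>s. Re s \<ge> 0 \<Longrightarrow> cmod ((1 - ph s) / s) \<le> b"
    and F_bound: "\<And>s. Re s > 0 \<Longrightarrow> cmod (F s) \<le> C / sqrt (Re s)" "C \<ge> 0"
    and F_cont: "\<And>s. Re s > 0 \<Longrightarrow> isCont F s"
  defines "Kf \<equiv> K_fun a0 a1 ph x0 x1 K q \<mu> L h \<nu>"
  assumes F_eq: "\<And>s. Re s > 0 \<Longrightarrow> s \<notin> S \<Longrightarrow> F s = A F s + Kf (\<lambda>i. F (\<mu> i)) (\<lambda>i. F (\<nu> i)) s"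
  shows "\<And>s. Re s > 0 \<Longrightarrow> s \<notin> S \<Longrightarrow>
            convergent (L_diag a0 a1 L10 L01 s) \<and>
            summable (LK_diag a0 a1 L10 L01 (Kf (\<lambda>i. F (\<mu> i)) (\<lambda>i. F (\<nu> i))) s) \<and>
            F s = series_rhs a0 a1 L10 L01 (Kf (\<lambda>i. F (\<mu> i)) (\<lambda>i. F (\<nu> i))) s"
    and "\<And>y z. solves_system S (\<lambda>y z. series_rhs a0 a1 L10 L01 (Kf y z)) K \<mu> L \<nu> y z \<longleftrightarrow>
                 (\<forall>i\<in>{1..K}. y i = F (\<mu> i)) \<and> (\<forall>i\<in>{1..L}. z i = F (\<nu> i))"
proof -
  let ?F\<mu> = "\<lambda>i. F (of_real (\<mu> i))" and ?F\<nu> = "\<lambda>i. F (of_real (\<nu> i))"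
  let ?R = "\<lambda>y z. series_rhs a0 a1 L10 L01 (Kf y z)"
  let ?D = "\<lambda>y z. resolvent (\<lambda>s. - G (\<lambda>i. y i - ?F\<mu> i) (\<lambda>i. z i - ?F\<nu> i) s)"
  have Kf: "Kf y z s = (1 - ph s) / s - G y z s" for y z s
    unfolding Kf_def K_fun_def G_def by simp
  obtain d where d: "d > 0" "\<And>i. i \<in> {1..K} \<Longrightarrow> d < \<mu> i" "\<And>i. i \<in> {1..L} \<Longrightarrow> d < \<nu> i"
    using contraction_radius by metis
  have sm: "summable (\<lambda>n. (A ^^ n) (Kf y z) s)" if s: "Re s \<ge> 0" for y z s
  proof -
    obtain B where B: "\<And>s. Re s \<ge> 0 \<Longrightarrow> cmod s \<le> d \<Longrightarrow> cmod (G y z s) \<le> B"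
      using G_bounded_near_0[OF d(2,3)] by metis
    show ?thesis
    proof (rule summable_funpow[OF d(1) _ s])
      fix s assume "Re s \<ge> 0" "cmod s \<le> d"
      then show "cmod (Kf y z s) \<le> b + B"
        unfolding Kf using ph[of s] B[of s] by (intro order_trans[OF norm_triangle_ineq4]) simp
    qed
  qed
  have R: "?R y z s = resolvent (Kf y z) s" if "Re s \<ge> 0" for y z s
    unfolding series_rhs_def resolvent_def LK_diag_eq_funpow using lim_L_diag[OF that]
    by (simp add: limI)
  have series: "LK_diag a0 a1 L10 L01 (Kf ?F\<mu> ?F\<nu>) s sums F s" if "Re s > 0" "s \<notin> S" for s
    by (rule series_representation[OF F_eq F_bound that])
  have part1: "F s = ?R ?F\<mu> ?F\<nu> s" if "Re s > 0" "s \<notin> S" for s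
    using series[OF that] lim_L_diag[of s] that unfolding series_rhs_def by (simp add: limI sums_iff)
  show "convergent (L_diag a0 a1 L10 L01 s) \<and>
            summable (LK_diag a0 a1 L10 L01 (Kf ?F\<mu> ?F\<nu>) s) \<and> F s = ?R ?F\<mu> ?F\<nu> s"
    if "Re s > 0" "s \<notin> S" for s
    using series[OF that] lim_L_diag[of s] part1[OF that] that
    by (auto simp: convergent_def sums_iff)
  have ev_pos: "\<forall>\<^sub>F s in at (of_real r). Re s > 0" if "r > 0" for r
    using that open_halfspace_Re_gt[of 0] unfolding eventually_at_topological by force
  have F_value: "has_value S (?R ?F\<mu> ?F\<nu>) (of_real r) (F r)" if r: "r > 0" for r
  proof (cases "of_real r \<in> S")
    case True
    have "F \<midarrow>of_real r\<rightarrow> F r" using F_cont[of r] r by (simp add: isCont_def)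
    moreover have "\<forall>\<^sub>F s in at (of_real r). F s = ?R ?F\<mu> ?F\<nu> s"
      using ev_pos[OF r] eventually_notin_S by eventually_elim (rule part1)
    ultimately show ?thesis
      unfolding has_value_def using True by (auto intro: Lim_transform_eventually)
  next
    case False
    then show ?thesis unfolding has_value_def using part1[of r] r by simp
  qed
  \<comment> \<open>The term (1 - ph s)/s is common to both sides and cancels; what remains is
    \<open>- G\<close> at the differences of the unknowns, and the two convergent series may be
    subtracted termwise.\<close>
  have diff: "?R y z s - ?R ?F\<mu> ?F\<nu> s =
      ?D y z s" if "Re s \<ge> 0" for y z s
  proof -
    have "(\<lambda>s. - G (\<lambda>i. y i - ?F\<mu> i) (\<lambda>i. z i - ?F\<nu> i) s) = (\<lambda>s. Kf y z s - Kf ?F\<mu> ?F\<nu> s)"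
      by (rule ext) (simp only: Kf G_def gain_term_diff, simp)
    then show ?thesis
      unfolding R[OF that] unfolding resolvent_def
      by (simp only: funpow_gain_op_diff suminf_diff[OF sm sm] that)
  qed
  have value_diff: "has_value S (?D y z) (of_real r) (t - F r)"
    if "has_value S (?R y z) (of_real r) t" and r: "r > 0" for y z r t
  proof (cases "of_real r \<in> S")
    case True
    have "(\<lambda>s. ?R y z s - ?R ?F\<mu> ?F\<nu> s) \<midarrow>of_real r\<rightarrow> t - F r"
      using that(1) F_value[OF r] True unfolding has_value_def by (intro tendsto_diff) simp_all
    moreover have "\<forall>\<^sub>F s in at (of_real r). ?R y z s - ?R ?F\<mu> ?F\<nu> s =
        ?D y z s"
      using ev_pos[OF r] by eventually_elim (simp only: diff less_imp_le)
    ultimately have "?D y z \<midarrow>of_real r\<rightarrow> t - F r"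
      by (rule Lim_transform_eventually)
    then show ?thesis unfolding has_value_def using True by simp
  next
    case False
    then show ?thesis
      using that(1) F_value[OF r] diff[of "of_real r" y z] r unfolding has_value_def by simp
  qed
  show "solves_system S ?R K \<mu> L \<nu> y z \<longleftrightarrow>
      (\<forall>i\<in>{1..K}. y i = F (\<mu> i)) \<and> (\<forall>i\<in>{1..L}. z i = F (\<nu> i))" for y z
  proof
    assume sol: "solves_system S ?R K \<mu> L \<nu> y z"
    interpret homogeneous_system a0 a1 p0 p1 x0 x1 K L q \<mu> h \<nu> "\<lambda>i. y i - ?F\<mu> i" "\<lambda>i. z i - ?F\<nu> i"
    proof
      show "has_value S (?D y z) (of_real (\<mu> i)) (y i - ?F\<mu> i)"
        if "i \<in> {1..K}" for i
        using sol that by (intro value_diff \<mu>) (auto simp: solves_system_def)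
      show "has_value S (?D y z) (of_real (\<nu> i)) (z i - ?F\<nu> i)"
        if "i \<in> {1..L}" for i
        using sol that by (intro value_diff \<nu>) (auto simp: solves_system_def)
    qed
    show "(\<forall>i\<in>{1..K}. y i = F (\<mu> i)) \<and> (\<forall>i\<in>{1..L}. z i = F (\<nu> i))"
      using homogeneous_trivial by (simp only: right_minus_eq) blast
  next
    assume "(\<forall>i\<in>{1..K}. y i = F (\<mu> i)) \<and> (\<forall>i\<in>{1..L}. z i = F (\<nu> i))"
    then have *: "\<And>i. i \<in> {1..K} \<Longrightarrow> y i = F (\<mu> i)" "\<And>i. i \<in> {1..L} \<Longrightarrow> z i = F (\<nu> i)" by auto
    have "G y z s = G ?F\<mu> ?F\<nu> s" for s
      unfolding G_def using gain_term_cong[OF *(1)] gain_term_cong[OF *(2)] by simp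
    then have "Kf y z = Kf ?F\<mu> ?F\<nu>" by (intro ext) (simp only: Kf)
    then show "solves_system S ?R K \<mu> L \<nu> y z"
      unfolding solves_system_def using F_value \<mu> \<nu> * by simp
  qed
qed

end

section \<open>The embedded chain\<close>

text \<open>Ordered as ((B, T), (C0, C1)): the timing pair and the gain pair are independent, which
  makes the law of one step a product of products.\<close>

type_synonym gain_data = "(real \<times> real) \<times> (real \<times> real)"

definition risk_step :: "real \<Rightarrow> real \<Rightarrow> real \<Rightarrow> gain_data \<Rightarrow> real" where
  "risk_step a0 a1 x s =
    (let u = x - fst (fst s) in
      if u \<le> 0 then 0
      else if snd (fst s) \<ge> fst (fst s) then (1 + a0) * u + fst (snd s)
      else (1 + a1) * u + snd (snd s))"

primrec risk_chain :: "real \<Rightarrow> real \<Rightarrow> real \<Rightarrow> (nat \<Rightarrow> gain_data) \<Rightarrow> nat \<Rightarrow> real" where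
  "risk_chain a0 a1 x w 0 = x"
| "risk_chain a0 a1 x w (Suc n) = risk_step a0 a1 (risk_chain a0 a1 x w n) (w n)"

text \<open>Ruin read off the embedded chain, with no reference to continuous time. The weak
  inequality also counts a surplus that reaches 0 exactly at a gain epoch.\<close>

definition hits :: "real \<Rightarrow> real \<Rightarrow> real \<Rightarrow> (nat \<Rightarrow> gain_data) \<Rightarrow> bool" where
  "hits a0 a1 x w \<longleftrightarrow> (\<exists>n. risk_chain a0 a1 x w n \<le> fst (fst (w n)))"

lemma risk_chain_case_nat:
  "risk_chain a0 a1 x (case_nat s w) (Suc n) = risk_chain a0 a1 (risk_step a0 a1 x s) w n"
  by (induction n) auto

text \<open>First-step decomposition: \<open>case_nat\<close> prepends one gain, and the remaining
  path starts afresh from the new surplus.\<close>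

lemma hits_case_nat:
  "hits a0 a1 x (case_nat s w) \<longleftrightarrow> x \<le> fst (fst s) \<or> hits a0 a1 (risk_step a0 a1 x s) w"
proof -
  have split: "(\<exists>n. P n) \<longleftrightarrow> P 0 \<or> (\<exists>n. P (Suc n))" for P :: "nat \<Rightarrow> bool"
    by (metis not0_implies_Suc)
  show ?thesis
    unfolding hits_def
    by (subst (1) split) (simp del: risk_chain.simps(2) add: risk_chain_case_nat)
qed

lemma measurable_risk_step[measurable]:
  assumes "f \<in> borel_measurable N" "g \<in> measurable N borel"
  shows "(\<lambda>x. risk_step a0 a1 (f x) (g x)) \<in> borel_measurable N"
proof -
  have [measurable]: "(\<lambda>x. fst (fst (g x))) \<in> borel_measurable N" "(\<lambda>x. snd (fst (g x))) \<in> borel_measurable N"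
    "(\<lambda>x. fst (snd (g x))) \<in> borel_measurable N" "(\<lambda>x. snd (snd (g x))) \<in> borel_measurable N"
    using assms(2) by (auto simp: borel_prod[symmetric])
  note assms(1)[measurable]
  show ?thesis unfolding risk_step_def Let_def by measurable
qed

lemma measurable_risk_chain[measurable]:
  assumes "f \<in> borel_measurable N" "\<And>i. (\<lambda>x. g x i) \<in> measurable N borel"
  shows "(\<lambda>x. risk_chain a0 a1 (f x) (g x) n) \<in> borel_measurable N"
  by (induction n) (use assms in auto)

lemma pred_hits:
  assumes "f \<in> borel_measurable N" "\<And>i. (\<lambda>x. g x i) \<in> measurable N borel"
  shows "Measurable.pred N (\<lambda>x. hits a0 a1 (f x) (g x))"
proof -
  have [measurable]: "(\<lambda>x. fst (fst (g x i))) \<in> borel_measurable N" for i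
    using assms(2)[of i] by (auto simp: borel_prod[symmetric])
  have [measurable]: "(\<lambda>x. risk_chain a0 a1 (f x) (g x) n) \<in> borel_measurable N" for n
    by (rule measurable_risk_chain[OF assms])
  show ?thesis unfolding hits_def by measurable
qed

lemma post_gain_eq_chain:
  "post_gain a0 a1 B T C0 C1 x n w = risk_chain a0 a1 x (\<lambda>n. ((B n w, T n w), (C0 n w, C1 n w))) n"
  by (induction n) (simp_all add: risk_step_def Let_def)

text \<open>After the n-th gain the path falls with slope -1, so its only candidate zero is the time
  X_n + S_n, with X_n the surplus after that gain and S_n its epoch. Inserting this time removes the
  quantifier over real t, which makes measurability of ruin accessible. The last clause says that n
  is the index selected by \<open>LEAST\<close>.\<close>

lemma ruined_iff:
  "ruined a0 a1 B T C0 C1 x w \<longleftrightarrow>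
    (\<exists>n. 0 \<le> post_gain a0 a1 B T C0 C1 x n w + gain_time B n w \<and>
      post_gain a0 a1 B T C0 C1 x n w + gain_time B n w < gain_time B (Suc n) w \<and>
      (\<forall>k. k < n \<longrightarrow> gain_time B (Suc k) w \<le> post_gain a0 a1 B T C0 C1 x n w + gain_time B n w))"
    (is "_ \<longleftrightarrow> (\<exists>n. ?P n)")
proof
  assume "ruined a0 a1 B T C0 C1 x w"
  then obtain t m where t: "t \<ge> 0" "t < gain_time B m w" "surplus a0 a1 B T C0 C1 x t w = 0"
    unfolding ruined_def by blast
  define n where "n = (LEAST n. t < gain_time B (Suc n) w)"
  have "m \<noteq> 0" using t(1,2) by (intro notI) (simp add: gain_time_def)
  then have "\<exists>n. t < gain_time B (Suc n) w" using t(2) by (metis not0_implies_Suc)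
  then have 1: "t < gain_time B (Suc n) w" unfolding n_def by (rule LeastI_ex)
  have 2: "gain_time B (Suc k) w \<le> t" if "k < n" for k
    using not_less_Least[OF that[unfolded n_def]] by simp
  have "post_gain a0 a1 B T C0 C1 x n w + gain_time B n w = t"
    using t(3) unfolding surplus_def n_def[symmetric] Let_def by simp
  then have "?P n" using 1 2 t(1) by simp
  then show "\<exists>n. ?P n" by blast
next
  assume "\<exists>n. ?P n"
  then obtain n where n: "?P n" by blast
  define t where "t = post_gain a0 a1 B T C0 C1 x n w + gain_time B n w"
  have "(LEAST n. t < gain_time B (Suc n) w) = n"
  proof (rule Least_equality)
    show "n \<le> k" if "t < gain_time B (Suc k) w" for k
      using that n unfolding t_def by (meson leI not_less)
  qed (use n t_def in simp)
  then have "surplus a0 a1 B T C0 C1 x t w = 0"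
    unfolding surplus_def by (simp add: t_def)
  moreover have "t \<ge> 0" "t < gain_time B (Suc n) w" using n by (auto simp: t_def)
  ultimately show "ruined a0 a1 B T C0 C1 x w" unfolding ruined_def by blast
qed

text \<open>Positive gaps make the gain times increasing and nonnegative gains keep X_n >= 0, so the
  conditions of \<open>ruined_iff\<close> collapse to X_n < B_n. It remains to reconcile < with
  <=.\<close>

lemma ruined_iff_hits:
  assumes B: "\<And>n. B n w > 0" and C: "\<And>n. C0 n w \<ge> 0" "\<And>n. C1 n w \<ge> 0"
    and x: "x > 0" and a: "a0 > 0" "a1 > 0"
  shows "ruined a0 a1 B T C0 C1 x w \<longleftrightarrow>
    hits a0 a1 x (\<lambda>n. ((B n w, T n w), (C0 n w, C1 n w)))"
proof -
  let ?X = "\<lambda>n. post_gain a0 a1 B T C0 C1 x n w" and ?S = "\<lambda>n. gain_time B n w"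
  have X: "?X n \<ge> 0" for n
    by (induction n) (use assms in \<open>auto simp: Let_def\<close>)
  have S: "?S (Suc n) = ?S n + B n w" for n by (simp add: gain_time_def)
  have S_mono: "?S m \<le> ?S n" if "m \<le> n" for m n
    using lift_Suc_mono_le[of ?S, OF _ that] S B less_imp_le by (simp add: add_increasing2 less_imp_le)
  have S0: "?S n \<ge> 0" for n using S_mono[of 0 n] by (simp add: gain_time_def)
  have "(\<exists>n. ?X n \<le> B n w) \<longleftrightarrow> (\<exists>n. ?X n < B n w)"
  proof
    assume "\<exists>n. ?X n \<le> B n w"
    then obtain n where n: "?X n \<le> B n w" ..
    \<comment> \<open>If X_n = B_n, the zero falls on a gain epoch, where \<open>surplus\<close>
      already uses the next index. The value 0 set by \<open>post_gain\<close> then gives a strict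
      inequality one step later.\<close>
    then have "?X (Suc n) = 0" by simp
    then have "?X (Suc n) < B (Suc n) w" using B by simp
    then show "\<exists>n. ?X n < B n w" ..
  qed (use less_imp_le in blast)
  also have "\<dots> \<longleftrightarrow> ruined a0 a1 B T C0 C1 x w"
    unfolding ruined_iff
  proof (rule arg_cong[where f = Ex], rule ext)
    fix n
    have "?S (Suc k) \<le> ?X n + ?S n" if "k < n" for k
      using S_mono[of "Suc k" n] that X[of n] by simp
    then show "(?X n < B n w) = (0 \<le> ?X n + ?S n \<and> ?X n + ?S n < ?S (Suc n) \<and>
        (\<forall>k. k < n \<longrightarrow> ?S (Suc k) \<le> ?X n + ?S n))"
      using X[of n] S0[of n] S[of n] by auto
  qed
  finally show ?thesis unfolding hits_def post_gain_eq_chain[symmetric] by simp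
qed

section \<open>The hyperexponential law\<close>

definition hyperexp :: "nat \<Rightarrow> (nat \<Rightarrow> real) \<Rightarrow> (nat \<Rightarrow> real) \<Rightarrow> real measure" where
  "hyperexp N p r = density lborel (\<lambda>x. \<Sum>i=1..N. ennreal (p i) * ennreal (exponential_density (r i) x))"

context
  fixes N :: nat and p r :: "nat \<Rightarrow> real"
  assumes p: "\<And>i. i \<in> {1..N} \<Longrightarrow> p i \<ge> 0" "(\<Sum>i=1..N. p i) = 1"
    and r: "\<And>i. i \<in> {1..N} \<Longrightarrow> r i > 0"
begin

lemma sets_hyperexp[measurable_cong]: "sets (hyperexp N p r) = sets borel"
  by (simp add: hyperexp_def)

lemma nn_integral_hyperexp:
  assumes [measurable]: "g \<in> borel_measurable borel"
  shows "(\<integral>\<^sup>+x. g x \<partial>hyperexp N p r) =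
    (\<Sum>i=1..N. ennreal (p i) * (\<integral>\<^sup>+x. ennreal (exponential_density (r i) x) * g x \<partial>lborel))"
  unfolding hyperexp_def
  by (simp add: nn_integral_density sum_distrib_right nn_integral_sum nn_integral_cmult mult.assoc)

lemma emeasure_hyperexp_atMost:
  "emeasure (hyperexp N p r) {..x} = ennreal (if x \<ge> 0 then \<Sum>i=1..N. p i * (1 - exp (- r i * x)) else 0)"
proof -
  have "emeasure (hyperexp N p r) {..x} = (\<integral>\<^sup>+t. indicator {..x} t \<partial>hyperexp N p r)"
    by (simp add: sets_hyperexp)
  also have "\<dots> = (\<Sum>i=1..N. ennreal (p i) * ennreal (erlang_CDF 0 (r i) x))"
    using r by (subst nn_integral_hyperexp) (auto intro!: sum.cong simp: nn_integral_erlang_density)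
  also have "\<dots> = (\<Sum>i=1..N. ennreal (p i * erlang_CDF 0 (r i) x))"
    using p r by (intro sum.cong refl) (simp add: ennreal_mult' less_imp_le)
  also have "\<dots> = ennreal (\<Sum>i=1..N. p i * erlang_CDF 0 (r i) x)"
  proof (rule sum_ennreal)
    fix i assume i: "i \<in> {1..N}"
    show "0 \<le> p i * erlang_CDF 0 (r i) x"
      using p(1)[OF i] r[OF i] by (simp add: erlang_CDF_0)
  qed
  finally show ?thesis by (simp add: erlang_CDF_0)
qed

lemma real_distribution_hyperexp: "real_distribution (hyperexp N p r)"
proof -
  have "emeasure (hyperexp N p r) UNIV = (\<integral>\<^sup>+t. 1 \<partial>hyperexp N p r)"
    using sets_eq_imp_space_eq[OF sets_hyperexp] by simp
  also have "\<dots> = (\<Sum>i=1..N. ennreal (p i) * 1)"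
  proof (subst nn_integral_hyperexp, simp, intro sum.cong refl arg_cong2[where f = times])
    fix i assume "i \<in> {1..N}"
    then have "prob_space (density lborel (exponential_density (r i)))"
      using r by (intro prob_space_exponential_density)
    from prob_space.emeasure_space_1[OF this]
    show "(\<integral>\<^sup>+x. ennreal (exponential_density (r i) x) * 1 \<partial>lborel) = 1"
      by (simp add: emeasure_density)
  qed
  also have "\<dots> = ennreal (\<Sum>i=1..N. p i)" unfolding mult_1_right by (rule sum_ennreal) (rule p(1))
  finally have "emeasure (hyperexp N p r) UNIV = 1" using p(2) by simp
  then show ?thesis
    using sets_hyperexp sets_eq_imp_space_eq[OF sets_hyperexp]
    by (intro real_distribution.intro prob_spaceI real_distribution_axioms.intro) auto
qed

lemma integral_hyperexp:
  fixes g :: "real \<Rightarrow> complex"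
  assumes g[measurable]: "g \<in> borel_measurable borel" and b: "\<And>x. cmod (g x) \<le> b"
  shows "(\<integral>x. g x \<partial>hyperexp N p r) =
    (\<Sum>i=1..N. of_real (p i) * (\<integral>x. of_real (exponential_density (r i) x) * g x \<partial>lborel))"
proof -
  have int: "integrable lborel (\<lambda>x. of_real (exponential_density (r i) x) * g x)" if "i \<in> {1..N}" for i
  proof -
    have "integrable (density lborel (exponential_density (r i))) g"
      using prob_space_exponential_density[OF r[OF that]] b
      by (intro finite_measure.integrable_const_bound[of _ _ b] prob_space.finite_measure) auto
    then show ?thesis
      using r[OF that] by (subst (asm) integrable_density) (auto simp: exponential_density_nonneg scaleR_conv_of_real)
  qed
  have eq: "hyperexp N p r = density lborel (\<lambda>x. ennreal (\<Sum>i=1..N. p i * exponential_density (r i) x))"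
    unfolding hyperexp_def
  proof (intro density_cong AE_I2)
    fix x
    have "(\<Sum>i=1..N. ennreal (p i) * ennreal (exponential_density (r i) x)) = (\<Sum>i=1..N. ennreal (p i * exponential_density (r i) x))"
      using p(1) by (intro sum.cong refl ennreal_mult'[symmetric])
    also have "\<dots> = ennreal (\<Sum>i=1..N. p i * exponential_density (r i) x)"
      by (intro sum_ennreal mult_nonneg_nonneg p(1) exponential_density_nonneg r)
    finally show "(\<Sum>i=1..N. ennreal (p i) * ennreal (exponential_density (r i) x)) =
      ennreal (\<Sum>i=1..N. p i * exponential_density (r i) x)" .
  qed auto
  have "(\<integral>x. g x \<partial>hyperexp N p r) = (\<integral>x. (\<Sum>i=1..N. p i * exponential_density (r i) x) *\<^sub>R g x \<partial>lborel)"
    unfolding eq using p r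
    by (subst integral_density) (auto intro!: sum_nonneg AE_I2 simp: exponential_density_nonneg)
  also have "\<dots> = (\<integral>x. (\<Sum>i=1..N. of_real (p i) * (of_real (exponential_density (r i) x) * g x)) \<partial>lborel)"
    by (simp add: scaleR_conv_of_real sum_distrib_right mult.assoc)
  also have "\<dots> = (\<Sum>i=1..N. of_real (p i) * (\<integral>x. of_real (exponential_density (r i) x) * g x \<partial>lborel))"
    using int by (subst Bochner_Integration.integral_sum) auto
  finally show ?thesis .
qed

end

text \<open>The distribution function is prescribed only for x >= 0. Its value at 0 is 0, so
  monotonicity settles x < 0 and uniqueness of distribution functions applies.\<close>

lemma (in prob_space) distr_eq_hyperexp:
  assumes p: "\<And>i. i \<in> {1..N} \<Longrightarrow> p i \<ge> 0" "(\<Sum>i=1..N. p i) = 1"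
    and r: "\<And>i. i \<in> {1..N} \<Longrightarrow> r i > 0"
    and [measurable]: "X \<in> borel_measurable M"
    and cdf: "\<And>x. x \<ge> 0 \<Longrightarrow> measure M {w \<in> space M. X w \<le> x} = (\<Sum>i=1..N. p i * (1 - exp (- r i * x)))"
  shows "distr M borel X = hyperexp N p r" and "AE w in M. X w \<ge> 0"
proof -
  have 0: "measure M {w \<in> space M. X w \<le> 0} = 0" using cdf[of 0] by simp
  then have "AE w in M. w \<notin> {w \<in> space M. X w \<le> 0}"
    by (intro AE_not_in) (simp add: emeasure_eq_measure null_sets_def)
  then show "AE w in M. X w \<ge> 0" using AE_space by eventually_elim auto
  show "distr M borel X = hyperexp N p r"
  proof (rule cdf_unique)
    show "cdf (distr M borel X) = cdf (hyperexp N p r)"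
    proof
      fix x
      have "cdf (distr M borel X) x = measure M {w \<in> space M. X w \<le> x}"
        unfolding cdf_def by (subst measure_distr) (auto intro!: arg_cong[where f = "measure M"])
      also have "\<dots> = (if x \<ge> 0 then \<Sum>i=1..N. p i * (1 - exp (- r i * x)) else 0)"
      proof (cases "x \<ge> 0")
        case False
        then have "measure M {w \<in> space M. X w \<le> x} \<le> measure M {w \<in> space M. X w \<le> 0}"
          by (intro finite_measure_mono) auto
        then show ?thesis using False 0 by (simp add: measure_le_0_iff)
      qed (use cdf in simp)
      also have "\<dots> = cdf (hyperexp N p r) x"
      proof -
        have "(\<Sum>i=1..N. p i * (1 - exp (- r i * x))) \<ge> 0" if "x \<ge> 0"
        proof (rule sum_nonneg)
          fix i assume i: "i \<in> {1..N}"
          show "p i * (1 - exp (- r i * x)) \<ge> 0"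
            using p(1)[OF i] r[OF i] that by simp
        qed
        moreover have "emeasure (hyperexp N p r) {..x} = ennreal (if x \<ge> 0 then \<Sum>i=1..N. p i * (1 - exp (- r i * x)) else 0)"
          using p r by (rule emeasure_hyperexp_atMost)
        ultimately show ?thesis
          unfolding cdf_def measure_def by simp
      qed
      finally show "cdf (distr M borel X) x = cdf (hyperexp N p r) x" .
    qed
  qed (auto intro: real_distribution_hyperexp[OF p r] real_distribution_distr)
qed

section \<open>Laplace transforms of bounded functions\<close>

definition laplace :: "(real \<Rightarrow> real) \<Rightarrow> complex \<Rightarrow> complex" where
  "laplace R s = (LINT x:{0<..}|lborel. lexp s x * of_real (R x))"

lemma set_integrable_exp_real:
  fixes r c :: real
  assumes "r > 0"
  shows "set_integrable lborel {c<..} (\<lambda>x. exp (- r * x))"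
proof -
  have "integrable lborel (exponential_density r)"
  proof (rule integrableI_nonneg)
    have "(\<integral>\<^sup>+x. ennreal (exponential_density r x) \<partial>lborel) = 1"
      using prob_space.emeasure_space_1[OF prob_space_exponential_density[OF assms]]
      by (simp add: emeasure_density)
    then show "(\<integral>\<^sup>+x. ennreal (exponential_density r x) \<partial>lborel) < \<infinity>" by simp
  qed (use assms in \<open>auto simp: exponential_density_nonneg\<close>)
  then have "integrable lborel (\<lambda>x. exponential_density r (- c + 1 * x))"
    by (subst lborel_integrable_real_affine_iff) auto
  then have "integrable lborel (\<lambda>x. exp (- r * c) / r * exponential_density r (- c + 1 * x))"
    by (rule integrable_mult_right)
  then show ?thesis
    unfolding set_integrable_def
    by (rule Bochner_Integration.integrable_bound)
      (use assms in \<open>auto intro!: AE_I2 simp: indicator_def exponential_density_def exp_diff[symmetric] exp_add[symmetric] algebra_simps\<close>)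
qed

lemma norm_exp_times_real: "cmod (lexp s x) = exp (- Re s * x)"
  by (simp add: norm_exp_eq_Re)

lemma set_integrable_exp_complex:
  assumes s: "Re s > 0" and g: "g \<in> borel_measurable borel" "\<And>x. cmod (g x) \<le> b"
  shows "set_integrable lborel {c<..} (\<lambda>x. lexp s x * g x)"
proof -
  have "set_integrable lborel {c<..} (\<lambda>x. b * exp (- Re s * x))"
    using set_integrable_exp_real[OF s] by (intro set_integrable_mult_right)
  then show ?thesis
  proof (rule set_integrable_bound)
    show "set_borel_measurable lborel {c<..} (\<lambda>x. lexp s x * g x)"
      using g(1) unfolding set_borel_measurable_def by measurable
    have b: "b \<ge> 0" using g(2)[of 0] norm_ge_zero order_trans by blast
    show "AE x in lborel. x \<in> {c<..} \<longrightarrow> cmod (lexp s x * g x) \<le> norm (b * exp (- Re s * x))"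
    proof (intro AE_I2 impI)
      fix x
      have "cmod (lexp s x * g x) = cmod (g x) * exp (- Re s * x)"
        by (simp only: norm_mult norm_exp_times_real mult.commute)
      also have "\<dots> \<le> b * exp (- Re s * x)" using g(2) by (intro mult_right_mono) auto
      finally show "cmod (lexp s x * g x) \<le> norm (b * exp (- Re s * x))" using b by simp
    qed
  qed
qed

lemma integral_exp_tail:
  assumes s: "Re s > 0"
  shows "(LINT x:{c<..}|lborel. lexp s x) = lexp s c / s"
proof -
  have s0: "s \<noteq> 0" using s by auto
  let ?F = "\<lambda>x::real. - lexp s x / s"
  have "(LBINT x=ereal c..\<infinity>. lexp s x) = 0 - ?F c"
  proof (rule interval_integral_FTC_integrable)
    show "(?F has_vector_derivative lexp s x) (at x)" for x
    proof -
      have "((\<lambda>z. - exp (- s * z) / s) has_field_derivative lexp s x) (at (of_real x))"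
        using s0 by (auto intro!: derivative_eq_intros simp: field_simps)
      then show ?thesis by (rule has_vector_derivative_real_field)
    qed
    show "set_integrable lborel (einterval (ereal c) \<infinity>) (\<lambda>x. lexp s x)"
    proof -
      have "einterval (ereal c) \<infinity> = {c<..}" by (auto simp: einterval_def)
      then show ?thesis using set_integrable_exp_complex[OF s, of "\<lambda>_. 1" 1 c] by simp
    qed
    have "isCont ?F c" using s0 by (intro continuous_intros)
    then show "((?F \<circ> real_of_ereal) \<longlongrightarrow> ?F c) (at_right (ereal c))"
      unfolding ereal_tendsto_simps by (auto simp: isCont_def intro: tendsto_within_subset)
    have "((\<lambda>x. exp (- Re s * x)) \<longlongrightarrow> 0) at_top" using s by real_asymp
    then have "((\<lambda>x. lexp s x) \<longlongrightarrow> 0) at_top"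
      by (rule Lim_null_comparison[rotated]) (simp add: norm_exp_eq_Re)
    then show "((?F \<circ> real_of_ereal) \<longlongrightarrow> 0) (at_left \<infinity>)"
      unfolding ereal_tendsto_simps using tendsto_divide[OF tendsto_minus tendsto_const] s0 by fastforce
  qed (auto intro!: continuous_intros)
  moreover have "(LBINT x=ereal c..\<infinity>. lexp s x) = (LINT x:{c<..}|lborel. lexp s x)"
    by (simp add: interval_lebesgue_integral_def einterval_def greaterThan_def)
  ultimately show ?thesis by simp
qed

lemma integral_exp_tail_real:
  fixes r c :: real
  assumes "r > 0"
  shows "(\<integral>x. indicator {c<..} x * exp (- r * x) \<partial>lborel) = exp (- r * c) / r"
proof -
  have "complex_of_real (\<integral>x. indicator {c<..} x * exp (- r * x) \<partial>lborel) = (\<integral>x. of_real (indicator {c<..} x * exp (- r * x)) \<partial>lborel)"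
    by (rule integral_complex_of_real[symmetric])
  also have "\<dots> = (LINT x:{c<..}|lborel. exp (- of_real r * of_real x))"
    unfolding set_lebesgue_integral_def by (intro Bochner_Integration.integral_cong) (auto simp: indicator_def exp_of_real[symmetric])
  also have "\<dots> = of_real (exp (- r * c) / r)"
    using assms by (subst integral_exp_tail) (auto simp: exp_of_real[symmetric])
  finally show ?thesis by (simp only: of_real_eq_iff)
qed

lemma integral_exp_interval:
  assumes s: "Re s > 0" and b: "b \<ge> 0"
  shows "(LINT x:{0<..b}|lborel. lexp s x) = (1 - lexp s b) / s"
proof -
  have i: "set_integrable lborel {c<..} (\<lambda>x. lexp s x)" for c
    using set_integrable_exp_complex[OF s, of "\<lambda>_. 1" 1 c] by simp
  have i0: "set_integrable lborel {0<..b} (\<lambda>x. lexp s x)"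
    by (rule set_integrable_subset[OF i[of 0]]) auto
  have "(LINT x:{0<..b} \<union> {b<..}|lborel. lexp s x) =
      (LINT x:{0<..b}|lborel. lexp s x) + (LINT x:{b<..}|lborel. lexp s x)"
    by (rule set_integral_Un) (use i0 i[of b] in auto)
  moreover have "{0<..b} \<union> {b<..} = {0<..}" using b by auto
  ultimately have "1 / s = (LINT x:{0<..b}|lborel. lexp s x) + lexp s b / s"
    using integral_exp_tail[OF s, of 0] integral_exp_tail[OF s, of b] by simp
  then show ?thesis
    by (simp add: diff_divide_distrib)
qed

text \<open>In the application \<open>z\<close> is a rate minus a transform argument, whose real
  part may be negative; hence the bounded interval and the fundamental theorem.\<close>

lemma integral_exp_between:
  fixes z :: complex
  assumes z: "z \<noteq> 0" and t: "t \<ge> 0"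
  shows "(LINT x:{0..t}|lborel. lexp z x) = (1 - lexp z t) / z"
proof -
  let ?F = "\<lambda>x::real. - lexp z x / z"
  have "(\<integral>x. indicator {0..t} x *\<^sub>R lexp z x \<partial>lborel) = ?F t - ?F 0"
  proof (rule integral_FTC_Icc)
    show "(?F has_vector_derivative lexp z x) (at x within {0..t})" for x
    proof -
      have "((\<lambda>w. - exp (- z * w) / z) has_field_derivative lexp z x) (at (of_real x))"
        using z by (auto intro!: derivative_eq_intros simp: field_simps)
      then show ?thesis
        by (rule has_vector_derivative_at_within[OF has_vector_derivative_real_field])
    qed
  qed (use t in \<open>auto intro!: continuous_intros\<close>)
  then show ?thesis by (simp add: set_lebesgue_integral_def diff_divide_distrib)
qed

context
  fixes R :: "real \<Rightarrow> real"
  assumes R_meas[measurable]: "R \<in> borel_measurable borel" and R_bound: "\<And>x. 0 \<le> R x" "\<And>x. R x \<le> 1"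
begin

abbreviation (input) "li s x \<equiv> indicator {0<..} x *\<^sub>R (lexp s x * complex_of_real (R x))"

lemma laplace_integrable:
  assumes "Re s > 0"
  shows "set_integrable lborel {c<..} (\<lambda>x. lexp s x * of_real (R x))"
  using R_bound by (intro set_integrable_exp_complex[OF assms, where b = 1]) auto

lemma laplace_norm_le:
  assumes s: "Re s > 0"
  shows "cmod (laplace R s) \<le> 1 / Re s"
proof -
  have "cmod (laplace R s) \<le> (\<integral>x. cmod (li s x) \<partial>lborel)"
    unfolding laplace_def set_lebesgue_integral_def by (rule integral_norm_bound)
  also have "\<dots> \<le> (\<integral>x. indicator {0<..} x * exp (- Re s * x) \<partial>lborel)"
  proof (rule integral_mono)
    show "integrable lborel (\<lambda>x. cmod (li s x))"
      using laplace_integrable[OF s, of 0] by (intro integrable_norm) (simp add: set_integrable_def)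
    show "integrable lborel (\<lambda>x. indicator {0<..} x * exp (- Re s * x))"
      using set_integrable_exp_real[OF s, of 0] by (simp add: set_integrable_def)
    show "cmod (li s x) \<le> indicator {0<..} x * exp (- Re s * x)" for x
      using R_bound[of x] by (auto simp: indicator_def norm_mult norm_exp_eq_Re intro!: mult_left_le)
  qed
  also have "\<dots> = 1 / Re s" using integral_exp_tail_real[OF s, of 0] by simp
  finally show ?thesis .
qed

lemma laplace_isCont:
  assumes s: "Re s > 0"
  shows "isCont (laplace R) s"
proof -
  define d where "d = Re s / 2"
  have d: "d > 0" "d < Re s" using s by (auto simp: d_def)
  have "continuous_on {z. Re z > d} (laplace R)"
    unfolding continuous_on_sequentially comp_def
  proof safe
    fix X a assume a: "Re a > d" and X: "\<forall>n. X n \<in> {z. Re z > d}" "X \<longlonglongrightarrow> a"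
    show "(\<lambda>n. laplace R (X n)) \<longlonglongrightarrow> laplace R a"
      unfolding laplace_def set_lebesgue_integral_def
    proof (rule integral_dominated_convergence)
      show "integrable lborel (\<lambda>x. indicator {0<..} x * exp (- d * x))"
        using set_integrable_exp_real[OF d(1), of 0] by (simp add: set_integrable_def)
      show "AE x in lborel. (\<lambda>n. indicator {0<..} x *\<^sub>R (lexp (X n) x * of_real (R x)))
          \<longlonglongrightarrow> indicator {0<..} x *\<^sub>R (lexp a x * of_real (R x))"
        by (intro AE_I2 tendsto_intros X)
      show "AE x in lborel. cmod (indicator {0<..} x *\<^sub>R (lexp (X n) x * of_real (R x)))
          \<le> indicator {0<..} x * exp (- d * x)" for n
      proof (rule AE_I2)
        fix x :: real
        have "exp (- Re (X n) * x) * R x \<le> exp (- d * x) * 1" if "x > 0"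
          using X(1) R_bound[of x] that by (intro mult_mono) (auto simp: less_imp_le)
        then show "cmod (indicator {0<..} x *\<^sub>R (lexp (X n) x * of_real (R x)))
          \<le> indicator {0<..} x * exp (- d * x)"
          using R_bound[of x] by (auto simp: indicator_def norm_mult norm_exp_times_real)
      qed
    qed measurable
  qed
  then show ?thesis
    using d open_halfspace_Re_gt[of d] by (auto simp: continuous_on_eq_continuous_at)
qed

text \<open>Split at A: below, R <= 1 contributes at most A; above, R <= c/A contributes c/(A Re s).
  The choice A = 1/sqrt(Re s) gives both parts the same order.\<close>

lemma laplace_bound_sqrt:
  assumes c: "c \<ge> 0" "\<And>x. x > 0 \<Longrightarrow> R x \<le> c / x" and s: "Re s > 0"
  shows "cmod (laplace R s) \<le> (1 + c) / sqrt (Re s)"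
proof -
  define A where "A = 1 / sqrt (Re s)"
  have A: "A > 0" using s by (simp add: A_def)
  have int1: "integrable lborel (\<lambda>x. indicator {0<..A} x * (1::real))"
    using A by (intro integrable_mult_left) (simp add: integrable_indicator_iff)
  have int2: "integrable lborel (\<lambda>x. c / A * (indicator {0<..} x * exp (- Re s * x)))"
    using set_integrable_exp_real[OF s, of 0] by (intro integrable_mult_right) (simp add: set_integrable_def)
  have "cmod (laplace R s) \<le> (\<integral>x. cmod (li s x) \<partial>lborel)"
    unfolding laplace_def set_lebesgue_integral_def by (rule integral_norm_bound)
  also have "\<dots> \<le> (\<integral>x. indicator {0<..A} x * 1 + c / A * (indicator {0<..} x * exp (- Re s * x)) \<partial>lborel)"
  proof (rule integral_mono)
    show "integrable lborel (\<lambda>x. cmod (li s x))"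
      using laplace_integrable[OF s, of 0] by (intro integrable_norm) (simp add: set_integrable_def)
    show "cmod (li s x)
        \<le> indicator {0<..A} x * 1 + c / A * (indicator {0<..} x * exp (- Re s * x))" for x
    proof (cases "x > 0")
      case True
      have eq: "cmod (li s x) = exp (- Re s * x) * R x"
        using True R_bound[of x] by (simp add: norm_mult norm_exp_times_real)
      have e1: "exp (- Re s * x) \<le> 1" using True s by simp
      show ?thesis
      proof (cases "x \<le> A")
        case le: True
        have "exp (- Re s * x) * R x \<le> 1 * 1" using e1 R_bound[of x] by (intro mult_mono) auto
        then show ?thesis unfolding eq using True le c A by (simp add: add_increasing2)
      next
        case False
        have "R x \<le> c / A" using c(2)[OF True] c(1) False A frac_le[of c c A x] by simp
        then have "exp (- Re s * x) * R x \<le> exp (- Re s * x) * (c / A)" by (intro mult_left_mono) auto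
        then show ?thesis unfolding eq using True False by (simp add: mult.commute)
      qed
    qed simp
  qed (use int1 int2 in auto)
  also have "\<dots> = A + c / A * (1 / Re s)"
  proof -
    have "(\<integral>x. indicator {0<..} x * exp (- Re s * x) \<partial>lborel) = 1 / Re s"
      using integral_exp_tail_real[OF s, of 0] by simp
    moreover have "(\<integral>x. indicator {0<..A} x * (1::real) \<partial>lborel) = A" using A by simp
    ultimately show ?thesis
      using int1 int2 by (subst Bochner_Integration.integral_add) (simp_all only: integral_mult_right_zero)
  qed
  also have "\<dots> = (1 + c) / sqrt (Re s)"
    using s real_sqrt_mult_self[of "Re s"] unfolding A_def by (simp add: field_simps)
  finally show ?thesis .
qed

text \<open>The origin of the constants in the functional equation. After exchanging the integrals,
  the inner one runs over 0 < c < t and equals m/(m - w) * (e^(-w t) - e^(-m t)); its second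
  exponential produces the transform at the rate m.\<close>

lemma laplace_exponential_shift:
  assumes w: "Re w > 0" and m: "m > 0" and ne: "w \<noteq> of_real m"
  shows "(\<integral>c. of_real (exponential_density m c) *
      (LINT t:{c<..}|lborel. lexp w (t - c) * of_real (R t)) \<partial>lborel) =
    of_real m / (of_real m - w) * (laplace R w - laplace R (of_real m))"
proof -
  let ?e = "\<lambda>c t. indicator {c<..} t *\<^sub>R (lexp w (t - c) * of_real (R t))"
  let ?f = "\<lambda>c t. of_real (exponential_density m c) * ?e c t"
  have ind: "indicator {c<..} t = (if c < t then 1 else 0 :: real)" for c t :: real by simp
  have meas[measurable]: "case_prod ?f \<in> borel_measurable (lborel \<Otimes>\<^sub>M lborel)"
    unfolding ind by measurable
  have norm_e: "cmod (?e c t) \<le> exp (Re w * c) * (indicator {c<..} t * exp (- Re w * t))" for c t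
    using R_bound[of t] by (auto simp: indicator_def norm_mult norm_exp_eq_Re exp_add[symmetric] algebra_simps intro!: mult_left_le)
  have e_int: "integrable lborel (?e c)" for c
  proof -
    have "integrable lborel (\<lambda>t. exp (w * of_real c) * (indicator {c<..} t *\<^sub>R (lexp w t * of_real (R t))))"
      using laplace_integrable[OF w, of c] by (intro integrable_mult_right) (simp add: set_integrable_def)
    then show ?thesis
      by (rule Bochner_Integration.integrable_cong[THEN iffD1, rotated 2])
        (auto simp: indicator_def exp_add[symmetric] exp_diff algebra_simps)
  qed
  have exp_int: "exp (Re w * c) * (\<integral>t. indicator {c<..} t * exp (- Re w * t) \<partial>lborel) = 1 / Re w" for c
    unfolding integral_exp_tail_real[OF w] by (simp add: exp_minus)
  have dens_int: "integrable lborel (\<lambda>c. exponential_density m c)"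
  proof -
    have "integrable lborel (\<lambda>c. m * (indicator {0<..} c *\<^sub>R exp (- m * c)))"
      using set_integrable_exp_real[OF m, of 0] by (intro integrable_mult_right) (simp add: set_integrable_def)
    moreover have "AE c in lborel. m * (indicator {0<..} c *\<^sub>R exp (- m * c)) = exponential_density m c"
      using AE_lborel_singleton[of 0] by eventually_elim (auto simp: exponential_density_def indicator_def mult.commute)
    ultimately show ?thesis by (subst integrable_cong_AE[symmetric]) auto
  qed
  have f_int: "integrable (lborel \<Otimes>\<^sub>M lborel) (case_prod ?f)"
  proof (rule lborel_pair.Fubini_integrable[OF meas])
    show "integrable lborel (\<lambda>c. \<integral>t. norm (case_prod ?f (c, t)) \<partial>lborel)"
    proof (rule Bochner_Integration.integrable_bound)
      show "integrable lborel (\<lambda>c. exponential_density m c * (1 / Re w))"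
        using dens_int by (rule integrable_mult_left)
      show "(\<lambda>c. \<integral>t. norm (case_prod ?f (c, t)) \<partial>lborel) \<in> borel_measurable lborel"
        by measurable
      show "AE c in lborel. norm (\<integral>t. norm (case_prod ?f (c, t)) \<partial>lborel) \<le> norm (exponential_density m c * (1 / Re w))"
      proof (rule AE_I2)
        fix c
        have "(\<integral>t. norm (case_prod ?f (c, t)) \<partial>lborel) = exponential_density m c * (\<integral>t. cmod (?e c t) \<partial>lborel)"
        proof -
          have "norm (case_prod ?f (c, t)) = exponential_density m c * cmod (?e c t)" for t
            using exponential_density_nonneg[OF m, of c]
            by (simp only: prod.case norm_mult[of "of_real (exponential_density m c)"] norm_of_real abs_of_nonneg)
          then show ?thesis by (simp only: integral_mult_right_zero)
        qed
        also have "\<dots> \<le> exponential_density m c * (\<integral>t. exp (Re w * c) * (indicator {c<..} t * exp (- Re w * t)) \<partial>lborel)"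
          using exponential_density_nonneg[OF m, of c] e_int[of c] norm_e[of c] set_integrable_exp_real[OF w, of c]
          by (intro mult_left_mono integral_mono integrable_norm integrable_mult_right) (auto simp: set_integrable_def)
        also have "\<dots> = exponential_density m c * (1 / Re w)"
          by (simp only: integral_mult_right_zero exp_int)
        finally have le: "(\<integral>t. norm (case_prod ?f (c, t)) \<partial>lborel) \<le> exponential_density m c * (1 / Re w)" .
        have nn: "(\<integral>t. norm (case_prod ?f (c, t)) \<partial>lborel) \<ge> 0" by (rule Bochner_Integration.integral_nonneg) simp
        show "norm (\<integral>t. norm (case_prod ?f (c, t)) \<partial>lborel) \<le> norm (exponential_density m c * (1 / Re w))"
          unfolding real_norm_def abs_of_nonneg[OF nn] using le abs_ge_self order_trans by blast
      qed
    qed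
    show "AE c in lborel. integrable lborel (\<lambda>t. case_prod ?f (c, t))"
      using e_int by (intro AE_I2) (simp only: prod.case, rule integrable_mult_right)
  qed
  have "(\<integral>c. of_real (exponential_density m c) *
      (LINT t:{c<..}|lborel. lexp w (t - c) * of_real (R t)) \<partial>lborel) =
      (\<integral>c. (\<integral>t. ?f c t \<partial>lborel) \<partial>lborel)"
    unfolding set_lebesgue_integral_def by (simp only: integral_mult_right_zero)
  also have "\<dots> = (\<integral>t. (\<integral>c. ?f c t \<partial>lborel) \<partial>lborel)"
    by (rule lborel_pair.Fubini_integral[OF f_int, symmetric])
  also have "\<dots> = (\<integral>t. of_real m / (of_real m - w) *
      (indicator {0<..} t *\<^sub>R (lexp w t * of_real (R t)) -
       indicator {0<..} t *\<^sub>R (exp (- of_real m * of_real t) * of_real (R t))) \<partial>lborel)"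
  proof (rule Bochner_Integration.integral_cong[OF refl])
    fix t
    let ?z = "of_real m - w"
    have z: "?z \<noteq> 0" using ne by simp
    show "(\<integral>c. ?f c t \<partial>lborel) = of_real m / ?z *
      (indicator {0<..} t *\<^sub>R (lexp w t * of_real (R t)) -
       indicator {0<..} t *\<^sub>R (exp (- of_real m * of_real t) * of_real (R t)))"
    proof (cases "t > 0")
      case True
      have "(\<integral>c. ?f c t \<partial>lborel) = (\<integral>c. of_real m * lexp w t * of_real (R t) *
          (indicator {0..t} c *\<^sub>R lexp ?z c) \<partial>lborel)"
      proof (rule integral_cong_AE)
        show "AE c in lborel. ?f c t = of_real m * lexp w t * of_real (R t) *
          (indicator {0..t} c *\<^sub>R lexp ?z c)"
          \<comment> \<open>The condition c < t and the closed interval [0, t] disagree only at c =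
            t.\<close>
          using AE_lborel_singleton[of t]
        proof eventually_elim
          fix c :: real assume "c \<noteq> t"
          have "exp (- of_real (c * m)) * lexp w (t - c) = lexp w t * lexp ?z c"
            by (simp add: exp_add[symmetric] algebra_simps)
          then show "?f c t = of_real m * lexp w t * of_real (R t) *
            (indicator {0..t} c *\<^sub>R lexp ?z c)"
            using \<open>c \<noteq> t\<close> by (auto simp: indicator_def exponential_density_def exp_of_real[symmetric] mult_ac)
        qed
      qed (unfold ind, measurable)
      also have "\<dots> = of_real m * lexp w t * of_real (R t) * ((1 - lexp ?z t) / ?z)"
        using integral_exp_between[OF z, of t] True by (simp only: integral_mult_right_zero set_lebesgue_integral_def less_imp_le)
      also have "\<dots> = of_real m / ?z * (lexp w t * of_real (R t) -
          lexp w t * lexp ?z t * of_real (R t))"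
        by (simp add: algebra_simps diff_divide_distrib)
      also have "lexp w t * lexp ?z t = exp (- of_real m * of_real t)"
        by (simp add: exp_add[symmetric] algebra_simps)
      finally show ?thesis using True by simp
    next
      case False
      then have 0: "?f c t = 0" for c by (auto simp: indicator_def exponential_density_def)
      have "(\<integral>c. ?f c t \<partial>lborel) = 0" unfolding 0 by (rule Bochner_Integration.integral_zero)
      then show ?thesis using False by simp
    qed
  qed
  also have "\<dots> = of_real m / (of_real m - w) * (laplace R w - laplace R (of_real m))"
    using laplace_integrable[OF w, of 0] laplace_integrable[of "of_real m" 0] m
    unfolding laplace_def set_lebesgue_integral_def set_integrable_def
    by (simp only: integral_mult_right_zero Bochner_Integration.integral_diff Re_complex_of_real)
  finally show ?thesis .
qed

end

section \<open>The dual risk model\<close>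

locale dual_risk = prob_space M for M :: "'a measure" +
  fixes B T C0 C1 :: "nat \<Rightarrow> 'a \<Rightarrow> real"
    and f :: "real \<Rightarrow> ennreal"
    and a0 a1 :: real
    and K L :: nat
    and q \<mu> h \<nu> :: "nat \<Rightarrow> real"
  assumes indep: "indep_vars (\<lambda>_. borel) (source_var B T C0 C1) UNIV"
    and B_density: "\<And>n. distributed M lborel (B n) f"
    and B_pos: "\<And>n. AE w in M. B n w > 0"
    and B_mean: "integrable M (B 0)"
    and T_ident: "\<And>n. distr M borel (T n) = distr M borel (T 0)"
    and a_pos: "a0 > 0" "a1 > 0"
    and q: "\<And>i. i \<in> {1..K} \<Longrightarrow> q i \<ge> 0" "(\<Sum>i=1..K. q i) = 1"
    and h: "\<And>i. i \<in> {1..L} \<Longrightarrow> h i \<ge> 0" "(\<Sum>i=1..L. h i) = 1"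
    and \<mu>: "\<And>i. i \<in> {1..K} \<Longrightarrow> \<mu> i > 0"
    and \<nu>: "\<And>i. i \<in> {1..L} \<Longrightarrow> \<nu> i > 0"
    and C0_cdf: "\<And>n x. x \<ge> 0 \<Longrightarrow>
      measure M {w \<in> space M. C0 n w \<le> x} = (\<Sum>i=1..K. q i * (1 - exp (- \<mu> i * x)))"
    and C1_cdf: "\<And>n x. x \<ge> 0 \<Longrightarrow>
      measure M {w \<in> space M. C1 n w \<le> x} = (\<Sum>i=1..L. h i * (1 - exp (- \<nu> i * x)))"
begin

lemma rv_source: "random_variable borel (source_var B T C0 C1 i)"
  using indep unfolding indep_vars_def by auto

lemma rv[measurable]:
  "random_variable borel (B n)" "random_variable borel (T n)"
  "random_variable borel (C0 n)" "random_variable borel (C1 n)"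
  using rv_source[of "Interarrival n"] rv_source[of "Threshold n"] rv_source[of "Gain0 n"] rv_source[of "Gain1 n"]
  by simp_all

lemma indep_var_sources:
  assumes "I \<inter> J = {}" "F \<in> measurable (PiM I (\<lambda>_. borel)) N1" "G \<in> measurable (PiM J (\<lambda>_. borel)) N2"
  shows "indep_var N1 (\<lambda>w. F (\<lambda>i\<in>I. source_var B T C0 C1 i w)) N2 (\<lambda>w. G (\<lambda>i\<in>J. source_var B T C0 C1 i w))"
  using indep_var_compose[OF indep_var_restrict[OF indep assms(1)] assms(2,3)] by (simp add: comp_def)

lemma indep_BT: "indep_var borel (B n) borel (T n)"
  using indep_var_sources[of "{Interarrival n}" "{Threshold n}" "\<lambda>g. g (Interarrival n)" borel "\<lambda>g. g (Threshold n)" borel]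
  by simp

lemma indep_C0C1: "indep_var borel (C0 n) borel (C1 n)"
  using indep_var_sources[of "{Gain0 n}" "{Gain1 n}" "\<lambda>g. g (Gain0 n)" borel "\<lambda>g. g (Gain1 n)" borel]
  by simp

lemma indep_BT_C: "indep_var borel (\<lambda>w. (B n w, T n w)) borel (\<lambda>w. (C0 n w, C1 n w))"
  using indep_var_sources[of "{Interarrival n, Threshold n}" "{Gain0 n, Gain1 n}"
      "\<lambda>g. (g (Interarrival n), g (Threshold n))" borel "\<lambda>g. (g (Gain0 n), g (Gain1 n))" borel]
  by (simp add: borel_measurable_Pair)

definition path :: "'a \<Rightarrow> nat \<Rightarrow> gain_data" where
  "path w n = ((B n w, T n w), (C0 n w, C1 n w))"

lemma rv_path[measurable]: "random_variable borel (\<lambda>w. path w n)"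
  unfolding path_def by (intro borel_measurable_Pair rv)

lemma indep_path: "indep_vars (\<lambda>_. borel) (\<lambda>n w. path w n) UNIV"
proof -
  let ?K = "\<lambda>n. {Interarrival n, Threshold n, Gain0 n, Gain1 n}"
  have "indep_vars (\<lambda>n. PiM (?K n) (\<lambda>_. borel)) (\<lambda>n w. \<lambda>i\<in>?K n. source_var B T C0 C1 i w) UNIV"
    by (rule indep_vars_restrict[OF indep]) (auto simp: disjoint_family_on_def)
  then have "indep_vars (\<lambda>_. borel) (\<lambda>n w. (\<lambda>g. ((g (Interarrival n), g (Threshold n)), (g (Gain0 n), g (Gain1 n))))
      (\<lambda>i\<in>?K n. source_var B T C0 C1 i w)) UNIV"
    by (rule indep_vars_compose2) (intro borel_measurable_Pair measurable_component_singleton; simp)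
  then show ?thesis by (simp add: path_def)
qed

lemma C0_law: "distr M borel (C0 n) = hyperexp K q \<mu>" and C0_nonneg: "AE w in M. C0 n w \<ge> 0"
  using distr_eq_hyperexp[OF q \<mu> rv(3) C0_cdf] by auto

lemma C1_law: "distr M borel (C1 n) = hyperexp L h \<nu>" and C1_nonneg: "AE w in M. C1 n w \<ge> 0"
  using distr_eq_hyperexp[OF h \<nu> rv(4) C1_cdf] by auto

lemma B_law: "distr M borel (B n) = density lborel f"
  using distributed_distr_eq_density[OF B_density[of n]] by (simp cong: distr_cong)

abbreviation "step_law \<equiv> distr M borel (\<lambda>w. path w 0)"

text \<open>Within one step all four variables are independent, so the marginals determine the law,
  and these do not depend on n.\<close>

lemma path_ident: "distr M borel (\<lambda>w. path w n) = step_law"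
proof -
  have pair: "distr M borel (\<lambda>w. (X w, Y w)) = distr M borel X \<Otimes>\<^sub>M distr M borel Y"
    if "indep_var borel X borel Y" for X Y :: "'a \<Rightarrow> 'b::second_countable_topology"
    using that unfolding indep_var_distribution_eq by (simp add: borel_prod)
  have "distr M borel (\<lambda>w. path w n) =
      (density lborel f \<Otimes>\<^sub>M distr M borel (T 0)) \<Otimes>\<^sub>M (hyperexp K q \<mu> \<Otimes>\<^sub>M hyperexp L h \<nu>)" for n
    unfolding path_def
    by (simp only: pair[OF indep_BT_C] pair[OF indep_BT] pair[OF indep_C0C1] B_law C0_law C1_law T_ident[of n])
  then show ?thesis by metis
qed

abbreviation "path_space \<equiv> PiM (UNIV :: nat set) (\<lambda>_. step_law)"

lemma prob_space_step_law: "prob_space step_law"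
  by (rule prob_space_distr) (rule rv_path)

lemma rv_paths[measurable]: "random_variable path_space path"
  by (rule measurable_PiM_single') (auto simp: path_def)

text \<open>Independent steps with a common law have the infinite product as joint law, so
  \<open>R\<close> may be studied on the canonical space, where prepending a step preserves the
  measure.\<close>

lemma path_law: "distr M path_space path = path_space"
proof -
  have "distr M (PiM UNIV (\<lambda>_. borel)) (\<lambda>w. \<lambda>n\<in>UNIV. path w n) = PiM UNIV (\<lambda>n. distr M borel (\<lambda>w. path w n))"
    using indep_path by (subst (asm) indep_vars_iff_distr_eq_PiM) auto
  also have "\<dots> = path_space" by (rule PiM_cong[OF refl path_ident])
  also have "distr M (PiM UNIV (\<lambda>_. borel)) (\<lambda>w. \<lambda>n\<in>UNIV. path w n) = distr M path_space path"
  proof (rule distr_cong[OF refl])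
    show "sets (PiM UNIV (\<lambda>_. borel)) = sets path_space" by (rule sets_PiM_cong) simp_all
  qed (simp add: fun_eq_iff)
  finally show ?thesis .
qed

lemma component_measurable: "(\<lambda>w. w i) \<in> measurable path_space borel"
  using measurable_component_singleton[of i UNIV "\<lambda>_. step_law"] by simp

definition R :: "real \<Rightarrow> real" where
  "R x = measure path_space {w \<in> space path_space. hits a0 a1 x w}"

lemma pred_hits_path[measurable]: "Measurable.pred path_space (hits a0 a1 x)"
  using pred_hits[of "\<lambda>_. x" path_space "\<lambda>w. w"] component_measurable by simp

interpretation path_space: prob_space path_space
  by (rule prob_space_PiM) (rule prob_space_step_law)

lemma R_bounds: "0 \<le> R x" "R x \<le> 1"
  unfolding R_def by (auto intro: path_space.prob_le_1)

lemma R_measurable[measurable]: "R \<in> borel_measurable borel"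
proof -
  have [measurable]: "Measurable.pred (borel \<Otimes>\<^sub>M path_space) (\<lambda>y. hits a0 a1 (fst y) (snd y))"
    by (rule pred_hits) (auto intro!: measurable_compose[OF measurable_snd component_measurable])
  have "(\<lambda>x. \<integral>w. (of_bool (hits a0 a1 x w) :: real) \<partial>path_space) \<in> borel_measurable borel"
    by (rule path_space.borel_measurable_lebesgue_integral) (simp add: case_prod_beta)
  also have "(\<lambda>x. \<integral>w. (of_bool (hits a0 a1 x w) :: real) \<partial>path_space) = R"
  proof
    fix x
    have "(\<integral>w. (of_bool (hits a0 a1 x w) :: real) \<partial>path_space) = (\<integral>w. indicator {w \<in> space path_space. hits a0 a1 x w} w \<partial>path_space)"
      by (intro Bochner_Integration.integral_cong) (auto simp: indicator_def)
    then show "(\<integral>w. (of_bool (hits a0 a1 x w) :: real) \<partial>path_space) = R x"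
      unfolding R_def by simp
  qed
  finally show ?thesis .
qed

lemma R_eq_prob: "R x = measure M {w \<in> space M. hits a0 a1 x (path w)}"
proof -
  have "R x = measure (distr M path_space path) {w \<in> space path_space. hits a0 a1 x w}"
    unfolding path_law R_def ..
  also have "\<dots> = measure M (path -` {w \<in> space path_space. hits a0 a1 x w} \<inter> space M)"
    by (rule measure_distr) auto
  also have "path -` {w \<in> space path_space. hits a0 a1 x w} \<inter> space M = {w \<in> space M. hits a0 a1 x (path w)}"
    by (auto simp: space_PiM)
  finally show ?thesis .
qed

lemma AE_good: "AE w in M. (\<forall>n. B n w > 0) \<and> (\<forall>n. C0 n w \<ge> 0) \<and> (\<forall>n. C1 n w \<ge> 0)"
  using B_pos C0_nonneg C1_nonneg by (simp add: AE_all_countable)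

lemma ruin_prob_eq_R:
  assumes "x > 0"
  shows "ruin_prob M a0 a1 B T C0 C1 x = R x"
  unfolding ruin_prob_def R_eq_prob
proof (rule measure_eq_AE)
  show "AE w in M. (w \<in> {w \<in> space M. ruined a0 a1 B T C0 C1 x w}) = (w \<in> {w \<in> space M. hits a0 a1 x (path w)})"
    using AE_good
  proof eventually_elim
    case (elim w)
    then have "ruined a0 a1 B T C0 C1 x w = hits a0 a1 x (\<lambda>n. ((B n w, T n w), (C0 n w, C1 n w)))"
      using assms a_pos by (intro ruined_iff_hits) auto
    also have "(\<lambda>n. ((B n w, T n w), (C0 n w, C1 n w))) = path w"
      by (simp add: path_def fun_eq_iff)
    finally show ?case by simp
  qed
  have [measurable]: "random_variable borel (\<lambda>w. post_gain a0 a1 B T C0 C1 x n w)" for n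
    unfolding post_gain_eq_chain path_def[symmetric] by (rule measurable_risk_chain) auto
  have [measurable]: "random_variable borel (\<lambda>w. gain_time B n w)" for n
    unfolding gain_time_def by measurable
  show "{w \<in> space M. ruined a0 a1 B T C0 C1 x w} \<in> events"
    unfolding ruined_iff by measurable
  have "Measurable.pred M (\<lambda>w. hits a0 a1 x (path w))"
    by (rule pred_hits) auto
  then show "{w \<in> space M. hits a0 a1 x (path w)} \<in> events" by measurable
qed

text \<open>Conditioning on the first gain: the product space is the image of one step times itself
  under \<open>case_nat\<close>, and the section of the ruin event over a first step is given by
  \<open>hits_case_nat\<close>.\<close>

lemma renewal:
  "R x = (\<integral>w. (if x \<le> B 0 w then 1 else R (risk_step a0 a1 x (path w 0))) \<partial>M)"
proof -
  interpret step: prob_space step_law by (rule prob_space_step_law)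
  interpret SS: sequence_space step_law by unfold_locales
  let ?H = "{w \<in> space path_space. hits a0 a1 x w}"
  let ?c = "\<lambda>(s, w). case_nat s w"
  let ?r = "\<lambda>s. if x \<le> fst (fst s) then 1 else R (risk_step a0 a1 x s)"
  have c_meas: "?c \<in> measurable (step_law \<Otimes>\<^sub>M path_space) path_space"
    by measurable
  have fst_meas[measurable]: "(\<lambda>s::gain_data. fst (fst s)) \<in> borel_measurable borel"
    by (simp add: borel_prod[symmetric])
  have r_meas[measurable]: "?r \<in> borel_measurable borel"
    by measurable
  have r_bounds: "0 \<le> ?r s" "?r s \<le> 1" for s using R_bounds by auto
  have "ennreal (R x) = emeasure (distr (step_law \<Otimes>\<^sub>M path_space) path_space ?c) ?H"
    unfolding SS.PiM_iter R_def by (simp add: path_space.emeasure_eq_measure)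
  also have "\<dots> = emeasure (step_law \<Otimes>\<^sub>M path_space) (?c -` ?H \<inter> space (step_law \<Otimes>\<^sub>M path_space))"
    by (rule emeasure_distr[OF c_meas]) simp
  also have "\<dots> = (\<integral>\<^sup>+s. emeasure path_space (Pair s -` (?c -` ?H \<inter> space (step_law \<Otimes>\<^sub>M path_space))) \<partial>step_law)"
    by (rule path_space.emeasure_pair_measure_alt) (rule measurable_sets[OF c_meas], simp)
  also have "\<dots> = (\<integral>\<^sup>+s. ennreal (?r s) \<partial>step_law)"
  proof (rule nn_integral_cong)
    fix s assume "s \<in> space step_law"
    have "Pair s -` (?c -` ?H \<inter> space (step_law \<Otimes>\<^sub>M path_space)) =
        {w \<in> space path_space. x \<le> fst (fst s) \<or> hits a0 a1 (risk_step a0 a1 x s) w}"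
      by (auto simp: space_pair_measure space_PiM hits_case_nat)
    moreover have "emeasure path_space {w \<in> space path_space. x \<le> fst (fst s) \<or> hits a0 a1 (risk_step a0 a1 x s) w} = ennreal (?r s)"
      using path_space.emeasure_space_1 by (simp add: R_def path_space.emeasure_eq_measure)
    ultimately show "emeasure path_space (Pair s -` (?c -` ?H \<inter> space (step_law \<Otimes>\<^sub>M path_space))) = ennreal (?r s)"
      by simp
  qed
  also have "\<dots> = ennreal (\<integral>s. ?r s \<partial>step_law)"
    by (rule nn_integral_eq_integral)
      (use r_bounds in \<open>auto intro!: step.integrable_const_bound[of _ 1] AE_I2\<close>)
  finally have "R x = (\<integral>s. ?r s \<partial>step_law)"
    using R_bounds[of x] r_bounds by (subst (asm) ennreal_inj) (auto intro!: Bochner_Integration.integral_nonneg)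
  also have "\<dots> = (\<integral>w. ?r (path w 0) \<partial>M)"
    by (rule integral_distr) auto
  finally show ?thesis by (simp add: path_def)
qed

lemma B_integrable: "integrable M (B n)" and B_expectation: "expectation (B n) = expectation (B 0)"
proof -
  have eq: "distr M borel (B n) = distr M borel (B 0)" by (simp only: B_law)
  have "integrable (distr M borel (B 0)) (\<lambda>x. x)" using B_mean by (subst integrable_distr_eq) auto
  then show "integrable M (B n)" unfolding eq[symmetric] by (subst (asm) integrable_distr_eq) auto
  have "(\<integral>x. x \<partial>distr M borel (B n)) = (\<integral>x. x \<partial>distr M borel (B 0))" unfolding eq ..
  then show "expectation (B n) = expectation (B 0)" by (subst (asm) (1 2) integral_distr) auto
qed

text \<open>Until ruin X_(k+1) >= b (X_k - B_k), which unrolls to X_k >= b^k (x - sum of B_i b^(-i)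
  over i < k). Ruin therefore forces x <= W, and Markov's inequality applies to W.\<close>

lemma R_le:
  obtains c where "c \<ge> 0" "\<And>x. x > 0 \<Longrightarrow> R x \<le> c / x"
proof -
  define b where "b = 1 + min a0 a1"
  have b: "b > 1" "b \<le> 1 + a0" "b \<le> 1 + a1" using a_pos by (auto simp: b_def)
  \<comment> \<open>The expectation of W: a geometric series of ratio 1/b times the mean
    gap.\<close>
  define c where "c = expectation (B 0) * (1 / (1 - 1 / b))"
  have EB: "expectation (B 0) \<ge> 0" using B_pos[of 0] by (intro integral_nonneg_AE) auto
  then have c: "c \<ge> 0" using b by (auto simp: c_def intro!: mult_nonneg_nonneg)
  have "R x \<le> c / x" if x: "x > 0" for x
  proof -
    define W where "W w = (\<Sum>i. ennreal (B i w * (1 / b) ^ i))" for w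
    have [measurable]: "W \<in> borel_measurable M" unfolding W_def by measurable
    have "emeasure M {w \<in> space M. hits a0 a1 x (path w)} \<le> emeasure M {w \<in> space M. 1 \<le> ennreal (1 / x) * W w}"
    proof (rule emeasure_mono_AE)
      show "AE w in M. w \<in> {w \<in> space M. hits a0 a1 x (path w)} \<longrightarrow> w \<in> {w \<in> space M. 1 \<le> ennreal (1 / x) * W w}"
        using AE_good
      proof eventually_elim
        case (elim w)
        show ?case
        proof safe
          assume "hits a0 a1 x (path w)"
          then obtain n0 where n0: "risk_chain a0 a1 x (path w) n0 \<le> B n0 w"
            unfolding hits_def by (auto simp: path_def)
          \<comment> \<open>Minimality keeps the surplus before every earlier gain positive, so the
            default branch 0 of \<open>risk_step\<close> does not interfere with the lower
            bound.\<close>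
          define n where "n = (LEAST n. risk_chain a0 a1 x (path w) n \<le> B n w)"
          have n: "risk_chain a0 a1 x (path w) n \<le> B n w" unfolding n_def using n0 by (rule LeastI)
          have less: "risk_chain a0 a1 x (path w) k > B k w" if "k < n" for k
            using not_less_Least[OF that[unfolded n_def]] by simp
          have lower: "risk_chain a0 a1 x (path w) k \<ge> b ^ k * (x - (\<Sum>i<k. B i w * (1 / b) ^ i))" if "k \<le> n" for k
            using that
          proof (induction k)
            case (Suc k)
            let ?X = "risk_chain a0 a1 x (path w) k"
            have pos: "?X - B k w > 0" using less[of k] Suc.prems by simp
            have "b * (?X - B k w) \<le> risk_chain a0 a1 x (path w) (Suc k)"
            proof (cases "B k w \<le> T k w")
              case True
              have "b * (?X - B k w) \<le> (1 + a0) * (?X - B k w)" using b pos by (intro mult_right_mono) auto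
              then show ?thesis using True pos elim by (simp add: risk_step_def Let_def path_def add_increasing2)
            next
              case False
              have "b * (?X - B k w) \<le> (1 + a1) * (?X - B k w)" using b pos by (intro mult_right_mono) auto
              then show ?thesis using False pos elim by (simp add: risk_step_def Let_def path_def add_increasing2)
            qed
            moreover have "b * (b ^ k * (x - (\<Sum>i<k. B i w * (1 / b) ^ i)) - B k w) \<le> b * (?X - B k w)"
              using Suc.IH Suc.prems b by (intro mult_left_mono) auto
            moreover have "b * (b ^ k * (x - (\<Sum>i<k. B i w * (1 / b) ^ i)) - B k w) =
                b ^ Suc k * (x - (\<Sum>i<Suc k. B i w * (1 / b) ^ i))"
            proof -
              have "b ^ k * (B k w * (1 / b) ^ k) = B k w" using b by (simp add: power_divide)
              then show ?thesis by (simp add: algebra_simps)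
            qed
            ultimately show ?case by simp
          qed simp
          have "b ^ n * (x - (\<Sum>i<Suc n. B i w * (1 / b) ^ i)) = b ^ n * (x - (\<Sum>i<n. B i w * (1 / b) ^ i)) - B n w"
          proof -
            have "b ^ n * (B n w * (1 / b) ^ n) = B n w" using b by (simp add: power_divide)
            then show ?thesis by (simp add: algebra_simps)
          qed
          also have "\<dots> \<le> 0" using lower[OF order_refl] n by simp
          finally have le0: "b ^ n * (x - (\<Sum>i<Suc n. B i w * (1 / b) ^ i)) \<le> 0" .
          have x_le: "x \<le> (\<Sum>i<Suc n. B i w * (1 / b) ^ i)"
          proof (rule ccontr)
            assume "\<not> ?thesis"
            then have "b ^ n * (x - (\<Sum>i<Suc n. B i w * (1 / b) ^ i)) > 0"
              using b by (intro mult_pos_pos) auto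
            with le0 show False by simp
          qed
          have "ennreal x \<le> ennreal (\<Sum>i<Suc n. B i w * (1 / b) ^ i)" using x_le by (rule ennreal_leI)
          also have "\<dots> = (\<Sum>i<Suc n. ennreal (B i w * (1 / b) ^ i))"
            using elim b by (intro sum_ennreal[symmetric]) (auto simp: less_imp_le)
          also have "\<dots> \<le> W w" unfolding W_def by (intro sum_le_suminf) auto
          finally have "ennreal (1 / x) * ennreal x \<le> ennreal (1 / x) * W w" by (rule mult_left_mono) simp
          moreover have "ennreal (1 / x) * ennreal x = 1" using x by (simp add: ennreal_mult'[symmetric])
          ultimately show "1 \<le> ennreal (1 / x) * W w" by simp
        qed
      qed
    qed measurable
    also have "\<dots> \<le> ennreal (1 / x) * (\<integral>\<^sup>+w. W w * indicator (space M) w \<partial>M)"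
      by (rule nn_integral_Markov_inequality) auto
    also have "(\<integral>\<^sup>+w. W w * indicator (space M) w \<partial>M) = (\<integral>\<^sup>+w. W w \<partial>M)"
      by (intro nn_integral_cong) simp
    also have "\<dots> = (\<Sum>i. \<integral>\<^sup>+w. ennreal (B i w * (1 / b) ^ i) \<partial>M)"
      unfolding W_def by (rule nn_integral_suminf) measurable
    also have "\<dots> = (\<Sum>i. ennreal (expectation (B 0) * (1 / b) ^ i))"
    proof (rule arg_cong[where f = suminf], rule ext)
      fix i
      have "(\<integral>\<^sup>+w. ennreal (B i w * (1 / b) ^ i) \<partial>M) = ennreal (\<integral>w. B i w * (1 / b) ^ i \<partial>M)"
        using B_pos[of i] b B_integrable[of i] by (intro nn_integral_eq_integral) auto
      then show "(\<integral>\<^sup>+w. ennreal (B i w * (1 / b) ^ i) \<partial>M) = ennreal (expectation (B 0) * (1 / b) ^ i)"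
        by (simp only: integral_mult_left_zero B_expectation[of i])
    qed
    also have "\<dots> = ennreal c"
    proof -
      have "(\<lambda>i. expectation (B 0) * (1 / b) ^ i) sums c"
        unfolding c_def using b by (intro sums_mult geometric_sums) simp
      then show ?thesis
        using EB b by (subst suminf_ennreal_eq[of _ c]) auto
    qed
    also have "ennreal (1 / x) * ennreal c = ennreal (c / x)"
      using x by (subst ennreal_mult'[symmetric]) simp_all
    finally have "ennreal (R x) \<le> ennreal (c / x)"
      by (simp only: R_eq_prob emeasure_eq_measure)
    then show ?thesis using c x by (subst (asm) ennreal_le_iff) auto
  qed
  with c show ?thesis by (rule that)
qed

end

lemma exp_minus_lipschitz:
  assumes "Re z \<ge> 0" "Re w \<ge> 0"
  shows "cmod (exp (- z) - exp (- w)) \<le> cmod (z - w)"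
proof -
  have "cmod (exp (- z) - exp (- w)) \<le> 1 * cmod (z - w)"
  proof (rule field_differentiable_bound[where S = "{z. Re z \<ge> 0}" and f' = "\<lambda>z. - exp (- z)"])
    show "((\<lambda>z. exp (- z)) has_field_derivative - exp (- z)) (at z within {z. Re z \<ge> 0})" for z
      by (auto intro!: derivative_eq_intros)
    show "cmod (- exp (- z)) \<le> 1" if "z \<in> {z. Re z \<ge> 0}" for z
      using that by (simp add: norm_exp_eq_Re)
  qed (use assms in \<open>auto simp: convex_halfspace_Re_ge\<close>)
  then show ?thesis by simp
qed

section \<open>Transforms of nonnegative random variables\<close>

context prob_space
begin

context
  fixes X :: "'a \<Rightarrow> real" and W :: "'a \<Rightarrow> bool"
  assumes X: "integrable M X" "AE w in M. X w > 0" and W[measurable]: "Measurable.pred M W"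
begin

text \<open>Covers all three transforms of the model: \<open>W\<close> constantly true gives phi,
  and the events T >= B and T < B give chi_0 and chi_1.\<close>

abbreviation (input) transform :: "complex \<Rightarrow> complex" where
  "transform s \<equiv> \<integral>w. lexp s (X w) * of_bool (W w) \<partial>M"

lemma X_measurable[measurable]: "random_variable borel X"
  using X(1) by simp

lemma transform_integrand_bound:
  assumes "Re s \<ge> 0"
  shows "AE w in M. cmod (lexp s (X w) * of_bool (W w)) \<le> of_bool (W w)"
  using X(2)
proof eventually_elim
  case (elim w)
  have "cmod (lexp s (X w)) \<le> 1"
    using elim assms by (simp add: norm_exp_eq_Re)
  then show ?case by (simp add: norm_mult)
qed

lemma transform_integrable:
  assumes "Re s \<ge> 0"
  shows "integrable M (\<lambda>w. lexp s (X w) * of_bool (W w))"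
proof (rule integrable_const_bound[where B = 1])
  show "AE w in M. cmod (lexp s (X w) * of_bool (W w)) \<le> 1"
    using transform_integrand_bound[OF assms] by eventually_elim (auto intro: order_trans)
qed measurable

lemma transform_norm_le:
  assumes s: "Re s \<ge> 0"
  shows "cmod (transform s) \<le> prob {w \<in> space M. W w}"
proof -
  have "cmod (transform s) \<le>
      (\<integral>w. cmod (lexp s (X w) * of_bool (W w)) \<partial>M)"
    by (rule integral_norm_bound)
  also have "\<dots> \<le> (\<integral>w. indicator {w \<in> space M. W w} w \<partial>M)"
  proof (rule integral_mono_AE)
    show "AE w in M. cmod (lexp s (X w) * of_bool (W w)) \<le> indicator {w \<in> space M. W w} w"
      using transform_integrand_bound[OF s] AE_space by eventually_elim (simp add: indicator_def of_bool_def)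
    show "integrable M (indicat_real {w \<in> space M. W w})"
      by (rule integrable_real_indicator) (auto simp: emeasure_eq_measure)
  qed (use transform_integrable[OF s] in \<open>auto intro!: integrable_norm\<close>)
  finally show ?thesis by simp
qed

text \<open>The finite mean enters as a Lipschitz constant valid up to the imaginary axis. This
  yields continuity on the closed half-plane and, with one argument 0, the bound on (1 -
  phi(s))/s.\<close>

lemma transform_lipschitz:
  assumes s: "Re s \<ge> 0" "Re t \<ge> 0"
  shows "cmod ((transform s) -
      (transform t)) \<le> expectation X * cmod (s - t)"
proof -
  let ?f = "\<lambda>s w. lexp s (X w) * of_bool (W w)"
  have "cmod ((\<integral>w. ?f s w \<partial>M) - (\<integral>w. ?f t w \<partial>M)) = cmod (\<integral>w. ?f s w - ?f t w \<partial>M)"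
    by (simp only: Bochner_Integration.integral_diff[OF transform_integrable[OF s(1)] transform_integrable[OF s(2)]])
  also have "\<dots> \<le> (\<integral>w. cmod (?f s w - ?f t w) \<partial>M)"
    by (rule integral_norm_bound)
  also have "\<dots> \<le> (\<integral>w. X w * cmod (s - t) \<partial>M)"
  proof (rule integral_mono_AE)
    show "AE w in M. cmod (?f s w - ?f t w) \<le> X w * cmod (s - t)"
      using X(2)
    proof eventually_elim
      case (elim w)
      have "cmod (?f s w - ?f t w) \<le> cmod (exp (- (s * of_real (X w))) - exp (- (t * of_real (X w))))"
        by simp
      also have "\<dots> \<le> cmod (s * of_real (X w) - t * of_real (X w))"
        using elim s by (intro exp_minus_lipschitz) auto
      also have "\<dots> = X w * cmod (s - t)"
        using elim by (simp add: left_diff_distrib[symmetric] norm_mult)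
      finally show ?case .
    qed
  qed (use transform_integrable[OF s(1)] transform_integrable[OF s(2)] X(1) in \<open>auto intro!: integrable_norm\<close>)
  finally show ?thesis by simp
qed

lemma transform_continuous_on:
  "continuous_on cRHP (\<lambda>s. transform s)"
proof (rule lipschitz_on_continuous_on)
  have "expectation X \<ge> 0" using X(2) by (intro integral_nonneg_AE) auto
  then show "(expectation X)-lipschitz_on cRHP
      (\<lambda>s. transform s)"
    using transform_lipschitz by (intro lipschitz_onI) (auto simp: dist_norm)
qed

text \<open>Differentiation under the integral: by the Lipschitz bound for the exponential,
  \<open>X\<close> itself dominates all difference quotients.\<close>

lemma transform_holomorphic:
  "(\<lambda>s. transform s) holomorphic_on RHP"
proof -
  let ?f = "\<lambda>s w. lexp s (X w) * of_bool (W w)"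
  let ?d = "\<lambda>s w. - of_real (X w) * lexp s (X w) * of_bool (W w)"
  have "((\<lambda>s. \<integral>w. ?f s w \<partial>M) has_field_derivative (\<integral>w. ?d s w \<partial>M)) (at s within RHP)"
    if s: "Re s > 0" for s
    unfolding has_field_derivative_iff tendsto_at_iff_sequentially comp_def
  proof (intro allI impI)
    fix Y assume Y: "\<forall>i. Y i \<in> RHP - {s}" "Y \<longlonglongrightarrow> s"
    have Y': "Re (Y i) > 0" "Y i \<noteq> s" for i using Y(1) by auto
    have quot: "((\<integral>w. ?f (Y i) w \<partial>M) - (\<integral>w. ?f s w \<partial>M)) / (Y i - s) = (\<integral>w. (?f (Y i) w - ?f s w) / (Y i - s) \<partial>M)" for i
      using transform_integrable[of "Y i"] transform_integrable[of s] Y'[of i] s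
      by (simp only: Bochner_Integration.integral_diff less_imp_le integral_divide_zero)
    show "(\<lambda>i. ((\<integral>w. ?f (Y i) w \<partial>M) - (\<integral>w. ?f s w \<partial>M)) / (Y i - s)) \<longlonglongrightarrow> (\<integral>w. ?d s w \<partial>M)"
      unfolding quot
    proof (rule integral_dominated_convergence)
      show "integrable M X" by (rule X(1))
      show "AE w in M. (\<lambda>i. (?f (Y i) w - ?f s w) / (Y i - s)) \<longlonglongrightarrow> ?d s w"
      proof (rule AE_I2)
        fix w
        have "((\<lambda>s. ?f s w) has_field_derivative ?d s w) (at s)"
          by (auto intro!: derivative_eq_intros)
        then have "(\<lambda>y. (?f y w - ?f s w) / (y - s)) \<midarrow>s\<rightarrow> ?d s w"
          by (simp add: has_field_derivative_iff)
        moreover have "filterlim Y (at s) sequentially"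
          using Y Y' by (auto simp: filterlim_at)
        ultimately show "(\<lambda>i. (?f (Y i) w - ?f s w) / (Y i - s)) \<longlonglongrightarrow> ?d s w"
          by (rule filterlim_compose)
      qed
      show "AE w in M. cmod ((?f (Y i) w - ?f s w) / (Y i - s)) \<le> X w" for i
        using X(2)
      proof eventually_elim
        case (elim w)
        have "cmod (?f (Y i) w - ?f s w) \<le> cmod (exp (- (Y i * of_real (X w))) - exp (- (s * of_real (X w))))"
          by simp
        also have "\<dots> \<le> cmod (Y i * of_real (X w) - s * of_real (X w))"
          using elim s Y'(1)[of i] by (intro exp_minus_lipschitz) auto
        also have "\<dots> = X w * cmod (Y i - s)"
          using elim by (simp add: left_diff_distrib[symmetric] norm_mult)
        finally show ?case using Y'(2)[of i] by (simp add: norm_divide divide_le_eq)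
      qed
    qed measurable
  qed
  then show ?thesis
    unfolding holomorphic_on_def field_differentiable_def by blast
qed

end

end

section \<open>The functional equation\<close>

context dual_risk
begin

lemma rho_eq_laplace: "rho M a0 a1 B T C0 C1 = laplace R"
  unfolding rho_def[abs_def] laplace_def[abs_def]
  by (intro ext set_lebesgue_integral_cong) (auto simp: ruin_prob_eq_R)

lemma shifted_R_measurable[measurable]: "(\<lambda>u. R ((1 + a) * u + c)) \<in> borel_measurable borel"
  by measurable

text \<open>Substituting t = (1 + a) u + c produces both the scaled argument and the factor 1/(1 +
  a) of \<open>chi_hat\<close>.\<close>

lemma laplace_shifted_R:
  assumes a: "a > 0"
  shows "laplace (\<lambda>u. R ((1 + a) * u + c)) s = 1 / of_real (1 + a) *
    (LINT t:{c<..}|lborel. exp (- (scaled a s) * of_real (t - c)) * of_real (R t))"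
proof -
  let ?g = "\<lambda>t. indicator {c<..} t *\<^sub>R (exp (- (scaled a s) * of_real (t - c)) * of_real (R t))"
  have nz: "of_real (1 + a) \<noteq> 0" using a by (simp only: of_real_eq_0_iff)
  have "(\<integral>t. ?g t \<partial>lborel) = \<bar>1 + a\<bar> *\<^sub>R (\<integral>u. ?g (c + (1 + a) * u) \<partial>lborel)"
    using a by (intro lborel_integral_real_affine) simp
  also have "(\<lambda>u. ?g (c + (1 + a) * u)) = (\<lambda>u. indicator {0<..} u *\<^sub>R (lexp s u * of_real (R ((1 + a) * u + c))))"
  proof
    fix u
    have "indicator {c<..} (c + (1 + a) * u) = (indicator {0<..} u :: real)"
      using a by (auto simp: indicator_def zero_less_mult_iff)
    moreover have "- (scaled a s) * of_real (c + (1 + a) * u - c) = - s * of_real u"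
      using nz by (simp only: add_diff_cancel_left' of_real_mult) (simp del: of_real_add)
    ultimately show "?g (c + (1 + a) * u) = indicator {0<..} u *\<^sub>R (lexp s u * of_real (R ((1 + a) * u + c)))"
      by (simp only: add.commute)
  qed
  finally have "(\<integral>t. ?g t \<partial>lborel) = of_real (1 + a) * laplace (\<lambda>u. R ((1 + a) * u + c)) s"
    using a unfolding laplace_def set_lebesgue_integral_def by (simp add: scaleR_conv_of_real)
  then show ?thesis using nz unfolding set_lebesgue_integral_def by (simp del: of_real_add)
qed

lemma laplace_shifted_measurable[measurable]:
  "(\<lambda>c. laplace (\<lambda>u. R ((1 + a) * u + c)) s) \<in> borel_measurable borel"
proof -
  have ind: "indicator {0<..} t = (if 0 < t then 1 else 0 :: real)" for t :: real by simp
  show ?thesis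
    unfolding laplace_def set_lebesgue_integral_def ind
    by (rule lborel.borel_measurable_lebesgue_integral) measurable
qed

lemma laplace_shifted_bound:
  assumes "Re s > 0"
  shows "cmod (laplace (\<lambda>u. R ((1 + a) * u + c)) s) \<le> 1 / Re s"
  by (rule laplace_norm_le[OF shifted_R_measurable _ _ assms]) (auto simp: R_bounds)

lemma expectation_laplace_shifted:
  assumes X[measurable]: "random_variable borel X" and law: "distr M borel X = hyperexp N p r"
    and p: "\<And>i. i \<in> {1..N} \<Longrightarrow> p i \<ge> 0" "(\<Sum>i=1..N. p i) = 1" and r: "\<And>i. i \<in> {1..N} \<Longrightarrow> r i > 0"
    and a: "a > 0" and s: "Re s > 0"
    and ne: "\<And>i. i \<in> {1..N} \<Longrightarrow> scaled a s \<noteq> of_real (r i)"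
  shows "(\<integral>w. laplace (\<lambda>u. R ((1 + a) * u + X w)) s \<partial>M) =
    (\<Sum>i=1..N. of_real (p i) * (of_real (r i) / (of_real (r i) - scaled a s)) *
      (laplace R (scaled a s) - laplace R (of_real (r i)))) / of_real (1 + a)"
proof -
  let ?w = "scaled a s"
  have w: "Re ?w > 0" unfolding Re_divide_of_real using s a by simp
  have "(\<integral>w. laplace (\<lambda>u. R ((1 + a) * u + X w)) s \<partial>M) = (\<integral>c. laplace (\<lambda>u. R ((1 + a) * u + c)) s \<partial>hyperexp N p r)"
    unfolding law[symmetric] by (rule integral_distr[symmetric]) measurable
  also have "\<dots> = (\<Sum>i=1..N. of_real (p i) * (\<integral>c. of_real (exponential_density (r i) c) * laplace (\<lambda>u. R ((1 + a) * u + c)) s \<partial>lborel))"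
    using p r laplace_shifted_measurable laplace_shifted_bound[OF s] by (rule integral_hyperexp)
  also have "\<dots> = (\<Sum>i=1..N. of_real (p i) * (1 / of_real (1 + a) *
      (of_real (r i) / (of_real (r i) - ?w) * (laplace R ?w - laplace R (of_real (r i))))))"
  proof (intro sum.cong refl arg_cong2[where f = times])
    fix i assume i: "i \<in> {1..N}"
    have "(\<integral>c. of_real (exponential_density (r i) c) * laplace (\<lambda>u. R ((1 + a) * u + c)) s \<partial>lborel) =
        (\<integral>c. 1 / of_real (1 + a) * (of_real (exponential_density (r i) c) *
          (LINT t:{c<..}|lborel. lexp ?w (t - c) * of_real (R t))) \<partial>lborel)"
      unfolding laplace_shifted_R[OF a] by (simp only: mult_ac)
    also have "\<dots> = 1 / of_real (1 + a) * (of_real (r i) / (of_real (r i) - ?w) * (laplace R ?w - laplace R (of_real (r i))))"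
      unfolding integral_mult_right_zero
      by (subst laplace_exponential_shift[OF R_measurable R_bounds w r[OF i] ne[OF i]]) (rule refl)
    finally show "(\<integral>c. of_real (exponential_density (r i) c) * laplace (\<lambda>u. R ((1 + a) * u + c)) s \<partial>lborel) =
      1 / of_real (1 + a) * (of_real (r i) / (of_real (r i) - ?w) * (laplace R ?w - laplace R (of_real (r i))))" .
  qed
  also have "\<dots> = (\<Sum>i=1..N. of_real (p i) * (of_real (r i) / (of_real (r i) - ?w)) *
      (laplace R ?w - laplace R (of_real (r i)))) / of_real (1 + a)"
    unfolding sum_divide_distrib
  proof (intro sum.cong refl)
    have "P * (1 / b * (Q * Y)) = P * Q * Y / b" for P Q b Y :: complex by simp
    then show "of_real (p i) * (1 / of_real (1 + a) *
        (of_real (r i) / (of_real (r i) - ?w) * (laplace R ?w - laplace R (of_real (r i))))) =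
      of_real (p i) * (of_real (r i) / (of_real (r i) - ?w)) *
        (laplace R ?w - laplace R (of_real (r i))) / of_real (1 + a)" for i .
  qed
  finally show ?thesis .
qed

abbreviation (input) "k0 s w \<equiv> lexp s (B 0 w) * of_bool (T 0 w \<ge> B 0 w)"
abbreviation (input) "k1 s w \<equiv> lexp s (B 0 w) * of_bool (T 0 w < B 0 w)"
abbreviation (input) "l0 s w \<equiv> laplace (\<lambda>u. R ((1 + a0) * u + C0 0 w)) s"
abbreviation (input) "l1 s w \<equiv> laplace (\<lambda>u. R ((1 + a1) * u + C1 0 w)) s"

text \<open>For a fixed outcome, initial surpluses x <= B are ruined before the first gain and
  integrate to (1 - e^(-s B))/s. For x > B the shift u = x - B extracts e^(-s B), and only one of
  the two regimes survives.\<close>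

lemma path_integral:
  assumes s: "Re s > 0" and B: "B 0 w > 0"
  shows "(\<integral>x. indicator {0<..} x *\<^sub>R (lexp s x *
      of_real (if x \<le> B 0 w then 1 else R (risk_step a0 a1 x (path w 0)))) \<partial>lborel) =
    (1 - lexp s (B 0 w)) / s +
    k0 s w * l0 s w +
    k1 s w * l1 s w"
    (is "(\<integral>x. ?F x \<partial>lborel) = _")
proof -
  let ?b = "B 0 w"
  define r where "r u = (if T 0 w \<ge> ?b then R ((1 + a0) * u + C0 0 w) else R ((1 + a1) * u + C1 0 w))" for u
  have r_meas[measurable]: "r \<in> borel_measurable borel"
    unfolding r_def[abs_def] by (cases "T 0 w \<ge> ?b") simp_all
  have r_bounds: "0 \<le> r u" "r u \<le> 1" for u using R_bounds by (auto simp: r_def)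
  let ?e = "\<lambda>x. indicator {0<..?b} x *\<^sub>R lexp s x"
  let ?g = "\<lambda>x. indicator {?b<..} x *\<^sub>R (lexp s x * of_real (r (x - ?b)))"
  have F: "?F x = ?e x + ?g x" for x
    using B by (auto simp: indicator_def r_def risk_step_def path_def Let_def)
  have e_int: "integrable lborel ?e"
  proof -
    have "set_integrable lborel {0<..} (\<lambda>x. lexp s x)"
      using set_integrable_exp_complex[OF s, of "\<lambda>_. 1" 1 0] by simp
    then have "set_integrable lborel {0<..?b} (\<lambda>x. lexp s x)"
      by (rule set_integrable_subset) auto
    then show ?thesis by (simp add: set_integrable_def)
  qed
  have g_int: "integrable lborel ?g"
    using set_integrable_exp_complex[OF s, of "\<lambda>x. of_real (r (x - ?b))" 1 ?b] r_bounds
    by (simp add: set_integrable_def)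
  have "(\<integral>x. ?F x \<partial>lborel) = (\<integral>x. ?e x \<partial>lborel) + (\<integral>x. ?g x \<partial>lborel)"
    unfolding F by (rule Bochner_Integration.integral_add[OF e_int g_int])
  also have "(\<integral>x. ?e x \<partial>lborel) = (1 - lexp s ?b) / s"
    using integral_exp_interval[OF s less_imp_le[OF B]] by (simp add: set_lebesgue_integral_def)
  also have "(\<integral>x. ?g x \<partial>lborel) = \<bar>1\<bar> *\<^sub>R (\<integral>u. ?g (?b + 1 * u) \<partial>lborel)"
    by (rule lborel_integral_real_affine) simp
  also have "(\<lambda>u. ?g (?b + 1 * u)) = (\<lambda>u. lexp s ?b * (indicator {0<..} u *\<^sub>R (lexp s u * of_real (r u))))"
    by (auto simp: indicator_def exp_add[symmetric] algebra_simps)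
  also have "(\<integral>u. lexp s ?b * (indicator {0<..} u *\<^sub>R (lexp s u * of_real (r u))) \<partial>lborel) =
      lexp s ?b * laplace r s"
    unfolding laplace_def set_lebesgue_integral_def by (rule integral_mult_right_zero)
  also have "\<bar>1\<bar> *\<^sub>R (lexp s ?b * laplace r s) =
      k0 s w * l0 s w +
      k1 s w * l1 s w"
    by (cases "T 0 w \<ge> ?b") (simp_all add: r_def[abs_def])
  finally show ?thesis by (simp only: add.assoc)
qed

text \<open>The renewal equation integrated against e^(-s x), with the two integrals exchanged;
  e^(-(Re s) x) dominates.\<close>

lemma laplace_R_eq_expectation:
  assumes s: "Re s > 0"
  shows "laplace R s =
    (\<integral>w. (1 - lexp s (B 0 w)) / s +
      k0 s w * l0 s w +
      k1 s w * l1 s w \<partial>M)"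
    (is "_ = (\<integral>w. ?H w \<partial>M)")
proof -
  let ?g = "\<lambda>x w. if x \<le> B 0 w then 1 else R (risk_step a0 a1 x (path w 0))"
  let ?F = "\<lambda>x w. indicator {0<..} x *\<^sub>R (lexp s x * of_real (?g x w))"
  interpret pair_sigma_finite lborel M ..
  have ind: "indicator {0<..} t = (if 0 < t then 1 else 0 :: real)" for t :: real by simp
  have [measurable]: "(\<lambda>y. R (risk_step a0 a1 (fst y) (path (snd y) 0))) \<in> borel_measurable (lborel \<Otimes>\<^sub>M M)"
    by (rule measurable_compose[OF _ R_measurable], rule measurable_risk_step)
      (auto intro: measurable_compose[OF measurable_snd rv_path])
  have F_meas[measurable]: "case_prod ?F \<in> borel_measurable (lborel \<Otimes>\<^sub>M M)"
    unfolding ind case_prod_beta by measurable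
  have g_bounds: "0 \<le> ?g x w" "?g x w \<le> 1" for x w using R_bounds by auto
  have F_norm: "cmod (?F x w) \<le> indicator {0<..} x * exp (- Re s * x)" for x w
    unfolding norm_scaleR norm_mult norm_exp_times_real norm_of_real
    using g_bounds[of x w] by (intro mult_mono mult_left_le) (auto simp: indicator_def)
  have F_meas': "?F x \<in> borel_measurable M" for x
    using measurable_compose[OF measurable_Pair1' F_meas, of x] by simp
  have F_int_x: "integrable M (?F x)" for x
    by (rule integrable_const_bound[OF _ F_meas']) (rule AE_I2, rule F_norm)
  have F_int: "integrable (lborel \<Otimes>\<^sub>M M) (case_prod ?F)"
  proof (rule Fubini_integrable[OF F_meas])
    show "integrable lborel (\<lambda>x. \<integral>w. norm (case_prod ?F (x, w)) \<partial>M)"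
    proof (rule Bochner_Integration.integrable_bound)
      show "integrable lborel (\<lambda>x. indicator {0<..} x * exp (- Re s * x))"
        using set_integrable_exp_real[OF s, of 0] by (simp add: set_integrable_def)
      show "(\<lambda>x. \<integral>w. norm (case_prod ?F (x, w)) \<partial>M) \<in> borel_measurable lborel"
        by measurable
      show "AE x in lborel. norm (\<integral>w. norm (case_prod ?F (x, w)) \<partial>M) \<le> norm (indicator {0<..} x * exp (- Re s * x))"
      proof (rule AE_I2)
        fix x
        have "(\<integral>w. norm (case_prod ?F (x, w)) \<partial>M) \<le> (\<integral>w. indicator {0<..} x * exp (- Re s * x) \<partial>M)"
          using F_int_x[of x] F_norm[of x] by (intro integral_mono integrable_norm) auto
        also have "\<dots> = indicator {0<..} x * exp (- Re s * x)" by (simp add: prob_space)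
        finally have le: "(\<integral>w. norm (case_prod ?F (x, w)) \<partial>M) \<le> indicator {0<..} x * exp (- Re s * x)" .
        have nn: "(\<integral>w. norm (case_prod ?F (x, w)) \<partial>M) \<ge> 0"
          by (rule Bochner_Integration.integral_nonneg) simp
        show "norm (\<integral>w. norm (case_prod ?F (x, w)) \<partial>M) \<le> norm (indicator {0<..} x * exp (- Re s * x))"
          unfolding real_norm_def abs_of_nonneg[OF nn] using le abs_ge_self order_trans by blast
      qed
    qed
    show "AE x in lborel. integrable M (\<lambda>w. case_prod ?F (x, w))"
      using F_int_x by (intro AE_I2) simp
  qed
  have "laplace R s = (\<integral>x. (\<integral>w. ?F x w \<partial>M) \<partial>lborel)"
    unfolding laplace_def set_lebesgue_integral_def
  proof (rule Bochner_Integration.integral_cong[OF refl])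
    fix x
    have "complex_of_real (R x) = (\<integral>w. of_real (?g x w) \<partial>M)"
      by (subst renewal) (rule integral_complex_of_real[symmetric])
    then show "indicator {0<..} x *\<^sub>R (lexp s x * of_real (R x)) = (\<integral>w. ?F x w \<partial>M)"
      by (simp only: integral_scaleR_right integral_mult_right_zero)
  qed
  also have "\<dots> = (\<integral>w. (\<integral>x. ?F x w \<partial>lborel) \<partial>M)"
    by (rule Fubini_integral[OF F_int, symmetric])
  also have "\<dots> = (\<integral>w. ?H w \<partial>M)"
  proof (rule integral_cong_AE)
    show "AE w in M. (\<integral>x. ?F x w \<partial>lborel) = ?H w"
      using B_pos[of 0] by eventually_elim (rule path_integral[OF s])
    show "(\<lambda>w. \<integral>x. ?F x w \<partial>lborel) \<in> borel_measurable M"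
      using lborel.borel_measurable_lebesgue_integral[of "\<lambda>w x. ?F x w" M] measurable_pair_swap[OF F_meas]
      by (simp add: case_prod_beta)
    show "?H \<in> borel_measurable M"
      by measurable
  qed
  finally show ?thesis .
qed

text \<open>The kernels read only B and T, the other factors only C0 or C1, which are disjoint parts
  of the source family. The coupling between B and T stays inside chi_0 and chi_1.\<close>

lemma indep_transform_gain:
  assumes [measurable]: "g \<in> borel_measurable borel" "g' \<in> borel_measurable borel"
  shows "indep_var borel (\<lambda>w. k0 s w) borel (\<lambda>w. g (C0 0 w) :: complex)"
    "indep_var borel (\<lambda>w. k1 s w) borel (\<lambda>w. g' (C1 0 w) :: complex)"
proof -
  let ?I = "{Interarrival 0, Threshold 0}"
  have comp[measurable]: "(\<lambda>w. w (Interarrival 0)) \<in> borel_measurable (PiM ?I (\<lambda>_. borel :: real measure))"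
    "(\<lambda>w. w (Threshold 0)) \<in> borel_measurable (PiM ?I (\<lambda>_. borel :: real measure))"
    by (rule measurable_component_singleton; simp)+
  have [measurable]: "Measurable.pred (PiM ?I (\<lambda>_. borel :: real measure)) (\<lambda>w. w (Threshold 0) \<ge> w (Interarrival 0))"
    "Measurable.pred (PiM ?I (\<lambda>_. borel :: real measure)) (\<lambda>w. w (Threshold 0) < w (Interarrival 0))"
    unfolding pred_def by (rule borel_measurable_le borel_measurable_less; rule comp)+
  have [measurable]: "(\<lambda>w. w i) \<in> borel_measurable (PiM {i} (\<lambda>_. borel :: real measure))" for i :: source
    by (rule measurable_component_singleton) simp
  have F: "(\<lambda>w. exp (- s * of_real (w (Interarrival 0))) * of_bool (w (Threshold 0) \<ge> w (Interarrival 0)))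
      \<in> borel_measurable (PiM ?I (\<lambda>_. borel :: real measure))"
    "(\<lambda>w. exp (- s * of_real (w (Interarrival 0))) * of_bool (w (Threshold 0) < w (Interarrival 0)))
      \<in> borel_measurable (PiM ?I (\<lambda>_. borel :: real measure))"
    by measurable
  have G: "(\<lambda>w. g (w (Gain0 0))) \<in> borel_measurable (PiM {Gain0 0} (\<lambda>_. borel :: real measure))"
    "(\<lambda>w. g' (w (Gain1 0))) \<in> borel_measurable (PiM {Gain1 0} (\<lambda>_. borel :: real measure))"
    by measurable
  show "indep_var borel (\<lambda>w. k0 s w) borel (\<lambda>w. g (C0 0 w) :: complex)"
    using indep_var_sources[OF _ F(1) G(1)] by simp
  show "indep_var borel (\<lambda>w. k1 s w) borel (\<lambda>w. g' (C1 0 w) :: complex)"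
    using indep_var_sources[OF _ F(2) G(2)] by simp
qed

lemma laplace_R_eq:
  assumes s: "Re s > 0"
  shows "laplace R s = (1 - phi M (B 0) s) / s +
    chi0 M (B 0) (T 0) s * (\<integral>w. l0 s w \<partial>M) +
    chi1 M (B 0) (T 0) s * (\<integral>w. l1 s w \<partial>M)"
proof -
  have s': "Re s \<ge> 0" using s by simp
  have W: "Measurable.pred M (\<lambda>w. T 0 w \<ge> B 0 w)" "Measurable.pred M (\<lambda>w. T 0 w < B 0 w)" "Measurable.pred M (\<lambda>w. True)"
    by measurable
  note int = transform_integrable[OF B_mean B_pos[of 0] W(1) s'] transform_integrable[OF B_mean B_pos[of 0] W(2) s']
  have exp_int: "integrable M (\<lambda>w. lexp s (B 0 w))"
    using transform_integrable[OF B_mean B_pos[of 0] W(3) s'] by simp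
  have l_int: "integrable M (\<lambda>w. laplace (\<lambda>u. R ((1 + a) * u + X w)) s)" if "random_variable borel X" for a X
    by (rule integrable_const_bound[where B = "1 / Re s"])
      (use laplace_shifted_bound[OF s] measurable_compose[OF that laplace_shifted_measurable] in auto)
  note ind = indep_transform_gain[OF laplace_shifted_measurable[of a0 s] laplace_shifted_measurable[of a1 s]]
  note prod0 = indep_var_lebesgue_integral[OF ind(1) int(1) l_int[OF rv(3)]] indep_var_integrable[OF ind(1) int(1) l_int[OF rv(3)]]
  note prod1 = indep_var_lebesgue_integral[OF ind(2) int(2) l_int[OF rv(4)]] indep_var_integrable[OF ind(2) int(2) l_int[OF rv(4)]]
  have i0: "integrable M (\<lambda>w. (1 - lexp s (B 0 w)) / s)"
    using exp_int by (intro integrable_divide_zero Bochner_Integration.integrable_diff) auto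
  have e0: "(\<integral>w. (1 - lexp s (B 0 w)) / s \<partial>M) = (1 - phi M (B 0) s) / s"
    unfolding phi_def integral_divide_zero using exp_int
    by (subst Bochner_Integration.integral_diff) (auto simp: prob_space)
  show ?thesis
    unfolding laplace_R_eq_expectation[OF s]
    by (simp only: Bochner_Integration.integral_add[OF Bochner_Integration.integrable_add[OF i0 prod0(2)] prod1(2)]
        Bochner_Integration.integral_add[OF i0 prod0(2)] e0 prod0(1) prod1(1) chi0_def chi1_def)
qed

lemma functional_equation:
  assumes s: "Re s > 0"
    and ne: "\<And>i. i \<in> {1..K} \<Longrightarrow> scaled a0 s \<noteq> of_real (\<mu> i)"
      "\<And>i. i \<in> {1..L} \<Longrightarrow> scaled a1 s \<noteq> of_real (\<nu> i)"
  defines "\<rho> \<equiv> laplace R"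
  shows "\<rho> s = gain_term a0 (chi0 M (B 0) (T 0)) K q \<mu> (\<lambda>_. 1) s * \<rho> (scaled a0 s) +
    gain_term a1 (chi1 M (B 0) (T 0)) L h \<nu> (\<lambda>_. 1) s * \<rho> (scaled a1 s) +
    K_fun a0 a1 (phi M (B 0)) (chi0 M (B 0) (T 0)) (chi1 M (B 0) (T 0)) K q \<mu> L h \<nu>
      (\<lambda>i. \<rho> (\<mu> i)) (\<lambda>i. \<rho> (\<nu> i)) s"
proof -
  have gt: "x s * ((\<Sum>i=1..N. of_real (p i) * (of_real (r i) / (of_real (r i) - scaled a s)) *
      (\<rho> (scaled a s) - \<rho> (of_real (r i)))) / of_real (1 + a)) =
      gain_term a x N p r (\<lambda>_. 1) s * \<rho> (scaled a s) - gain_term a x N p r (\<lambda>i. \<rho> (r i)) s"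
    for x N p r a
  proof -
    have sum: "(\<Sum>i=1..N. of_real (p i) * (of_real (r i) / (of_real (r i) - scaled a s)) *
        (\<rho> (scaled a s) - \<rho> (of_real (r i)))) =
      (\<Sum>i=1..N. of_real (p i) * (of_real (r i) / (of_real (r i) - scaled a s)) * 1) *
        \<rho> (scaled a s) -
      (\<Sum>i=1..N. of_real (p i) * (of_real (r i) / (of_real (r i) - scaled a s)) * \<rho> (of_real (r i)))"
      by (simp only: right_diff_distrib sum_subtractf sum_distrib_right mult_1_right)
    have alg: "X * ((Y * Z - V) / b) = X / b * Y * Z - X / b * V" for X Y Z V b :: complex
      by (simp add: diff_divide_distrib algebra_simps)
    show ?thesis unfolding sum gain_term_def chi_hat_def by (rule alg)
  qed
  show ?thesis
    unfolding \<rho>_def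
    by (subst laplace_R_eq[OF s],
        subst expectation_laplace_shifted[OF rv(3) C0_law q \<mu> a_pos(1) s ne(1)], assumption,
        subst expectation_laplace_shifted[OF rv(4) C1_law h \<nu> a_pos(2) s ne(2)], assumption)
      (simp only: gt[unfolded \<rho>_def] K_fun_def, simp)
qed

end

section \<open>The risk model as an instance of the analytic setting\<close>

context dual_risk
begin

lemma gain_system:
  "gain_system a0 a1 (prob {w \<in> space M. T 0 w \<ge> B 0 w}) (prob {w \<in> space M. T 0 w < B 0 w})
    (chi0 M (B 0) (T 0)) (chi1 M (B 0) (T 0)) K L q \<mu> h \<nu>"
proof
  have W: "Measurable.pred M (\<lambda>w. T 0 w \<ge> B 0 w)" "Measurable.pred M (\<lambda>w. T 0 w < B 0 w)"
    by measurable
  note tr = B_mean B_pos[of 0]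
  have "prob {w \<in> space M. T 0 w < B 0 w} = prob (space M - {w \<in> space M. T 0 w \<ge> B 0 w})"
    by (rule arg_cong[where f = prob]) auto
  then show "prob {w \<in> space M. T 0 w \<ge> B 0 w} + prob {w \<in> space M. T 0 w < B 0 w} = 1"
    by (simp add: prob_compl)
  show "cmod (chi0 M (B 0) (T 0) s) \<le> prob {w \<in> space M. T 0 w \<ge> B 0 w}" if "Re s \<ge> 0" for s
    unfolding chi0_def by (rule transform_norm_le[OF tr W(1) that])
  show "cmod (chi1 M (B 0) (T 0) s) \<le> prob {w \<in> space M. T 0 w < B 0 w}" if "Re s \<ge> 0" for s
    unfolding chi1_def by (rule transform_norm_le[OF tr W(2) that])
  show "continuous_on cRHP (chi0 M (B 0) (T 0))"
    unfolding chi0_def[abs_def] by (rule transform_continuous_on[OF tr W(1)])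
  show "continuous_on cRHP (chi1 M (B 0) (T 0))"
    unfolding chi1_def[abs_def] by (rule transform_continuous_on[OF tr W(2)])
  show "chi0 M (B 0) (T 0) holomorphic_on RHP"
    unfolding chi0_def[abs_def] by (rule transform_holomorphic[OF tr W(1)])
  show "chi1 M (B 0) (T 0) holomorphic_on RHP"
    unfolding chi1_def[abs_def] by (rule transform_holomorphic[OF tr W(2)])
qed (use a_pos q h \<mu> \<nu> in auto)

text \<open>The Lipschitz estimate between 0 and s, as phi(0) = 1. At s = 0 the quotient is 0 by
  convention and the bound reduces to nonnegativity of the mean.\<close>

lemma phi_quotient_bound:
  assumes s: "Re s \<ge> 0"
  shows "cmod ((1 - phi M (B 0) s) / s) \<le> expectation (B 0)"
proof (cases "s = 0")
  case True
  then show ?thesis using B_pos[of 0] by (auto intro!: integral_nonneg_AE)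
next
  case False
  have "cmod (phi M (B 0) 0 - phi M (B 0) s) \<le> expectation (B 0) * cmod (0 - s)"
    using transform_lipschitz[OF B_mean B_pos[of 0], of "\<lambda>_. True" 0 s] s by (simp add: phi_def)
  moreover have "phi M (B 0) 0 = 1" by (simp add: phi_def prob_space)
  ultimately show ?thesis using False by (simp add: norm_divide divide_le_eq)
qed

end

theorem mainTheorem4:
  fixes M :: "'a measure"
    and B T C0 C1 :: "nat \<Rightarrow> 'a \<Rightarrow> real"
    and f :: "real \<Rightarrow> ennreal"
    and a0 a1 :: real
    and K L :: nat
    and q \<mu> h \<nu> :: "nat \<Rightarrow> real"
    and \<rho> L10 L01 :: "complex \<Rightarrow> complex"
    and Kf :: "(nat \<Rightarrow> complex) \<Rightarrow> (nat \<Rightarrow> complex) \<Rightarrow> complex \<Rightarrow> complex"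
  assumes prob_space: "prob_space M"
    and indep: "prob_space.indep_vars M (\<lambda>_. borel) (source_var B T C0 C1) UNIV"
    and B_density: "\<And>n. distributed M lborel (B n) f"
    and B_pos: "\<And>n. AE \<omega> in M. B n \<omega> > 0"
    and B_mean: "integrable M (B 0)"
    and T_ident: "\<And>n. distr M borel (T n) = distr M borel (T 0)"
    and a_pos: "a0 > 0" "a1 > 0"
    and q: "\<And>i. i \<in> {1..K} \<Longrightarrow> q i \<ge> 0" "(\<Sum>i=1..K. q i) = 1"
    and h: "\<And>i. i \<in> {1..L} \<Longrightarrow> h i \<ge> 0" "(\<Sum>i=1..L. h i) = 1"
    and \<mu>: "\<And>i. i \<in> {1..K} \<Longrightarrow> \<mu> i > 0"
    and \<nu>: "\<And>i. i \<in> {1..L} \<Longrightarrow> \<nu> i > 0"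
    and C0_cdf: "\<And>n x. x \<ge> 0 \<Longrightarrow>
      Sigma_Algebra.measure M {\<omega> \<in> space M. C0 n \<omega> \<le> x} = (\<Sum>i=1..K. q i * (1 - exp (- \<mu> i * x)))"
    and C1_cdf: "\<And>n x. x \<ge> 0 \<Longrightarrow>
      Sigma_Algebra.measure M {\<omega> \<in> space M. C1 n \<omega> \<le> x} = (\<Sum>i=1..L. h i * (1 - exp (- \<nu> i * x)))"
    and \<rho>_eq: "\<rho> = rho M a0 a1 B T C0 C1"
    and L10_eq: "L10 = gain_term a0 (chi0 M (B 0) (T 0)) K q \<mu> (\<lambda>_. 1)"
    and L01_eq: "L01 = gain_term a1 (chi1 M (B 0) (T 0)) L h \<nu> (\<lambda>_. 1)"
    and Kf_eq: "Kf = K_fun a0 a1 (phi M (B 0)) (chi0 M (B 0) (T 0)) (chi1 M (B 0) (T 0)) K q \<mu> L h \<nu>"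
  shows "(\<forall>s. Re s > 0 \<longrightarrow> s \<notin> singular_points a0 a1 K \<mu> L \<nu> \<longrightarrow>
            convergent (L_diag a0 a1 L10 L01 s) \<and>
            summable (LK_diag a0 a1 L10 L01 (Kf (\<lambda>i. \<rho> (\<mu> i)) (\<lambda>i. \<rho> (\<nu> i))) s) \<and>
            \<rho> s = series_rhs a0 a1 L10 L01 (Kf (\<lambda>i. \<rho> (\<mu> i)) (\<lambda>i. \<rho> (\<nu> i))) s)
       \<and> (\<forall>y z. solves_system (singular_points a0 a1 K \<mu> L \<nu>)
                   (\<lambda>y z. series_rhs a0 a1 L10 L01 (Kf y z)) K \<mu> L \<nu> y z \<longleftrightarrow>
                 (\<forall>i\<in>{1..K}. y i = \<rho> (\<mu> i)) \<and> (\<forall>i\<in>{1..L}. z i = \<rho> (\<nu> i)))"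
proof -
  interpret dual_risk M B T C0 C1 f a0 a1 K L q \<mu> h \<nu>
    by (rule dual_risk.intro[OF prob_space], rule dual_risk_axioms.intro)
      (fact indep B_density B_pos B_mean T_ident a_pos q h \<mu> \<nu> C0_cdf C1_cdf)+
  interpret gain_system a0 a1 "prob {\<omega> \<in> space M. T 0 \<omega> \<ge> B 0 \<omega>}" "prob {\<omega> \<in> space M. T 0 \<omega> < B 0 \<omega>}"
    "chi0 M (B 0) (T 0)" "chi1 M (B 0) (T 0)" K L q \<mu> h \<nu>
    by (rule gain_system)
  have \<rho>: "\<rho> = laplace R" by (simp only: \<rho>_eq rho_eq_laplace)
  obtain C where C: "C \<ge> 0" "\<And>x. x > 0 \<Longrightarrow> R x \<le> C / x" using R_le by blast
  have bound: "cmod (\<rho> s) \<le> (1 + C) / sqrt (Re s)" if "Re s > 0" for s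
    unfolding \<rho> by (rule laplace_bound_sqrt[OF R_measurable R_bounds C that])
  have cont: "isCont \<rho> s" if "Re s > 0" for s
    unfolding \<rho> by (rule laplace_isCont[OF R_measurable R_bounds that])
  have eq: "\<rho> s = gain_op a0 a1 L10 L01 \<rho> s + Kf (\<lambda>i. \<rho> (\<mu> i)) (\<lambda>i. \<rho> (\<nu> i)) s"
    if "Re s > 0" "s \<notin> singular_points a0 a1 K \<mu> L \<nu>" for s
    unfolding gain_op_def L10_eq L01_eq Kf_eq unfolding \<rho>
    by (rule functional_equation[OF that(1) S_scaled(3,4)[OF that(2)]])
  note main = system_characterizes[OF phi_quotient_bound bound _ cont eq[unfolded L10_eq L01_eq Kf_eq],
      folded L10_eq L01_eq Kf_eq]
  show ?thesis
    using main C(1) by simp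
qed

end
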